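(* Let $E$ be a finite directed graph, $K$ a field, and $c$ a basic closed path in $E$. (1) For each integer $n\ge 1$, the left $L_K(E)$-module $M_{E,n,c-1}=L_K(E)/L_K(E)(c-1)^n$ has a unique composition series, with all composition factors isomorphic to $V_{[c^\infty]}$. (2) The Prüfer left $L_K(E)$-module $U_{E,c-1}$ is uniserial and artinian (and not noetherian).
   Context: All modules are left modules. A module is uniserial if its submodules are totally ordered by inclusion. A directed graph $E=(E^0,E^1,s,r)$ has vertex set $E^0$, edge set $E^1$, and source and range maps $s,r:E^1\to E^0$; it is finite if $E^0$ and $E^1$ are finite. A path is a sequence $e_1\cdots e_n$ of edges with $r(e_i)=s(e_{i+1})$; vertices are paths of length $0$. A closed path is a path $e_1\cdots e_n$, $n\ge 1$, with $r(e_n)=s(e_1)$; it is basic if it is not of the form $\delta^k$ with $\delta$ a closed path and $k\ge 2$. The Leavitt path algebra $L_K(E)$ is the $K$-algebra generated by $E^0\cup\{e,e^*: e\in E^1\}$ with relations: $vu=\delta_{v,u}v$ for $v,u\in E^0$; $s(e)e=er(e)=e$ and $r(e)e^*=e^*s(e)=e^*$ for $e\in E^1$; $e^*e'=\delta_{e,e'}r(e)$ for $e,e'\in E^1$; $v=\sum_{s(e)=v}ee^*$ for each $v\in E^0$ with $0<|s^{-1}(v)|<\infty$. For finite $E$ it is unital with $1=\sum_{v\in E^0}v$. Chen simple module: an infinite path is a sequence $e_1e_2e_3\cdots$ of edges with $r(e_i)=s(e_{i+1})$; two infinite paths are tail equivalent if they coincide after deleting suitable finite initial segments; $[p]$ is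 the tail-equivalence class of $p$; $c^\infty=ccc\cdots$. $V_{[p]}$ is the $K$-vector space with basis $[p]$, with left $L_K(E)$-action given, for $q=f_1f_2\cdots\in[p]$, by $v\cdot q=q$ if $v=s(f_1)$ and $0$ otherwise; $e\cdot q=eq$ if $r(e)=s(f_1)$ and $0$ otherwise; $e^*\cdot q=f_2f_3\cdots$ if $e=f_1$ and $0$ otherwise. It is a simple module. Prüfer module: for $1\le i\le j$ let $\psi_{E,i,j}:M_{E,i,c-1}\to M_{E,j,c-1}$ be the $L_K(E)$-homomorphism with $1+L_K(E)(c-1)^i\mapsto (c-1)^{j-i}+L_K(E)(c-1)^j$ (these are monomorphisms). Then $U_{E,c-1}=\varinjlim\{M_{E,i,c-1},\psi_{E,i,j}\}_{i\le j}$. *)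

theory Defs
  imports
    "HOL-Library.Poly_Mapping"
    "HOL-Library.Stream"
    "Graph_Theory.Graph_Theory"
    "HOL-Algebra.Module"
    "HOL-Algebra.QuotRing"
begin

section \<open>Left modules over a ring\<close>

text \<open>
  The library locale \<^locale>\<open>module\<close> demands a commutative ring, so left modules over an
  arbitrary ring are introduced here. The record type \<open>module\<close> and the locale \<^locale>\<open>submodule\<close>
  (which does not refer to commutativity) are reused; the fields \<open>mult\<close> and \<open>one\<close> that a module
  record inherits from rings play no role.
\<close>

locale left_module = R?: ring R + M?: abelian_group M
  for R :: "('a, 'r) ring_scheme" (structure) and M :: "('a, 'b, 'm) module_scheme" (structure) +
  assumes smult_closed:
      "\<lbrakk>a \<in> carrier R; x \<in> carrier M\<rbrakk> \<Longrightarrow> a \<odot>\<^bsub>M\<^esub> x \<in> carrier M"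
    and smult_l_distr:
      "\<lbrakk>a \<in> carrier R; b \<in> carrier R; x \<in> carrier M\<rbrakk> \<Longrightarrow>
        (a \<oplus>\<^bsub>R\<^esub> b) \<odot>\<^bsub>M\<^esub> x = a \<odot>\<^bsub>M\<^esub> x \<oplus>\<^bsub>M\<^esub> b \<odot>\<^bsub>M\<^esub> x"
    and smult_r_distr:
      "\<lbrakk>a \<in> carrier R; x \<in> carrier M; y \<in> carrier M\<rbrakk> \<Longrightarrow>
        a \<odot>\<^bsub>M\<^esub> (x \<oplus>\<^bsub>M\<^esub> y) = a \<odot>\<^bsub>M\<^esub> x \<oplus>\<^bsub>M\<^esub> a \<odot>\<^bsub>M\<^esub> y"
    and smult_assoc:
      "\<lbrakk>a \<in> carrier R; b \<in> carrier R; x \<in> carrier M\<rbrakk> \<Longrightarrow>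
        (a \<otimes>\<^bsub>R\<^esub> b) \<odot>\<^bsub>M\<^esub> x = a \<odot>\<^bsub>M\<^esub> (b \<odot>\<^bsub>M\<^esub> x)"
    and smult_one:
      "x \<in> carrier M \<Longrightarrow> \<one>\<^bsub>R\<^esub> \<odot>\<^bsub>M\<^esub> x = x"

definition left_module_hom ::
    "('a, 'r) ring_scheme \<Rightarrow> ('a, 'b, 'm) module_scheme \<Rightarrow> ('a, 'c, 'n) module_scheme \<Rightarrow> ('b \<Rightarrow> 'c) set" where
  "left_module_hom R M N =
    {h \<in> carrier M \<rightarrow> carrier N.
      (\<forall>x\<in>carrier M. \<forall>y\<in>carrier M. h (x \<oplus>\<^bsub>M\<^esub> y) = h x \<oplus>\<^bsub>N\<^esub> h y) \<and>
      (\<forall>a\<in>carrier R. \<forall>x\<in>carrier M. h (a \<odot>\<^bsub>M\<^esub> x) = a \<odot>\<^bsub>N\<^esub> h x)}"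

definition left_module_isomorphic ::
    "('a, 'r) ring_scheme \<Rightarrow> ('a, 'b, 'm) module_scheme \<Rightarrow> ('a, 'c, 'n) module_scheme \<Rightarrow> bool" where
  "left_module_isomorphic R M N \<longleftrightarrow>
    (\<exists>h\<in>left_module_hom R M N. bij_betw h (carrier M) (carrier N))"

definition regular_module :: "('a, 'r) ring_scheme \<Rightarrow> ('a, 'a) module" where
  "regular_module R =
    \<lparr>carrier = carrier R, mult = mult R, one = one R, zero = zero R, add = add R,
     smult = mult R\<rparr>"

text \<open>The quotient module \<open>M / N\<close>, with the same coset conventions as \<^const>\<open>FactRing\<close>.\<close>

definition quot_module :: "('a, 'b, 'm) module_scheme \<Rightarrow> 'b set \<Rightarrow> ('a, 'b set) module" where
  "quot_module M N =
    \<lparr>carrier = a_rcosets\<^bsub>M\<^esub> N, mult = undefined, one = undefined,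
     zero = N, add = set_add M,
     smult = (\<lambda>a X. \<Union>x\<in>X. N +>\<^bsub>M\<^esub> (a \<odot>\<^bsub>M\<^esub> x))\<rparr>"

definition simple_module :: "('a, 'r) ring_scheme \<Rightarrow> ('a, 'b, 'm) module_scheme \<Rightarrow> bool" where
  "simple_module R M \<longleftrightarrow>
    left_module R M \<and> carrier M \<noteq> {\<zero>\<^bsub>M\<^esub>} \<and>
    (\<forall>N. submodule N R M \<longrightarrow> N = {\<zero>\<^bsub>M\<^esub>} \<or> N = carrier M)"

definition uniserial_module :: "('a, 'r) ring_scheme \<Rightarrow> ('a, 'b, 'm) module_scheme \<Rightarrow> bool" where
  "uniserial_module R M \<longleftrightarrow>
    (\<forall>N N'. submodule N R M \<longrightarrow> submodule N' R M \<longrightarrow> N \<subseteq> N' \<or> N' \<subseteq> N)"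

definition artinian_module :: "('a, 'r) ring_scheme \<Rightarrow> ('a, 'b, 'm) module_scheme \<Rightarrow> bool" where
  "artinian_module R M \<longleftrightarrow>
    (\<forall>N :: nat \<Rightarrow> 'b set. (\<forall>i. submodule (N i) R M) \<and> (\<forall>i. N (Suc i) \<subseteq> N i) \<longrightarrow>
      (\<exists>m. \<forall>i\<ge>m. N i = N m))"

definition noetherian_module :: "('a, 'r) ring_scheme \<Rightarrow> ('a, 'b, 'm) module_scheme \<Rightarrow> bool" where
  "noetherian_module R M \<longleftrightarrow>
    (\<forall>N :: nat \<Rightarrow> 'b set. (\<forall>i. submodule (N i) R M) \<and> (\<forall>i. N i \<subseteq> N (Suc i)) \<longrightarrow>
      (\<exists>m. \<forall>i\<ge>m. N i = N m))"

text \<open>The factor \<open>N\<^sub>i\<^sub>+\<^sub>1 / N\<^sub>i\<close> of a chain of submodules of \<open>M\<close>.\<close>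

definition chain_factor ::
    "('a, 'b, 'm) module_scheme \<Rightarrow> 'b set list \<Rightarrow> nat \<Rightarrow> ('a, 'b set) module" where
  "chain_factor M Ns i = quot_module (M\<lparr>carrier := Ns ! Suc i\<rparr>) (Ns ! i)"

text \<open>A composition series \<open>0 = N\<^sub>0 \<subset> N\<^sub>1 \<subset> \<dots> \<subset> N\<^sub>l = M\<close>, given as the list \<open>[N\<^sub>0, \<dots>, N\<^sub>l]\<close>.\<close>

definition composition_series ::
    "('a, 'r) ring_scheme \<Rightarrow> ('a, 'b, 'm) module_scheme \<Rightarrow> 'b set list \<Rightarrow> bool" where
  "composition_series R M Ns \<longleftrightarrow>
    Ns \<noteq> [] \<and> hd Ns = {\<zero>\<^bsub>M\<^esub>} \<and> last Ns = carrier M \<and>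
    (\<forall>N\<in>set Ns. submodule N R M) \<and>
    (\<forall>i. Suc i < length Ns \<longrightarrow>
      Ns ! i \<subset> Ns ! Suc i \<and> simple_module R (chain_factor M Ns i))"

text \<open>
  The direct limit of a directed system \<open>(M\<^sub>i, \<phi>\<^sub>i\<^sub>j)\<close> of modules: the disjoint union of the \<open>M\<^sub>i\<close>,
  modulo identification of \<open>x \<in> M\<^sub>i\<close> and \<open>y \<in> M\<^sub>j\<close> whenever they have the same image in some \<open>M\<^sub>k\<close>.
\<close>

definition dlim_rel ::
    "'i::preorder set \<Rightarrow> ('i \<Rightarrow> ('a, 'b, 'm) module_scheme) \<Rightarrow> ('i \<Rightarrow> 'i \<Rightarrow> 'b \<Rightarrow> 'b) \<Rightarrow> ('i \<times> 'b) rel" where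
  "dlim_rel I M \<phi> =
    {((i, x), (j, y)). i \<in> I \<and> j \<in> I \<and> x \<in> carrier (M i) \<and> y \<in> carrier (M j) \<and>
      (\<exists>k\<in>I. i \<le> k \<and> j \<le> k \<and> \<phi> i k x = \<phi> j k y)}"

definition direct_limit ::
    "'i::preorder set \<Rightarrow> ('i \<Rightarrow> ('a, 'b, 'm) module_scheme) \<Rightarrow> ('i \<Rightarrow> 'i \<Rightarrow> 'b \<Rightarrow> 'b) \<Rightarrow>
      ('a, ('i \<times> 'b) set) module" where
  "direct_limit I M \<phi> =
    \<lparr>carrier = (SIGMA i:I. carrier (M i)) // dlim_rel I M \<phi>,
     mult = undefined, one = undefined,
     zero = (\<Union>i\<in>I. dlim_rel I M \<phi> `` {(i, \<zero>\<^bsub>M i\<^esub>)}),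
     add = (\<lambda>X Y. \<Union>(i, x)\<in>X. \<Union>(j, y)\<in>Y. \<Union>k\<in>{k\<in>I. i \<le> k \<and> j \<le> k}.
        dlim_rel I M \<phi> `` {(k, \<phi> i k x \<oplus>\<^bsub>M k\<^esub> \<phi> j k y)}),
     smult = (\<lambda>a X. \<Union>(i, x)\<in>X. dlim_rel I M \<phi> `` {(i, a \<odot>\<^bsub>M i\<^esub> x)})\<rparr>"


section \<open>Quotients by powers of an element and the associated Pruefer module\<close>

text \<open>
  \<^const>\<open>cgenideal\<close> (notation \<open>PIdl\<close>) is defined for arbitrary rings as the set of all \<open>x \<otimes> a\<close>,
  that is, as the left ideal \<open>R a\<close>.
\<close>

definition power_quot :: "('a, 'r) ring_scheme \<Rightarrow> 'a \<Rightarrow> nat \<Rightarrow> ('a, 'a set) module" where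
  "power_quot R a n = quot_module (regular_module R) (PIdl\<^bsub>R\<^esub> (a [^]\<^bsub>R\<^esub> n))"

text \<open>
  Right multiplication \<open>x + R a\<^sup>i \<mapsto> x a\<^sup>j\<^sup>-\<^sup>i + R a\<^sup>j\<close> for \<open>i \<le> j\<close>. By \<open>power_quot_map_hom\<close>,
  \<open>power_quot_map_one\<close> and \<open>power_quot_map_unique\<close> below, this is the homomorphism of left modules
  with \<open>1 + R a\<^sup>i \<mapsto> a\<^sup>j\<^sup>-\<^sup>i + R a\<^sup>j\<close>.
\<close>

definition power_quot_map :: "('a, 'r) ring_scheme \<Rightarrow> 'a \<Rightarrow> nat \<Rightarrow> nat \<Rightarrow> 'a set \<Rightarrow> 'a set" where
  "power_quot_map R a i j X =
    (\<Union>x\<in>X. PIdl\<^bsub>R\<^esub> (a [^]\<^bsub>R\<^esub> j) +>\<^bsub>R\<^esub> (x \<otimes>\<^bsub>R\<^esub> a [^]\<^bsub>R\<^esub> (j - i)))"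

lemma (in ring) cgenideal_iff: "x \<in> PIdl a \<longleftrightarrow> (\<exists>r\<in>carrier R. x = r \<otimes> a)"
  by (auto simp: cgenideal_def)

lemma (in ring) left_principal_subgroup:
  assumes a: "a \<in> carrier R"
  shows "additive_subgroup (PIdl a) R"
proof (rule additive_subgroup.intro, rule add.subgroupI)
  show "PIdl a \<subseteq> carrier R" using a by (auto simp: cgenideal_iff)
  show "PIdl a \<noteq> {}" using a by (auto simp: cgenideal_def)
  show "\<ominus> x \<in> PIdl a" if "x \<in> PIdl a" for x
  proof -
    from that obtain r where "r \<in> carrier R" "x = r \<otimes> a" by (auto simp: cgenideal_iff)
    then show ?thesis using a unfolding cgenideal_iff by (intro bexI[of _ "\<ominus> r"]) (auto simp: l_minus)
  qed
  show "x \<oplus> y \<in> PIdl a" if "x \<in> PIdl a" "y \<in> PIdl a" for x y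
  proof -
    from that obtain r s where "r \<in> carrier R" "x = r \<otimes> a" "s \<in> carrier R" "y = s \<otimes> a"
      by (auto simp: cgenideal_iff)
    then show ?thesis using a unfolding cgenideal_iff by (intro bexI[of _ "r \<oplus> s"]) (auto simp: l_distr)
  qed
qed

lemma (in ring) left_principal_abelian_subgroup:
  assumes a: "a \<in> carrier R"
  shows "abelian_subgroup (PIdl a) R"
  using left_principal_subgroup[OF a] by (intro abelian_subgroupI3 is_abelian_group)

lemma (in ring) left_principal_coset_eq:
  assumes a: "a \<in> carrier R" and x: "x \<in> carrier R" and y: "y \<in> carrier R"
  shows "PIdl a +> x = PIdl a +> y \<longleftrightarrow> (\<exists>r\<in>carrier R. x \<ominus> y = r \<otimes> a)"
proof -
  interpret abelian_subgroup "PIdl a" R by (rule left_principal_abelian_subgroup[OF a])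
  have "PIdl a +> x = PIdl a +> y \<longleftrightarrow> x \<in> PIdl a +> y"
    using x y a_repr_independence'[of x y] a_rcos_self[of x] by auto
  also have "\<dots> \<longleftrightarrow> x \<ominus> y \<in> PIdl a"
    using a_rcos_module_minus[OF ring_axioms y x] by simp
  finally show ?thesis by (simp add: cgenideal_iff)
qed

lemma power_quot_simps:
  "carrier (power_quot R a n) = a_rcosets\<^bsub>R\<^esub> (PIdl\<^bsub>R\<^esub> (a [^]\<^bsub>R\<^esub> n))"
  "add (power_quot R a n) = set_add R"
  "smult (power_quot R a n) =
    (\<lambda>b X. \<Union>x\<in>X. PIdl\<^bsub>R\<^esub> (a [^]\<^bsub>R\<^esub> n) +>\<^bsub>R\<^esub> (b \<otimes>\<^bsub>R\<^esub> x))"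
  by (simp_all add: power_quot_def quot_module_def regular_module_def A_RCOSETS_defs
      A_RCOSETS_def a_r_coset_def r_coset_def set_add_def set_mult_def fun_eq_iff)

lemma (in ring) UN_coset_eq:
  assumes a: "a \<in> carrier R" and b: "b \<in> carrier R" and x: "x \<in> carrier R"
    and g: "\<And>z. z \<in> carrier R \<Longrightarrow> g z \<in> carrier R"
    and cong: "\<And>y. \<lbrakk>y \<in> carrier R; PIdl a +> y = PIdl a +> x\<rbrakk> \<Longrightarrow> PIdl b +> g y = PIdl b +> g x"
  shows "(\<Union>y\<in>PIdl a +> x. PIdl b +> g y) = PIdl b +> g x"
proof -
  interpret abelian_subgroup "PIdl a" R by (rule left_principal_abelian_subgroup[OF a])
  have "PIdl b +> g y = PIdl b +> g x" if "y \<in> PIdl a +> x" for y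
    using that x cong[of y] a_elemrcos_carrier[OF x that] a_repr_independence'[OF that x] by simp
  moreover have "x \<in> PIdl a +> x" using x by (rule a_rcos_self)
  ultimately show ?thesis by blast
qed

lemma (in ring) power_quot_map_coset:
  assumes a: "a \<in> carrier R" and x: "x \<in> carrier R" and ij: "i \<le> j"
  shows "power_quot_map R a i j (PIdl (a [^] i) +> x) = PIdl (a [^] j) +> (x \<otimes> a [^] (j - i))"
  unfolding power_quot_map_def
proof (rule UN_coset_eq)
  fix y assume y: "y \<in> carrier R" and eq: "PIdl (a [^] i) +> y = PIdl (a [^] i) +> x"
  then obtain r where r: "r \<in> carrier R" "y \<ominus> x = r \<otimes> a [^] i"
    using left_principal_coset_eq a x by (metis nat_pow_closed)
  have "y \<otimes> a [^] (j - i) \<ominus> x \<otimes> a [^] (j - i) = (y \<ominus> x) \<otimes> a [^] (j - i)"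
    using a x y by (simp add: minus_eq l_distr l_minus)
  also have "\<dots> = r \<otimes> a [^] j"
    using a r ij by (simp add: m_assoc nat_pow_mult)
  finally show "PIdl (a [^] j) +> (y \<otimes> a [^] (j - i)) = PIdl (a [^] j) +> (x \<otimes> a [^] (j - i))"
    using a x y r by (subst left_principal_coset_eq) auto
qed (use a x in auto)

lemma (in ring) power_quot_smult_coset:
  assumes a: "a \<in> carrier R" and x: "x \<in> carrier R" and b: "b \<in> carrier R"
  shows "b \<odot>\<^bsub>power_quot R a n\<^esub> (PIdl (a [^] n) +> x) = PIdl (a [^] n) +> (b \<otimes> x)"
  unfolding power_quot_simps
proof (rule UN_coset_eq)
  fix y assume y: "y \<in> carrier R" and eq: "PIdl (a [^] n) +> y = PIdl (a [^] n) +> x"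
  then obtain r where r: "r \<in> carrier R" "y \<ominus> x = r \<otimes> a [^] n"
    using left_principal_coset_eq a x by (metis nat_pow_closed)
  have "b \<otimes> y \<ominus> b \<otimes> x = b \<otimes> (y \<ominus> x)"
    using b x y by (simp add: minus_eq r_distr r_minus)
  also have "\<dots> = (b \<otimes> r) \<otimes> a [^] n"
    using a b r by (simp add: m_assoc)
  finally show "PIdl (a [^] n) +> (b \<otimes> y) = PIdl (a [^] n) +> (b \<otimes> x)"
    using a b x y r by (subst left_principal_coset_eq) auto
qed (use a x b in auto)

lemma (in ring) power_quot_add_coset:
  assumes a: "a \<in> carrier R" and x: "x \<in> carrier R" and y: "y \<in> carrier R"
  shows "(PIdl (a [^] n) +> x) \<oplus>\<^bsub>power_quot R a n\<^esub> (PIdl (a [^] n) +> y) = PIdl (a [^] n) +> (x \<oplus> y)"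
proof -
  interpret abelian_subgroup "PIdl (a [^] n)" R
    by (rule left_principal_abelian_subgroup) (use a in auto)
  show ?thesis unfolding power_quot_simps using x y by (rule a_rcos_sum)
qed

lemma power_quot_carrierE:
  assumes "X \<in> carrier (power_quot R a n)"
  obtains x where "x \<in> carrier R" "X = PIdl\<^bsub>R\<^esub> (a [^]\<^bsub>R\<^esub> n) +>\<^bsub>R\<^esub> x"
  using assms unfolding power_quot_simps A_RCOSETS_def' a_r_coset_def' by auto

lemma power_quot_carrierI:
  assumes "x \<in> carrier R"
  shows "PIdl\<^bsub>R\<^esub> (a [^]\<^bsub>R\<^esub> n) +>\<^bsub>R\<^esub> x \<in> carrier (power_quot R a n)"
  using assms unfolding power_quot_simps A_RCOSETS_def' a_r_coset_def' by auto

lemma (in ring) power_quot_map_hom: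
  assumes a: "a \<in> carrier R" and ij: "i \<le> j"
  shows "power_quot_map R a i j \<in> left_module_hom R (power_quot R a i) (power_quot R a j)"
  unfolding left_module_hom_def
  using assms
  by (auto elim!: power_quot_carrierE simp: power_quot_map_coset power_quot_smult_coset
      power_quot_add_coset l_distr m_assoc intro!: power_quot_carrierI)

lemma (in ring) power_quot_map_one:
  assumes "a \<in> carrier R" and "i \<le> j"
  shows "power_quot_map R a i j (PIdl (a [^] i) +> \<one>) = PIdl (a [^] j) +> a [^] (j - i)"
  using assms by (simp add: power_quot_map_coset)

lemma (in ring) power_quot_map_unique:
  assumes a: "a \<in> carrier R" and ij: "i \<le> j"
    and h: "h \<in> left_module_hom R (power_quot R a i) (power_quot R a j)"
    and one: "h (PIdl (a [^] i) +> \<one>) = PIdl (a [^] j) +> a [^] (j - i)"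
    and X: "X \<in> carrier (power_quot R a i)"
  shows "h X = power_quot_map R a i j X"
proof -
  obtain x where x: "x \<in> carrier R" "X = PIdl (a [^] i) +> x"
    using X by (rule power_quot_carrierE)
  have "X = x \<odot>\<^bsub>power_quot R a i\<^esub> (PIdl (a [^] i) +> \<one>)"
    using a x by (simp add: power_quot_smult_coset)
  then have "h X = x \<odot>\<^bsub>power_quot R a j\<^esub> h (PIdl (a [^] i) +> \<one>)"
    using h x power_quot_carrierI[of \<one> R a i] unfolding left_module_hom_def by auto
  then show ?thesis
    using a x ij by (simp add: one power_quot_smult_coset power_quot_map_coset)
qed

definition pruefer_module :: "('a, 'r) ring_scheme \<Rightarrow> 'a \<Rightarrow> ('a, (nat \<times> 'a set) set) module" where
  "pruefer_module R a = direct_limit {1..} (power_quot R a) (power_quot_map R a)"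


section \<open>Leavitt path algebras\<close>

text \<open>
  Graphs are those of the entry on graph theory: \<^const>\<open>tail\<close> is the source map \<open>s\<close> and
  \<^const>\<open>head\<close> the range map \<open>r\<close>; loops and parallel arcs are allowed.
\<close>

definition closed_path :: "('v, 'e) pre_digraph \<Rightarrow> 'e list \<Rightarrow> bool" where
  "closed_path E p \<longleftrightarrow> p \<noteq> [] \<and> (\<exists>v. pre_digraph.awalk E v p v)"

definition basic_closed_path :: "('v, 'e) pre_digraph \<Rightarrow> 'e list \<Rightarrow> bool" where
  "basic_closed_path E c \<longleftrightarrow>
    closed_path E c \<and> \<not> (\<exists>d k. closed_path E d \<and> k \<ge> 2 \<and> c = concat (replicate k d))"

datatype ('v, 'e) lpa_gen = Vertex 'v | Edge 'e | Ghost 'e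

definition lpa_gens :: "('v, 'e) pre_digraph \<Rightarrow> ('v, 'e) lpa_gen set" where
  "lpa_gens E = Vertex ` verts E \<union> Edge ` arcs E \<union> Ghost ` arcs E"

text \<open>
  The free monoid, written additively so that the convolution product of \<^typ>\<open>'a \<Rightarrow>\<^sub>0 'b\<close> yields
  the free associative algebra.
\<close>

datatype 'g fword = FWord (letters: "'g list")

instantiation fword :: (type) monoid_add
begin
definition zero_fword :: "'a fword" where "zero_fword = FWord []"
definition plus_fword :: "'a fword \<Rightarrow> 'a fword \<Rightarrow> 'a fword" where
  "plus_fword u w = FWord (letters u @ letters w)"
instance by standard (auto simp: zero_fword_def plus_fword_def)
end

type_synonym ('v, 'e, 'k) lpa_free = "('v, 'e) lpa_gen fword \<Rightarrow>\<^sub>0 'k"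
type_synonym ('v, 'e, 'k) lpa = "('v, 'e, 'k) lpa_free set"

definition free_algebra :: "'g set \<Rightarrow> ('g fword \<Rightarrow>\<^sub>0 'k::field) ring" where
  "free_algebra G =
    \<lparr>carrier = {f. \<forall>w\<in>Poly_Mapping.keys f. set (letters w) \<subseteq> G},
     mult = (*), one = 1, zero = 0, add = (+)\<rparr>"

lemma free_algebra_simps:
  "mult (free_algebra G) = (*)" "one (free_algebra G) = 1"
  "zero (free_algebra G) = 0" "add (free_algebra G) = (+)"
  by (simp_all add: free_algebra_def)

lemma free_algebra_closed:
  fixes x y :: "'g fword \<Rightarrow>\<^sub>0 'k::field"
  shows "0 \<in> carrier (free_algebra G :: ('g fword \<Rightarrow>\<^sub>0 'k) ring)"
    and "1 \<in> carrier (free_algebra G :: ('g fword \<Rightarrow>\<^sub>0 'k) ring)"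
    and "\<lbrakk>x \<in> carrier (free_algebra G); y \<in> carrier (free_algebra G)\<rbrakk> \<Longrightarrow> x + y \<in> carrier (free_algebra G)"
    and "\<lbrakk>x \<in> carrier (free_algebra G); y \<in> carrier (free_algebra G)\<rbrakk> \<Longrightarrow> x * y \<in> carrier (free_algebra G)"
    and "x \<in> carrier (free_algebra G) \<Longrightarrow> - x \<in> carrier (free_algebra G)"
proof -
  show "x + y \<in> carrier (free_algebra G)"
    if "x \<in> carrier (free_algebra G)" "y \<in> carrier (free_algebra G)"
    using that Poly_Mapping.keys_add[of x y] unfolding free_algebra_def by auto
  show "x * y \<in> carrier (free_algebra G)"
    if "x \<in> carrier (free_algebra G)" "y \<in> carrier (free_algebra G)"
  proof -
    have "set (letters w) \<subseteq> G" if w: "w \<in> Poly_Mapping.keys (x * y)" for w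
    proof -
      obtain u v where "u \<in> Poly_Mapping.keys x" "v \<in> Poly_Mapping.keys y" "w = u + v"
        using Poly_Mapping.keys_mult[of x y] w by blast
      moreover from this have "set (letters u) \<subseteq> G" "set (letters v) \<subseteq> G"
        using \<open>x \<in> _\<close> \<open>y \<in> _\<close> unfolding free_algebra_def by auto
      ultimately show ?thesis by (simp add: plus_fword_def)
    qed
    then show ?thesis unfolding free_algebra_def by simp
  qed
qed (simp_all add: free_algebra_def zero_fword_def)

lemma free_algebra_ring: "ring (free_algebra G :: ('g fword \<Rightarrow>\<^sub>0 'k::field) ring)"
proof (intro ringI abelian_groupI monoidI, unfold free_algebra_simps)
  show "\<exists>y\<in>carrier (free_algebra G). y + x = 0" if "x \<in> carrier (free_algebra G)"
    for x :: "'g fword \<Rightarrow>\<^sub>0 'k"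
    using free_algebra_closed(5)[OF that] by (intro bexI[of _ "- x"]) simp_all
qed (simp_all only: free_algebra_closed mult.assoc add_0 mult_1_left mult_1_right
      distrib_left distrib_right add.assoc add.commute add.left_commute add_0_right)

definition word_elt :: "'g list \<Rightarrow> 'g fword \<Rightarrow>\<^sub>0 'k::field" where
  "word_elt gs = Poly_Mapping.single (FWord gs) 1"

text \<open>
  A relation \<open>x = y\<close> is encoded as the element \<open>x - y\<close>. Since \<^const>\<open>free_algebra\<close> is the free
  \<^emph>\<open>unital\<close> algebra, the relation \<open>1 = (\<Sum>v\<in>E\<^sup>0. v)\<close>, which for finite \<open>E\<close> describes the unit of the
  Leavitt path algebra, is imposed along with the defining ones.
\<close>

inductive_set lpa_relations :: "('v, 'e) pre_digraph \<Rightarrow> ('v, 'e, 'k::field) lpa_free set"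
  for E :: "('v, 'e) pre_digraph" where
  vertices: "\<lbrakk>v \<in> verts E; u \<in> verts E\<rbrakk> \<Longrightarrow>
    word_elt [Vertex v, Vertex u] - (if v = u then word_elt [Vertex v] else 0) \<in> lpa_relations E"
| source_edge: "e \<in> arcs E \<Longrightarrow> word_elt [Vertex (tail E e), Edge e] - word_elt [Edge e] \<in> lpa_relations E"
| edge_range: "e \<in> arcs E \<Longrightarrow> word_elt [Edge e, Vertex (head E e)] - word_elt [Edge e] \<in> lpa_relations E"
| range_ghost: "e \<in> arcs E \<Longrightarrow> word_elt [Vertex (head E e), Ghost e] - word_elt [Ghost e] \<in> lpa_relations E"
| ghost_source: "e \<in> arcs E \<Longrightarrow> word_elt [Ghost e, Vertex (tail E e)] - word_elt [Ghost e] \<in> lpa_relations E"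
| ghost_edge: "\<lbrakk>e \<in> arcs E; e' \<in> arcs E\<rbrakk> \<Longrightarrow>
    word_elt [Ghost e, Edge e'] - (if e = e' then word_elt [Vertex (head E e)] else 0) \<in> lpa_relations E"
| cuntz_krieger: "\<lbrakk>v \<in> verts E; finite (out_arcs E v); out_arcs E v \<noteq> {}\<rbrakk> \<Longrightarrow>
    word_elt [Vertex v] - (\<Sum>e\<in>out_arcs E v. word_elt [Edge e, Ghost e]) \<in> lpa_relations E"
| unit: "1 - (\<Sum>v\<in>verts E. word_elt [Vertex v]) \<in> lpa_relations E"

definition lpa_ideal :: "('v, 'e) pre_digraph \<Rightarrow> ('v, 'e, 'k::field) lpa_free set" where
  "lpa_ideal E = Idl\<^bsub>free_algebra (lpa_gens E)\<^esub> (lpa_relations E)"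

definition leavitt_path_algebra :: "('v, 'e) pre_digraph \<Rightarrow> ('v, 'e, 'k::field) lpa ring" where
  "leavitt_path_algebra E = free_algebra (lpa_gens E) Quot lpa_ideal E"

definition lpa_path :: "('v, 'e) pre_digraph \<Rightarrow> 'e list \<Rightarrow> ('v, 'e, 'k::field) lpa" where
  "lpa_path E p = lpa_ideal E +>\<^bsub>free_algebra (lpa_gens E)\<^esub> word_elt (map Edge p)"

lemma word_elt_closed:
  "set gs \<subseteq> G \<Longrightarrow> word_elt gs \<in> carrier (free_algebra G :: ('g fword \<Rightarrow>\<^sub>0 'k::field) ring)"
  by (simp add: free_algebra_def word_elt_def)

lemma (in fin_digraph) lpa_relations_closed:
  "(lpa_relations G :: ('a, 'b, 'k::field) lpa_free set) \<subseteq> carrier (free_algebra (lpa_gens G))"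
proof
  let ?F = "free_algebra (lpa_gens G) :: (('a, 'b, 'k) lpa_free) ring"
  note add = free_algebra_closed(3)[where G = "lpa_gens G" and 'k = 'k]
    and zero = free_algebra_closed(1)[where G = "lpa_gens G" and 'k = 'k]
    and one = free_algebra_closed(2)[where G = "lpa_gens G" and 'k = 'k]
  have diff: "x - y \<in> carrier ?F" if "x \<in> carrier ?F" "y \<in> carrier ?F" for x y
    using add[OF that(1) free_algebra_closed(5)[OF that(2)]] by simp
  have sum: "sum f A \<in> carrier ?F" if "\<And>x. x \<in> A \<Longrightarrow> f x \<in> carrier ?F" for f :: "'c \<Rightarrow> _" and A
    using that by (induction A rule: infinite_finite_induct) (auto intro: add zero)
  have [simp]: "Vertex v \<in> lpa_gens G \<longleftrightarrow> v \<in> verts G" "Edge e \<in> lpa_gens G \<longleftrightarrow> e \<in> arcs G"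
    "Ghost e \<in> lpa_gens G \<longleftrightarrow> e \<in> arcs G" for v e
    by (auto simp: lpa_gens_def)
  fix x :: "('a, 'b, 'k) lpa_free" assume "x \<in> lpa_relations G"
  then show "x \<in> carrier ?F"
    by cases (auto intro!: diff zero one sum word_elt_closed)
qed

lemma (in fin_digraph) lpa_ideal_ideal:
  "ideal (lpa_ideal G :: ('a, 'b, 'k::field) lpa_free set) (free_algebra (lpa_gens G))"
  unfolding lpa_ideal_def
  by (intro ring.genideal_ideal free_algebra_ring lpa_relations_closed)

lemma (in fin_digraph) leavitt_path_algebra_ring:
  "ring (leavitt_path_algebra G :: ('a, 'b, 'k::field) lpa ring)"
  unfolding leavitt_path_algebra_def by (rule ideal.quotient_is_ring[OF lpa_ideal_ideal])

lemma lpa_path_closed: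
  assumes "set p \<subseteq> arcs E"
  shows "lpa_path E p \<in> carrier (leavitt_path_algebra E :: ('v, 'e, 'k::field) lpa ring)"
proof -
  have "word_elt (map Edge p) \<in> carrier (free_algebra (lpa_gens E) :: ('v, 'e, 'k) lpa_free ring)"
    using assms by (intro word_elt_closed) (auto simp: lpa_gens_def)
  then show ?thesis
    unfolding leavitt_path_algebra_def lpa_path_def FactRing_def A_RCOSETS_def' a_r_coset_def'
    by auto
qed


section \<open>Chen modules\<close>

definition infinite_path :: "('v, 'e) pre_digraph \<Rightarrow> 'e stream \<Rightarrow> bool" where
  "infinite_path E p \<longleftrightarrow> (\<forall>i. p !! i \<in> arcs E \<and> head E (p !! i) = tail E (p !! Suc i))"

definition tail_class :: "('v, 'e) pre_digraph \<Rightarrow> 'e stream \<Rightarrow> 'e stream set" where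
  "tail_class E p = {q. infinite_path E q \<and> (\<exists>m n. sdrop m p = sdrop n q)}"

text \<open>Generators and words act on infinite paths; \<^const>\<open>None\<close> stands for the value \<open>0\<close>.\<close>

fun gen_act :: "('v, 'e) pre_digraph \<Rightarrow> ('v, 'e) lpa_gen \<Rightarrow> 'e stream \<Rightarrow> 'e stream option" where
  "gen_act E (Vertex v) q = (if v = tail E (shd q) then Some q else None)"
| "gen_act E (Edge e) q = (if head E e = tail E (shd q) then Some (e ## q) else None)"
| "gen_act E (Ghost e) q = (if e = shd q then Some (stl q) else None)"

fun word_act :: "('v, 'e) pre_digraph \<Rightarrow> ('v, 'e) lpa_gen list \<Rightarrow> 'e stream \<Rightarrow> 'e stream option" where
  "word_act E [] q = Some q"
| "word_act E (g # w) q = Option.bind (word_act E w q) (gen_act E g)"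

definition free_act ::
    "('v, 'e) pre_digraph \<Rightarrow> ('v, 'e, 'k::field) lpa_free \<Rightarrow> ('e stream \<Rightarrow>\<^sub>0 'k) \<Rightarrow> ('e stream \<Rightarrow>\<^sub>0 'k)" where
  "free_act E f x =
    (\<Sum>w\<in>Poly_Mapping.keys f. \<Sum>q\<in>Poly_Mapping.keys x.
      (case word_act E (letters w) q of
         None \<Rightarrow> 0
       | Some q' \<Rightarrow> Poly_Mapping.single q' (Poly_Mapping.lookup f w * Poly_Mapping.lookup x q)))"

text \<open>
  The Leavitt path algebra acts through representatives: \<^const>\<open>the_elem\<close> picks the common value
  of \<^term>\<open>free_act E f x\<close> for all \<open>f\<close> in the coset \<open>X\<close>.
\<close>

definition chen_module ::
    "('v, 'e) pre_digraph \<Rightarrow> 'e stream \<Rightarrow> (('v, 'e, 'k::field) lpa, 'e stream \<Rightarrow>\<^sub>0 'k) module" where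
  "chen_module E p =
    \<lparr>carrier = {x. Poly_Mapping.keys x \<subseteq> tail_class E p}, mult = undefined, one = undefined,
     zero = 0, add = (+),
     smult = (\<lambda>X x. the_elem ((\<lambda>f. free_act E f x) ` X))\<rparr>"

end

theory Submission
  imports Defs
begin

text \<open>
  Put \<open>a = c - 1\<close>. Sending \<open>x\<close> to \<open>x c\<^sup>\<infinity>\<close> gives \<open>R / R a \<cong> V\<close>, and the grading by path length makes
  right multiplication by \<open>a\<close> injective, so everything follows once every left ideal that contains
  some \<open>a\<^sup>n\<close> and is not contained in \<open>R a\<close> is all of \<open>R\<close>. Modulo \<open>R a\<^sup>n\<close> the element \<open>c = 1 + a\<close> is
  invertible on the right, so a monomial \<open>p q\<^sup>*\<close> may be multiplied by a high power of \<open>c\<close>, which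
  either kills it or turns it into a path ending with \<open>c\<close>. Hence each element is a combination of
  paths \<open>p\<^sub>i\<close>, one for each infinite path \<open>p\<^sub>i c\<^sup>\<infinity>\<close>, with coefficients on the right that are
  polynomials in \<open>a\<close>; basicness of \<open>c\<close> enters because \<open>p c\<^sup>\<infinity> = c\<^sup>\<infinity>\<close> forces \<open>p\<close> to be a power of \<open>c\<close>. If
  the element is not in \<open>R a\<close>, some coefficient has a nonzero constant term, multiplication by a long
  ghost path isolates it, and a polynomial in \<open>a\<close> with nonzero constant term is a unit modulo \<open>a\<^sup>n\<close>.
\<close>

section \<open>Left modules\<close>

text \<open>The obstacle is that \<open>R a^n\<close> is only a left ideal: a congruence modulo
  \<open>R a^n\<close> may be multiplied on the right only by elements that commute with
  \<open>a\<close>. This dictates the shape of the normal form. Its coefficients stand on the right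
  and commute with \<open>a\<close>, and the right inverse of \<open>c\<close> modulo
  \<open>R a^n\<close> is the truncated geometric series in \<open>-a\<close>, which commutes with
  \<open>a\<close> as well. The monomials enter as a spanning set. Statements that something does
  not vanish come from the action on \<open>c^\<infinity>\<close>: there \<open>a\<close> acts as
  zero, a coefficient acts through its constant term, and distinct infinite paths are linearly
  independent. In particular the annihilator of \<open>c^\<infinity>\<close> is exactly
  \<open>R a\<close>. Computations take place in the free algebra modulo the ideal of relations,
  where sums and products are those of a type class; only the final results are transported to
  cosets. The passage from left ideals to the theorem is purely ring-theoretic and is carried out
  for an abstract pair \<open>R\<close>, \<open>a\<close>.\<close>

lemma (in left_module) smult_zero_right:
  assumes "a \<in> carrier R" shows "a \<odot>\<^bsub>M\<^esub> \<zero>\<^bsub>M\<^esub> = \<zero>\<^bsub>M\<^esub>"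
  using smult_r_distr[OF assms M.zero_closed M.zero_closed] smult_closed[OF assms M.zero_closed]
  by simp

lemma (in left_module) smult_zero_left:
  assumes "x \<in> carrier M" shows "\<zero>\<^bsub>R\<^esub> \<odot>\<^bsub>M\<^esub> x = \<zero>\<^bsub>M\<^esub>"
  using smult_l_distr[OF R.zero_closed R.zero_closed assms] smult_closed[OF R.zero_closed assms]
  by simp

lemma (in left_module) smult_minus_one:
  assumes x: "x \<in> carrier M" shows "(\<ominus>\<^bsub>R\<^esub> \<one>\<^bsub>R\<^esub>) \<odot>\<^bsub>M\<^esub> x = \<ominus>\<^bsub>M\<^esub> x"
proof -
  have "(\<ominus>\<^bsub>R\<^esub> \<one>\<^bsub>R\<^esub>) \<odot>\<^bsub>M\<^esub> x \<oplus>\<^bsub>M\<^esub> x = (\<ominus>\<^bsub>R\<^esub> \<one>\<^bsub>R\<^esub> \<oplus>\<^bsub>R\<^esub> \<one>\<^bsub>R\<^esub>) \<odot>\<^bsub>M\<^esub> x"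
    using x by (simp add: smult_l_distr smult_one)
  also have "\<dots> = \<zero>\<^bsub>M\<^esub>" using x by (simp add: R.l_neg smult_zero_left)
  finally show ?thesis using x smult_closed[of "\<ominus>\<^bsub>R\<^esub> \<one>\<^bsub>R\<^esub>" x] by (simp add: M.minus_equality)
qed

text \<open>Negation is covered by the scalar clause, because \<open>- x\<close> is
  \<open>(- 1) x\<close>.\<close>

lemma (in left_module) submodule_iff:
  "submodule H R M \<longleftrightarrow> H \<subseteq> carrier M \<and> \<zero>\<^bsub>M\<^esub> \<in> H \<and> (\<forall>x\<in>H. \<forall>y\<in>H. x \<oplus>\<^bsub>M\<^esub> y \<in> H) \<and>
    (\<forall>a\<in>carrier R. \<forall>x\<in>H. a \<odot>\<^bsub>M\<^esub> x \<in> H)" (is "_ \<longleftrightarrow> ?P")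
proof
  assume "submodule H R M"
  then interpret submodule H R M .
  show ?P using subset one_closed m_closed smult_closed by auto
next
  assume P: ?P
  have "\<ominus>\<^bsub>M\<^esub> x \<in> H" if "x \<in> H" for x
    using P that smult_minus_one[of x] R.add.inv_closed[OF R.one_closed] by (metis subsetD)
  with P show "submodule H R M"
    by (intro submodule.intro M.add.subgroupI submodule_axioms.intro) (auto simp: a_inv_def)
qed

lemma (in left_module) submodule_abelian_subgroup:
  "submodule H R M \<Longrightarrow> abelian_subgroup H M"
  by (intro abelian_subgroupI3 additive_subgroup.intro M.abelian_group_axioms)
    (auto simp: submodule_def)

lemma (in left_module) submodule_zero: "submodule {\<zero>\<^bsub>M\<^esub>} R M"
  unfolding submodule_iff by (auto simp: smult_zero_right)

lemma (in left_module) submodule_carrier: "submodule (carrier M) R M"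
  unfolding submodule_iff by (auto intro: smult_closed)

lemma (in left_module) left_module_restrict:
  assumes "submodule H R M"
  shows "left_module R (M\<lparr>carrier := H\<rparr>)"
proof -
  have H: "H \<subseteq> carrier M" "\<zero>\<^bsub>M\<^esub> \<in> H" "\<And>x y. x \<in> H \<Longrightarrow> y \<in> H \<Longrightarrow> x \<oplus>\<^bsub>M\<^esub> y \<in> H"
    "\<And>a x. a \<in> carrier R \<Longrightarrow> x \<in> H \<Longrightarrow> a \<odot>\<^bsub>M\<^esub> x \<in> H"
    using assms unfolding submodule_iff by auto
  have neg: "\<exists>y\<in>H. y \<oplus>\<^bsub>M\<^esub> x = \<zero>\<^bsub>M\<^esub>" if "x \<in> H" for x
    using that H smult_minus_one[of x] R.add.inv_closed[OF R.one_closed]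
    by (metis M.l_neg subsetD)
  have "abelian_group (M\<lparr>carrier := H\<rparr>)"
    by (rule abelian_groupI) (use H neg in \<open>auto simp: M.a_ac subset_iff\<close>)
  then show ?thesis
    using H by (intro left_module.intro left_module_axioms.intro R.ring_axioms)
      (auto simp: smult_l_distr smult_r_distr smult_assoc smult_one subset_iff)
qed

lemma (in left_module) submodule_restrict_iff:
  assumes "submodule H R M"
  shows "submodule P R (M\<lparr>carrier := H\<rparr>) \<longleftrightarrow> submodule P R M \<and> P \<subseteq> H"
proof -
  have H: "H \<subseteq> carrier M" using assms by (simp add: submodule_iff)
  show ?thesis
    unfolding left_module.submodule_iff[OF left_module_restrict[OF assms]] submodule_iff[of P]
    using H by auto
qed

text \<open>The axioms are transported along a surjection onto a bare record \<open>Q\<close>. As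
  \<open>Q\<close> is not yet known to be a group, additivity of \<open>p\<close> does not determine
  the field \<open>zero\<close>, which is why its value is a hypothesis.\<close>

lemma left_module_image:
  assumes "left_module R M" and p: "p \<in> left_module_hom R M Q"
    and surj: "p ` carrier M = carrier Q" and zero: "p \<zero>\<^bsub>M\<^esub> = \<zero>\<^bsub>Q\<^esub>"
  shows "left_module R Q"
proof -
  interpret left_module R M by fact
  have add: "p x \<oplus>\<^bsub>Q\<^esub> p y = p (x \<oplus>\<^bsub>M\<^esub> y)" if "x \<in> carrier M" "y \<in> carrier M" for x y
    using p that unfolding left_module_hom_def by simp
  have smult: "b \<odot>\<^bsub>Q\<^esub> p x = p (b \<odot>\<^bsub>M\<^esub> x)" if "b \<in> carrier R" "x \<in> carrier M" for b x
    using p that unfolding left_module_hom_def by simp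
  have ex: "\<exists>x\<in>carrier M. X = p x" if "X \<in> carrier Q" for X using that surj by auto
  have cl: "p x \<in> carrier Q" if "x \<in> carrier M" for x using that surj by auto
  have neg: "\<exists>Y\<in>carrier Q. Y \<oplus>\<^bsub>Q\<^esub> p x = p \<zero>\<^bsub>M\<^esub>" if "x \<in> carrier M" for x
    using that by (intro bexI[of _ "p (\<ominus>\<^bsub>M\<^esub> x)"]) (auto simp: add cl M.l_neg)
  have "abelian_group Q"
    by (rule abelian_groupI)
      (auto dest!: ex simp: add cl zero[symmetric] M.a_ac neg)
  then show ?thesis
    by (intro left_module.intro left_module_axioms.intro R.ring_axioms)
      (auto dest!: ex simp: add smult cl smult_closed smult_l_distr smult_r_distr smult_assoc smult_one)
qed

lemma submodule_image:
  assumes "left_module R M" and "left_module R Q" and p: "p \<in> left_module_hom R M Q"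
    and zero: "p \<zero>\<^bsub>M\<^esub> = \<zero>\<^bsub>Q\<^esub>" and N: "submodule N R M"
  shows "submodule (p ` N) R Q"
proof -
  interpret M: left_module R M by fact
  interpret Q: left_module R Q by fact
  have sub: "N \<subseteq> carrier M" using N by (simp add: M.submodule_iff)
  show ?thesis
    unfolding Q.submodule_iff
  proof (intro conjI ballI)
    show "p ` N \<subseteq> carrier Q" using p sub unfolding left_module_hom_def by auto
    show "\<zero>\<^bsub>Q\<^esub> \<in> p ` N" using N zero by (auto simp: M.submodule_iff intro: image_eqI[of _ _ "\<zero>\<^bsub>M\<^esub>"])
    show "X \<oplus>\<^bsub>Q\<^esub> Y \<in> p ` N" if "X \<in> p ` N" "Y \<in> p ` N" for X Y
    proof -
      from that obtain x y where "x \<in> N" "y \<in> N" "X = p x" "Y = p y" by auto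
      moreover from this have "x \<in> carrier M" "y \<in> carrier M" using sub by auto
      ultimately show ?thesis using p N unfolding left_module_hom_def M.submodule_iff
        by (intro image_eqI[of _ _ "x \<oplus>\<^bsub>M\<^esub> y"]) auto
    qed
    show "b \<odot>\<^bsub>Q\<^esub> X \<in> p ` N" if "b \<in> carrier R" "X \<in> p ` N" for b X
    proof -
      from that obtain x where "x \<in> N" "X = p x" by auto
      moreover from this have "x \<in> carrier M" using sub by auto
      ultimately show ?thesis using p N that unfolding left_module_hom_def M.submodule_iff
        by (intro image_eqI[of _ _ "b \<odot>\<^bsub>M\<^esub> x"]) auto
    qed
  qed
qed

lemma submodule_vimage:
  assumes "left_module R M" and "left_module R Q" and p: "p \<in> left_module_hom R M Q"
    and zero: "p \<zero>\<^bsub>M\<^esub> = \<zero>\<^bsub>Q\<^esub>" and N: "submodule N R Q"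
  shows "submodule {x \<in> carrier M. p x \<in> N} R M"
proof -
  interpret M: left_module R M by fact
  interpret Q: left_module R Q by fact
  show ?thesis using p zero N unfolding M.submodule_iff Q.submodule_iff left_module_hom_def
    by (auto intro: M.smult_closed)
qed

section \<open>Quotient modules: correspondence of submodules and the first isomorphism
  theorem\<close>

context left_module
begin

lemma quot_carrier_iff:
  "X \<in> carrier (quot_module M N) \<longleftrightarrow> (\<exists>x\<in>carrier M. X = N +>\<^bsub>M\<^esub> x)"
  by (auto simp: quot_module_def A_RCOSETS_def')

context
  fixes N assumes N: "submodule N R M"
begin

lemma quot_coset_eq:
  assumes "x \<in> carrier M" "y \<in> carrier M"
  shows "N +>\<^bsub>M\<^esub> x = N +>\<^bsub>M\<^esub> y \<longleftrightarrow> x \<ominus>\<^bsub>M\<^esub> y \<in> N"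
proof -
  interpret S: abelian_subgroup N M by (rule submodule_abelian_subgroup[OF N])
  have "N +>\<^bsub>M\<^esub> x = N +>\<^bsub>M\<^esub> y \<longleftrightarrow> x \<in> N +>\<^bsub>M\<^esub> y"
    using assms S.a_repr_independence'[of x y] S.a_rcos_self[of x] by auto
  also have "\<dots> \<longleftrightarrow> x \<ominus>\<^bsub>M\<^esub> y \<in> N"
    using assms by (simp add: S.a_rcos_module a_minus_def)
  finally show ?thesis .
qed

lemma quot_zero: "\<zero>\<^bsub>quot_module M N\<^esub> = N +>\<^bsub>M\<^esub> \<zero>\<^bsub>M\<^esub>"
proof -
  interpret S: abelian_subgroup N M by (rule submodule_abelian_subgroup[OF N])
  show ?thesis using M.a_coset_add_zero[OF S.a_subset] by (simp add: quot_module_def)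
qed

lemma quot_add:
  assumes "x \<in> carrier M" "y \<in> carrier M"
  shows "(N +>\<^bsub>M\<^esub> x) \<oplus>\<^bsub>quot_module M N\<^esub> (N +>\<^bsub>M\<^esub> y) = N +>\<^bsub>M\<^esub> (x \<oplus>\<^bsub>M\<^esub> y)"
proof -
  interpret S: abelian_subgroup N M by (rule submodule_abelian_subgroup[OF N])
  show ?thesis using S.a_rcos_sum[OF assms] by (simp add: quot_module_def)
qed

lemma quot_smult:
  assumes x: "x \<in> carrier M" and b: "b \<in> carrier R"
  shows "b \<odot>\<^bsub>quot_module M N\<^esub> (N +>\<^bsub>M\<^esub> x) = N +>\<^bsub>M\<^esub> (b \<odot>\<^bsub>M\<^esub> x)"
proof -
  interpret S: abelian_subgroup N M by (rule submodule_abelian_subgroup[OF N])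
  \<comment> \<open>Independence of the representative: all cosets in the union that defines the
    scalar multiplication coincide.\<close>
  have eq: "N +>\<^bsub>M\<^esub> (b \<odot>\<^bsub>M\<^esub> y) = N +>\<^bsub>M\<^esub> (b \<odot>\<^bsub>M\<^esub> x)" if y: "y \<in> N +>\<^bsub>M\<^esub> x" for y
  proof -
    have yc: "y \<in> carrier M" using S.a_elemrcos_carrier[OF x y] .
    have yx: "y \<ominus>\<^bsub>M\<^esub> x \<in> N" using y x yc by (simp add: S.a_rcos_module a_minus_def)
    have "b \<odot>\<^bsub>M\<^esub> y = b \<odot>\<^bsub>M\<^esub> (y \<ominus>\<^bsub>M\<^esub> x \<oplus>\<^bsub>M\<^esub> x)"
      using x yc by (simp add: a_minus_def M.a_assoc M.l_neg)
    also have "\<dots> = b \<odot>\<^bsub>M\<^esub> (y \<ominus>\<^bsub>M\<^esub> x) \<oplus>\<^bsub>M\<^esub> b \<odot>\<^bsub>M\<^esub> x"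
      using x yc b by (simp add: smult_r_distr)
    finally have "b \<odot>\<^bsub>M\<^esub> y \<ominus>\<^bsub>M\<^esub> b \<odot>\<^bsub>M\<^esub> x = b \<odot>\<^bsub>M\<^esub> (y \<ominus>\<^bsub>M\<^esub> x)"
      using x yc b by (simp add: a_minus_def M.a_assoc M.r_neg smult_closed)
    also have "\<dots> \<in> N" using N b yx by (simp add: submodule_iff)
    finally show ?thesis using x yc b by (simp add: quot_coset_eq smult_closed)
  qed
  have "x \<in> N +>\<^bsub>M\<^esub> x" using x by (rule S.a_rcos_self)
  then have "(\<Union>y\<in>N +>\<^bsub>M\<^esub> x. N +>\<^bsub>M\<^esub> (b \<odot>\<^bsub>M\<^esub> y)) = N +>\<^bsub>M\<^esub> (b \<odot>\<^bsub>M\<^esub> x)"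
    by (intro SUP_eq_const eq) blast
  then show ?thesis by (simp add: quot_module_def)
qed

lemma quot_map_hom: "(\<lambda>x. N +>\<^bsub>M\<^esub> x) \<in> left_module_hom R M (quot_module M N)"
  unfolding left_module_hom_def by (auto simp: quot_carrier_iff quot_add quot_smult)

lemma left_module_quot: "left_module R (quot_module M N)"
  by (rule left_module_image[OF left_module_axioms quot_map_hom])
    (auto simp: quot_zero quot_carrier_iff)

text \<open>The correspondence between submodules of the quotient and submodules of \<open>M\<close>
  above \<open>N\<close>, by images and preimages under the coset map.\<close>

lemma simple_quot_iff:
  "simple_module R (quot_module M N) \<longleftrightarrow>
    N \<noteq> carrier M \<and> (\<forall>P. submodule P R M \<and> N \<subseteq> P \<longrightarrow> P = N \<or> P = carrier M)"
proof -
  let ?Q = "quot_module M N" and ?p = "\<lambda>x. N +>\<^bsub>M\<^esub> x"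
  have sub: "N \<subseteq> carrier M" using N by (simp add: submodule_iff)
  have [simp]: "\<ominus>\<^bsub>M\<^esub> \<zero>\<^bsub>M\<^esub> = \<zero>\<^bsub>M\<^esub>"
    using M.minus_equality[of "\<zero>\<^bsub>M\<^esub>" "\<zero>\<^bsub>M\<^esub>"] by simp
  have in_N: "?p x = \<zero>\<^bsub>?Q\<^esub> \<longleftrightarrow> x \<in> N" if "x \<in> carrier M" for x
    using that quot_coset_eq[of x "\<zero>\<^bsub>M\<^esub>"] by (simp add: quot_zero M.minus_eq)
  have carrier: "carrier ?Q = ?p ` carrier M" by (auto simp: quot_carrier_iff)
  have trivial: "carrier ?Q = {\<zero>\<^bsub>?Q\<^esub>} \<longleftrightarrow> N = carrier M"
  proof
    assume triv: "carrier ?Q = {\<zero>\<^bsub>?Q\<^esub>}"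
    have "x \<in> N" if "x \<in> carrier M" for x
    proof -
      have "?p x \<in> carrier ?Q" using that carrier by blast
      then show ?thesis using that in_N triv by simp
    qed
    then show "N = carrier M" using sub by blast
  next
    assume "N = carrier M"
    then have "?p x = \<zero>\<^bsub>?Q\<^esub>" if "x \<in> carrier M" for x using that in_N by blast
    then show "carrier ?Q = {\<zero>\<^bsub>?Q\<^esub>}"
      unfolding carrier using M.zero_closed by (simp add: image_constant[OF M.zero_closed] cong: image_cong)
  qed
  \<comment> \<open>Because \<open>N \<subseteq> P\<close>, the submodule \<open>P\<close> is a
    union of cosets of \<open>N\<close> and can be recovered from its image.\<close>
  have mem: "?p x \<in> ?p ` P \<longleftrightarrow> x \<in> P" if P: "submodule P R M" "N \<subseteq> P" and x: "x \<in> carrier M" for P x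
  proof
    assume "?p x \<in> ?p ` P"
    then obtain y where y: "y \<in> P" "?p x = ?p y" by auto
    have yc: "y \<in> carrier M" using P y by (auto simp: submodule_iff)
    have "x \<ominus>\<^bsub>M\<^esub> y \<in> P" using y x yc P by (auto simp: quot_coset_eq)
    then have "x \<ominus>\<^bsub>M\<^esub> y \<oplus>\<^bsub>M\<^esub> y \<in> P" using P y by (simp add: submodule_iff)
    then show "x \<in> P" using x yc by (simp add: a_minus_def M.a_assoc M.l_neg)
  qed auto
  have "(\<forall>P'. submodule P' R ?Q \<longrightarrow> P' = {\<zero>\<^bsub>?Q\<^esub>} \<or> P' = carrier ?Q) \<longleftrightarrow>
      (\<forall>P. submodule P R M \<and> N \<subseteq> P \<longrightarrow> P = N \<or> P = carrier M)" (is "?L \<longleftrightarrow> ?R")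
  proof
    assume L: ?L
    show ?R
    proof (intro allI impI)
      fix P assume P: "submodule P R M \<and> N \<subseteq> P"
      then have "submodule (?p ` P) R ?Q"
        by (intro submodule_image[OF left_module_axioms left_module_quot quot_map_hom]) (auto simp: quot_zero)
      with L have "?p ` P = {\<zero>\<^bsub>?Q\<^esub>} \<or> ?p ` P = carrier ?Q" by simp
      then consider "?p ` P = {\<zero>\<^bsub>?Q\<^esub>}" | "?p ` P = ?p ` carrier M" unfolding carrier by (elim disjE)
      then show "P = N \<or> P = carrier M"
      proof cases
        case 1
        have "x \<in> N" if "x \<in> P" for x
        proof -
          have "?p x \<in> ?p ` P" "x \<in> carrier M" using that P by (auto simp: submodule_iff)
          then show ?thesis using in_N 1 by simp
        qed
        then show ?thesis using P by auto
      next
        case 2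
        have "x \<in> P" if "x \<in> carrier M" for x
          using mem[of P x] P that 2 by blast
        then show ?thesis using P by (auto simp: submodule_iff)
      qed
    qed
  next
    assume R: ?R
    show ?L
    proof (intro allI impI)
      fix P' assume P': "submodule P' R ?Q"
      let ?P = "{x \<in> carrier M. ?p x \<in> P'}"
      interpret Q: left_module R ?Q by (rule left_module_quot)
      have img: "P' = ?p ` ?P" using P' unfolding Q.submodule_iff carrier by auto
      have sub: "submodule ?P R M"
        using P' by (intro submodule_vimage[OF left_module_axioms left_module_quot quot_map_hom]) (auto simp: quot_zero)
      have zP: "\<zero>\<^bsub>?Q\<^esub> \<in> P'" using P' unfolding Q.submodule_iff by blast
      have "N \<subseteq> ?P"
      proof
        fix x assume "x \<in> N"
        then have "x \<in> carrier M" "?p x = \<zero>\<^bsub>?Q\<^esub>" using in_N \<open>N \<subseteq> carrier M\<close> by blast+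
        then show "x \<in> ?P" using zP by simp
      qed
      with sub R have "?P = N \<or> ?P = carrier M" by blast
      then show "P' = {\<zero>\<^bsub>?Q\<^esub>} \<or> P' = carrier ?Q"
      proof
        assume "?P = N"
        then have "P' = ?p ` N" using img by simp
        moreover have "?p x = \<zero>\<^bsub>?Q\<^esub>" if "x \<in> N" for x using that in_N \<open>N \<subseteq> carrier M\<close> by blast
        ultimately have "P' \<subseteq> {\<zero>\<^bsub>?Q\<^esub>}" by (metis (no_types, lifting) image_subsetI singletonI)
        then show ?thesis using zP by blast
      next
        assume "?P = carrier M"
        then show ?thesis using img carrier by simp
      qed
    qed
  qed
  with trivial left_module_quot show ?thesis unfolding simple_module_def by (simp only: simp_thms)
qed

lemma quot_isomorphic:
  assumes V: "left_module R V" and f: "f \<in> left_module_hom R M V"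
    and surj: "f ` carrier M = carrier V" and ker: "\<And>x. x \<in> carrier M \<Longrightarrow> f x = \<zero>\<^bsub>V\<^esub> \<longleftrightarrow> x \<in> N"
  shows "left_module_isomorphic R (quot_module M N) V"
proof -
  interpret V: left_module R V by fact
  interpret S: abelian_subgroup N M by (rule submodule_abelian_subgroup[OF N])
  let ?p = "\<lambda>x. N +>\<^bsub>M\<^esub> x"
  have fadd: "f (x \<oplus>\<^bsub>M\<^esub> y) = f x \<oplus>\<^bsub>V\<^esub> f y" and fcl: "f x \<in> carrier V" if "x \<in> carrier M" "y \<in> carrier M" for x y
    using that f unfolding left_module_hom_def by auto
  have fsm: "f (b \<odot>\<^bsub>M\<^esub> x) = b \<odot>\<^bsub>V\<^esub> f x" if "x \<in> carrier M" "b \<in> carrier R" for x b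
    using that f unfolding left_module_hom_def by auto
  have eq: "f x = f y \<longleftrightarrow> ?p x = ?p y" if xy: "x \<in> carrier M" "y \<in> carrier M" for x y
  proof -
    have "f (x \<ominus>\<^bsub>M\<^esub> y) \<oplus>\<^bsub>V\<^esub> f y = f x"
      using xy fadd[of "x \<ominus>\<^bsub>M\<^esub> y" y] by (simp add: a_minus_def M.a_assoc M.l_neg)
    then have "f x = f y \<longleftrightarrow> f (x \<ominus>\<^bsub>M\<^esub> y) = \<zero>\<^bsub>V\<^esub>"
      using xy fcl[of y y] fcl[of "x \<ominus>\<^bsub>M\<^esub> y" y] V.M.l_zero V.M.add.r_cancel_one[of "f y" "f (x \<ominus>\<^bsub>M\<^esub> y)"] by auto
    then show ?thesis using xy by (simp add: ker quot_coset_eq)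
  qed
  \<comment> \<open>The induced map is defined through a chosen representative; by \<open>eq\<close>
    the choice does not affect the value.\<close>
  define h where "h X = f (SOME x. x \<in> carrier M \<and> ?p x = X)" for X
  have h: "h (?p x) = f x" if x: "x \<in> carrier M" for x
  proof -
    have "(SOME y. y \<in> carrier M \<and> ?p y = ?p x) \<in> carrier M \<and> ?p (SOME y. y \<in> carrier M \<and> ?p y = ?p x) = ?p x"
      by (rule someI[of _ x]) (use x in simp)
    then show ?thesis unfolding h_def using x eq by blast
  qed
  have "h \<in> left_module_hom R (quot_module M N) V"
    unfolding left_module_hom_def
    by (auto simp: quot_carrier_iff quot_add quot_smult h fadd fsm fcl smult_closed)
  moreover have "bij_betw h (carrier (quot_module M N)) (carrier V)"
    unfolding bij_betw_def
  proof
    show "inj_on h (carrier (quot_module M N))"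
      by (rule inj_onI) (auto simp: quot_carrier_iff h eq)
    show "h ` carrier (quot_module M N) = carrier V"
    proof -
      have "carrier (quot_module M N) = ?p ` carrier M" by (auto simp: quot_carrier_iff)
      then have "h ` carrier (quot_module M N) = (\<lambda>x. h (?p x)) ` carrier M" by (simp add: image_image)
      also have "\<dots> = f ` carrier M" using h by (rule image_cong[OF refl])
      finally show ?thesis using surj by simp
    qed
  qed
  ultimately show ?thesis unfolding left_module_isomorphic_def by (intro bexI)
qed

end
end

text \<open>Brings the simplicity of a factor, which speaks about a record with restricted carrier,
  back to submodules of \<open>M\<close> itself.\<close>

lemma (in left_module) chain_factor_simple_iff:
  assumes N1: "submodule N1 R M" and N2: "submodule N2 R M" and sub: "N1 \<subseteq> N2"
  shows "simple_module R (quot_module (M\<lparr>carrier := N2\<rparr>) N1) \<longleftrightarrow>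
    N1 \<noteq> N2 \<and> (\<forall>P. submodule P R M \<and> N1 \<subseteq> P \<and> P \<subseteq> N2 \<longrightarrow> P = N1 \<or> P = N2)"
proof -
  interpret M2: left_module R "M\<lparr>carrier := N2\<rparr>" by (rule left_module_restrict[OF N2])
  have "submodule N1 R (M\<lparr>carrier := N2\<rparr>)"
    using submodule_restrict_iff[OF N2] N1 sub by blast
  from M2.simple_quot_iff[OF this] show ?thesis
    using submodule_restrict_iff[OF N2] by auto
qed

text \<open>When the submodules form a finite strict chain, a factor is simple only between
  neighbours. A composition series can therefore skip nothing and must run through the whole chain.
  The index is \<open>n - i\<close> because \<open>W\<close> descends whereas a series
  ascends.\<close>

lemma (in left_module) composition_series_chain:
  assumes W: "\<And>P. submodule P R M \<longleftrightarrow> (\<exists>j\<le>n. P = W j)"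
    and mono: "\<And>i j. \<lbrakk>i \<le> n; j \<le> n\<rbrakk> \<Longrightarrow> W i \<subseteq> W j \<longleftrightarrow> j \<le> i"
    and W0: "W 0 = carrier M" and Wn: "W n = {\<zero>\<^bsub>M\<^esub>}"
  shows "composition_series R M Ns \<longleftrightarrow> Ns = map (\<lambda>i. W (n - i)) [0..<Suc n]"
proof
  have sub: "submodule (W k) R M" if "k \<le> n" for k
    unfolding W by (rule exI, rule conjI, rule that, rule refl)
  have simple: "simple_module R (quot_module (M\<lparr>carrier := W j\<rparr>) (W i)) \<longleftrightarrow> i = Suc j"
    if ij: "i \<le> n" "j \<le> i" for i j
  proof -
    have j: "j \<le> n" using ij by simp
    have sub: "submodule (W i) R M" "submodule (W j) R M" "W i \<subseteq> W j"
      using ij j mono[OF ij(1) j] sub by simp_all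
    have eq: "W k = W l \<longleftrightarrow> k = l" if "k \<le> n" "l \<le> n" for k l
      unfolding set_eq_subset mono[OF that] mono[OF that(2,1)] by linarith
    have "simple_module R (quot_module (M\<lparr>carrier := W j\<rparr>) (W i)) \<longleftrightarrow>
        W i \<noteq> W j \<and> (\<forall>k\<le>n. W i \<subseteq> W k \<and> W k \<subseteq> W j \<longrightarrow> W k = W i \<or> W k = W j)"
      unfolding chain_factor_simple_iff[OF sub] W by blast
    also have "\<dots> \<longleftrightarrow> i \<noteq> j \<and> (\<forall>k\<le>n. k \<le> i \<and> j \<le> k \<longrightarrow> k = i \<or> k = j)"
      using ij(1) j by (simp add: mono eq)
    also have "\<dots> \<longleftrightarrow> i = Suc j"
    proof
      assume *: "i \<noteq> j \<and> (\<forall>k\<le>n. k \<le> i \<and> j \<le> k \<longrightarrow> k = i \<or> k = j)"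
      \<comment> \<open>The submodule with index \<open>Suc j\<close> lies between the two and hence
        equals one of them.\<close>
      then have "Suc j = i \<or> Suc j = j" using ij by (intro *[THEN conjunct2, rule_format]) auto
      then show "i = Suc j" by simp
    qed auto
    finally show ?thesis .
  qed
  {
    assume cs: "composition_series R M Ns"
    then have ne: "Ns \<noteq> []" and hd: "hd Ns = {\<zero>\<^bsub>M\<^esub>}" and last: "last Ns = carrier M"
      and subs: "\<And>i. i < length Ns \<Longrightarrow> submodule (Ns ! i) R M"
      and step: "\<And>i. Suc i < length Ns \<Longrightarrow> Ns ! i \<subset> Ns ! Suc i \<and> simple_module R (chain_factor M Ns i)"
      unfolding composition_series_def by auto
    \<comment> \<open>Induction from the bottom: the next entry is some \<open>W j\<close>, and
      simplicity of the factor forces \<open>n - i = Suc j\<close>. This also keeps the index within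
      \<open>n\<close>.\<close>
    have nth: "i \<le> n \<and> Ns ! i = W (n - i)" if "i < length Ns" for i
      using that
    proof (induction i)
      case 0
      then show ?case using hd ne Wn by (simp add: hd_conv_nth)
    next
      case (Suc i)
      then have IH: "i \<le> n" "Ns ! i = W (n - i)" by auto
      obtain j where j: "j \<le> n" "Ns ! Suc i = W j" using subs[OF Suc.prems] W by auto
      have ps: "W (n - i) \<subset> W j" using step[OF Suc.prems] IH(2) j(2) by simp
      have "j \<le> n - i" using mono[of "n - i" j] psubset_imp_subset[OF ps] j(1) by simp
      moreover have "simple_module R (quot_module (M\<lparr>carrier := W j\<rparr>) (W (n - i)))"
        using step[OF Suc.prems] IH(2) j(2) by (simp add: chain_factor_def)
      ultimately have "n - i = Suc j" using simple[of "n - i" j] by simp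
      then have "j = n - Suc i" "Suc i \<le> n" by auto
      then show ?case using j by auto
    qed
    have len: "length Ns = Suc n"
    proof -
      \<comment> \<open>The last entry is the whole module \<open>W 0\<close>, which fixes the
        length.\<close>
      have "W (n - (length Ns - 1)) = W 0" "length Ns - 1 \<le> n"
        using nth[of "length Ns - 1"] last ne W0 by (auto simp: last_conv_nth)
      then have "n - (length Ns - 1) = 0" using mono[of 0 "n - (length Ns - 1)"] by auto
      then show ?thesis using \<open>length Ns - 1 \<le> n\<close> ne by (cases Ns) auto
    qed
    show "Ns = map (\<lambda>i. W (n - i)) [0..<Suc n]"
      by (rule nth_equalityI) (use len nth in \<open>auto simp del: upt_Suc\<close>)
  }
  {
    assume Ns: "Ns = map (\<lambda>i. W (n - i)) [0..<Suc n]"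
    have nth: "Ns ! i = W (n - i)" if "i \<le> n" for i
      using that unfolding Ns by (simp del: upt_Suc)
    have len: "length Ns = Suc n" by (simp add: Ns)
    have ne: "Ns \<noteq> []" by (simp add: Ns)
    show "composition_series R M Ns"
      unfolding composition_series_def
    proof (intro conjI ballI allI impI)
      show "Ns \<noteq> []" by fact
      show "hd Ns = {\<zero>\<^bsub>M\<^esub>}" using ne nth[of 0] Wn by (simp add: hd_conv_nth)
      show "last Ns = carrier M" using ne nth[of n] W0 len by (simp add: last_conv_nth)
      show "submodule N R M" if "N \<in> set Ns" for N
        using that sub unfolding Ns by (auto simp del: upt_Suc)
      fix i assume i: "Suc i < length Ns"
      then have i': "Suc i \<le> n" using len by simp
      show "Ns ! i \<subset> Ns ! Suc i"
      proof -
        have "W (n - i) \<subseteq> W (n - Suc i)" "\<not> W (n - Suc i) \<subseteq> W (n - i)"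
          using i' mono[of "n - i" "n - Suc i"] mono[of "n - Suc i" "n - i"] by simp_all
        then show ?thesis using i' nth[of i] nth[of "Suc i"] by (simp add: less_le_not_le)
      qed
      show "simple_module R (chain_factor M Ns i)"
        using i' nth[of i] nth[of "Suc i"] simple[of "n - i" "n - Suc i"]
        by (simp add: chain_factor_def)
    qed
  }
qed


section \<open>Powers of a right cancellable element\<close>

lemma (in ring) left_module_regular: "left_module R (regular_module R)"
proof -
  have "abelian_group (regular_module R)"
    by (rule abelian_groupI) (auto simp: regular_module_def a_ac intro: bexI[of _ "\<ominus> _"] l_neg)
  then show ?thesis
    by (intro left_module.intro left_module_axioms.intro ring_axioms)
      (auto simp: regular_module_def l_distr r_distr m_assoc)
qed

lemma (in ring) submodule_regular_iff:
  "submodule N R (regular_module R) \<longleftrightarrow> N \<subseteq> carrier R \<and> \<zero> \<in> N \<and> (\<forall>x\<in>N. \<forall>y\<in>N. x \<oplus> y \<in> N) \<and>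
    (\<forall>b\<in>carrier R. \<forall>x\<in>N. b \<otimes> x \<in> N)"
  unfolding left_module.submodule_iff[OF left_module_regular] by (simp add: regular_module_def)

lemma (in ring) submodule_left_principal:
  assumes b: "b \<in> carrier R" shows "submodule (PIdl b) R (regular_module R)"
proof -
  interpret additive_subgroup "PIdl b" R by (rule left_principal_subgroup[OF b])
  have "r \<otimes> x \<in> PIdl b" if "r \<in> carrier R" "x \<in> PIdl b" for r x
    using that b by (auto simp: cgenideal_iff m_assoc[symmetric])
  then show ?thesis
    using left_principal_subgroup[OF b] a_subset zero_closed a_closed unfolding submodule_regular_iff by auto
qed

text \<open>All that the theorem needs to know about \<open>R\<close> and \<open>a = c - 1\<close>.
  The last assumption with \<open>n = 1\<close> says that \<open>R a\<close> is a maximal left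
  ideal; for general \<open>n\<close> it says that a left ideal containing \<open>a^n\<close> is
  either inside \<open>R a\<close> or everything.\<close>

locale power_chain = ring R for R :: "('a, 'r) ring_scheme" (structure) +
  fixes a :: 'a
  assumes elem_closed [simp]: "a \<in> carrier R"
    and right_cancel: "\<lbrakk>x \<in> carrier R; x \<otimes> a = \<zero>\<rbrakk> \<Longrightarrow> x = \<zero>"
    and one_notin: "\<one> \<notin> PIdl a"
    and local: "\<lbrakk>submodule N R (regular_module R); a [^] (n::nat) \<in> N; \<not> N \<subseteq> PIdl a\<rbrakk> \<Longrightarrow> \<one> \<in> N"
begin

lemma pow_mult: "x \<in> carrier R \<Longrightarrow> x \<otimes> a [^] (i::nat) \<otimes> a [^] (j::nat) = x \<otimes> a [^] (i + j)"
  by (simp add: m_assoc nat_pow_mult)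

lemma cancel_zero: "\<lbrakk>x \<in> carrier R; x \<otimes> a [^] (n::nat) = \<zero>\<rbrakk> \<Longrightarrow> x = \<zero>"
proof (induction n)
  case (Suc n)
  then show ?case using right_cancel[of "x \<otimes> a [^] n"] by (simp add: m_assoc)
qed simp

lemma cancel:
  assumes "x \<in> carrier R" "y \<in> carrier R" "x \<otimes> a [^] (n::nat) = y \<otimes> a [^] n"
  shows "x = y"
proof -
  have "(x \<ominus> y) \<otimes> a [^] n = \<zero>"
    using assms by (simp add: minus_eq l_distr l_minus r_neg)
  then have "x \<ominus> y = \<zero>" using assms cancel_zero[of "x \<ominus> y" n] by simp
  moreover have "x = x \<ominus> y \<oplus> y" using assms by (simp add: minus_eq a_assoc l_neg)
  ultimately show ?thesis using assms by simp
qed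

text \<open>Cancelling \<open>a^m\<close> on the right; this lets every statement modulo
  \<open>R a^k\<close> be moved to the higher level \<open>k + m\<close> and back.\<close>

lemma pow_mem_iff:
  assumes x: "x \<in> carrier R"
  shows "x \<otimes> a [^] m \<in> PIdl (a [^] (k + m)) \<longleftrightarrow> x \<in> PIdl (a [^] (k::nat))"
proof -
  have "x \<otimes> a [^] m = r \<otimes> a [^] (k + m) \<longleftrightarrow> x = r \<otimes> a [^] k" if "r \<in> carrier R" for r
    using that x cancel[of x "r \<otimes> a [^] k" m] by (auto simp: pow_mult)
  then show ?thesis unfolding cgenideal_iff by blast
qed

lemma pow_mem_mono:
  fixes i j :: nat assumes "i \<le> j" shows "PIdl (a [^] j) \<subseteq> PIdl (a [^] i)"
proof
  fix x assume "x \<in> PIdl (a [^] j)"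
  then obtain r where r: "r \<in> carrier R" "x = r \<otimes> a [^] j" by (auto simp: cgenideal_iff)
  then have "x = (r \<otimes> a [^] (j - i)) \<otimes> a [^] i" using assms by (simp add: pow_mult)
  then show "x \<in> PIdl (a [^] i)" using r unfolding cgenideal_iff by (intro bexI[of _ "r \<otimes> a [^] (j - i)"]) auto
qed

lemma pow_in_pow: "a [^] (i::nat) \<in> PIdl (a [^] i)"
  unfolding cgenideal_iff by (intro bexI[of _ \<one>]) auto

text \<open>The powers are strictly decreasing: from \<open>a^i \<in> R a^(i+1)\<close>,
  cancellation of \<open>a^i\<close> would give \<open>1 \<in> R a\<close>.\<close>

lemma pow_in_pow_iff: "a [^] i \<in> PIdl (a [^] j) \<longleftrightarrow> (j::nat) \<le> i"
proof
  assume mem: "a [^] i \<in> PIdl (a [^] j)"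
  show "j \<le> i"
  proof (rule ccontr)
    assume "\<not> j \<le> i"
    then have "\<one> \<otimes> a [^] i \<in> PIdl (a [^] (1 + i))"
      using mem pow_mem_mono[of "1 + i" j] by auto
    then show False using one_notin pow_mem_iff[of \<one> i 1] by simp
  qed
qed (use pow_mem_mono pow_in_pow in blast)

lemma pow_subset_iff: "PIdl (a [^] i) \<subseteq> PIdl (a [^] j) \<longleftrightarrow> (j::nat) \<le> i"
  using pow_in_pow[of i] pow_in_pow_iff[of i j] pow_mem_mono[of j i] by blast

text \<open>Let \<open>i\<close> be the largest exponent with \<open>N\<close> inside
  \<open>R a^i\<close>. Dividing \<open>N\<close> by \<open>a^i\<close> on the right gives a left
  ideal that is not inside \<open>R a\<close> and still contains a power of \<open>a\<close>; by
  \<open>local\<close> it contains \<open>1\<close>, so \<open>a^i \<in> N\<close>.\<close>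

lemma left_ideal_cases:
  assumes N: "submodule N R (regular_module R)" and n: "a [^] (n::nat) \<in> N"
  obtains i where "i \<le> n" "N = PIdl (a [^] i)"
proof -
  have N': "N \<subseteq> carrier R" "\<zero> \<in> N" "\<And>x y. x \<in> N \<Longrightarrow> y \<in> N \<Longrightarrow> x \<oplus> y \<in> N"
    "\<And>b x. b \<in> carrier R \<Longrightarrow> x \<in> N \<Longrightarrow> b \<otimes> x \<in> N"
    using N unfolding submodule_regular_iff by auto
  have sup: "PIdl (a [^] i) \<subseteq> N" if "a [^] i \<in> N" for i :: nat
    using N'(4) that by (auto simp: cgenideal_iff)
  show thesis
  proof (cases "N \<subseteq> PIdl (a [^] n)")
    case True
    then show thesis using sup[OF n] that[of n] by auto
  next
    case False
    \<comment> \<open>The exponent is shifted by one so that minimality of \<open>i\<close> yields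
      \<open>N \<subseteq> R a^i\<close>; for \<open>i = 0\<close> this holds because
      \<open>R a^0\<close> is the whole ring.\<close>
    define i where "i = (LEAST i. \<not> N \<subseteq> PIdl (a [^] Suc i))"
    have n0: "n \<noteq> 0" using False N'(1) by (auto simp: cgenideal_iff)
    then have *: "\<not> N \<subseteq> PIdl (a [^] Suc (n - 1))" using False by simp
    then have i: "\<not> N \<subseteq> PIdl (a [^] Suc i)" and "i \<le> n - 1"
      unfolding i_def by (rule LeastI, rule Least_le)
    then have in': "i < n" using n0 by simp
    have Ni: "N \<subseteq> PIdl (a [^] i)"
    proof (cases i)
      case 0
      then show ?thesis using N'(1) by (auto simp: cgenideal_iff)
    next
      case (Suc j)
      then show ?thesis using not_less_Least[of j "\<lambda>i. \<not> N \<subseteq> PIdl (a [^] Suc i)"] by (simp add: i_def)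
    qed
    define N0 where "N0 = {x \<in> carrier R. x \<otimes> a [^] i \<in> N}"
    have "submodule N0 R (regular_module R)"
      using N' unfolding submodule_regular_iff N0_def by (auto simp: l_distr m_assoc)
    moreover have "a [^] (n - i) \<in> N0" using n in' by (simp add: N0_def nat_pow_mult)
    moreover have "\<not> N0 \<subseteq> PIdl a"
    proof -
      obtain y where y: "y \<in> N" "y \<notin> PIdl (a [^] Suc i)" using i by auto
      then have "y \<in> PIdl (a [^] i)" using Ni by blast
      then obtain x where x: "x \<in> carrier R" "y = x \<otimes> a [^] i" by (auto simp: cgenideal_iff)
      have "x \<notin> PIdl a" using y x pow_mem_iff[of x i 1] by simp
      then show ?thesis using x y by (auto simp: N0_def)
    qed
    ultimately have "\<one> \<in> N0" by (rule local)
    then have "N = PIdl (a [^] i)" using Ni sup[of i] by (auto simp: N0_def)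
    with in' show thesis by (intro that[of i]) simp_all
  qed
qed

section \<open>Submodules and composition series of \<open>R / R a^n\<close>\<close>

abbreviation pcos :: "nat \<Rightarrow> 'a \<Rightarrow> 'a set" where
  "pcos n x \<equiv> PIdl (a [^] n) +> x"

lemma regular_coset: "N +>\<^bsub>regular_module R\<^esub> x = N +> x"
  by (simp add: a_r_coset_def' regular_module_def)

lemma left_module_power_quot: "left_module R (power_quot R a n)"
  unfolding power_quot_def
  by (intro left_module.left_module_quot left_module_regular submodule_left_principal) simp

lemma pcos_hom: "pcos n \<in> left_module_hom R (regular_module R) (power_quot R a n)"
  using left_module.quot_map_hom[OF left_module_regular submodule_left_principal[of "a [^] n"]]
  by (simp add: power_quot_def regular_coset)

lemma pcos_eq_iff:
  "\<lbrakk>x \<in> carrier R; y \<in> carrier R\<rbrakk> \<Longrightarrow> pcos n x = pcos n y \<longleftrightarrow> x \<ominus> y \<in> PIdl (a [^] n)"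
  by (simp add: left_principal_coset_eq cgenideal_iff)

lemma pcos_zero: "\<zero>\<^bsub>power_quot R a n\<^esub> = pcos n \<zero>"
  using left_module.quot_zero[OF left_module_regular submodule_left_principal[of "a [^] n"]]
  unfolding power_quot_def regular_coset by (simp add: regular_module_def)

lemma pcos_carrier: "carrier (power_quot R a n) = pcos n ` carrier R"
  by (auto elim!: power_quot_carrierE intro: power_quot_carrierI)

text \<open>For \<open>j \<le> n\<close> this is \<open>R a^j / R a^n\<close>, descending from the
  whole module at \<open>j = 0\<close> to zero at \<open>j = n\<close>.\<close>

definition W :: "nat \<Rightarrow> nat \<Rightarrow> 'a set set" where
  "W n j = pcos n ` (PIdl (a [^] j))"

lemma W_image: "W n j = (\<lambda>x. pcos n (x \<otimes> a [^] j)) ` carrier R"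
proof -
  have "PIdl (a [^] j) = (\<lambda>x. x \<otimes> a [^] j) ` carrier R" by (auto simp: cgenideal_iff)
  then show ?thesis by (simp add: W_def image_image)
qed

lemma principal_carrier: "x \<in> PIdl (a [^] (j::nat)) \<Longrightarrow> x \<in> carrier R"
  by (auto simp: cgenideal_iff)

text \<open>For \<open>j \<le> n\<close> the left ideal \<open>R a^j\<close> contains
  \<open>R a^n\<close> and is thus a union of cosets, so membership does not depend on the
  representative.\<close>

lemma pcos_in_W:
  assumes x: "x \<in> carrier R" and j: "j \<le> n"
  shows "pcos n x \<in> W n j \<longleftrightarrow> x \<in> PIdl (a [^] j)"
proof
  assume "pcos n x \<in> W n j"
  then obtain y where y: "y \<in> PIdl (a [^] j)" "pcos n x = pcos n y" by (auto simp: W_def)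
  have yc: "y \<in> carrier R" using y(1) by (rule principal_carrier)
  have "x \<ominus> y \<in> PIdl (a [^] j)" using y x yc pow_mem_mono[OF j] by (auto simp: pcos_eq_iff)
  then have "(x \<ominus> y) \<oplus> y \<in> PIdl (a [^] j)"
    using y submodule_left_principal[of "a [^] j"] by (simp add: submodule_regular_iff)
  then show "x \<in> PIdl (a [^] j)" using x yc by (simp add: minus_eq a_assoc l_neg)
qed (auto simp: W_def)

lemma W_subset_iff:
  assumes "i \<le> n" "j \<le> n" shows "W n i \<subseteq> W n j \<longleftrightarrow> j \<le> i"
proof -
  have "W n i \<subseteq> W n j \<longleftrightarrow> PIdl (a [^] i) \<subseteq> PIdl (a [^] j)"
    using pcos_in_W[OF principal_carrier assms(2)] unfolding W_def[of n i] by auto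
  then show ?thesis by (simp add: pow_subset_iff)
qed

lemma W_0: "W n 0 = carrier (power_quot R a n)"
proof -
  have "PIdl (a [^] (0::nat)) = carrier R" by (auto simp: cgenideal_iff)
  then show ?thesis by (simp add: W_def pcos_carrier)
qed

lemma W_n: "W n n = {\<zero>\<^bsub>power_quot R a n\<^esub>}"
proof -
  have "pcos n x = pcos n \<zero>" if "x \<in> PIdl (a [^] n)" for x
    using that principal_carrier[OF that] by (simp add: pcos_eq_iff minus_eq)
  then have "pcos n ` (PIdl (a [^] n)) = (\<lambda>_. pcos n \<zero>) ` (PIdl (a [^] n))"
    by (intro image_cong refl)
  moreover have "\<zero> \<in> PIdl (a [^] n)"
    using submodule_left_principal[of "a [^] n"] by (simp add: submodule_regular_iff)
  ultimately show ?thesis unfolding W_def pcos_zero by (simp only: image_constant)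
qed

text \<open>The preimage in \<open>R\<close> of a submodule contains \<open>a^n\<close>, which
  becomes zero in the quotient; hence \<open>left_ideal_cases\<close> applies to it.\<close>

lemma submodule_power_quot_iff:
  "submodule P R (power_quot R a n) \<longleftrightarrow> (\<exists>j\<le>n. P = W n j)"
proof
  have zero: "pcos n \<zero>\<^bsub>regular_module R\<^esub> = \<zero>\<^bsub>power_quot R a n\<^esub>"
    by (simp add: pcos_zero regular_module_def)
  interpret Q: left_module R "power_quot R a n" by (rule left_module_power_quot)
  {
    assume P: "submodule P R (power_quot R a n)"
    let ?N = "{x \<in> carrier (regular_module R). pcos n x \<in> P}"
    have N: "submodule ?N R (regular_module R)"
      by (rule submodule_vimage[OF left_module_regular left_module_power_quot pcos_hom zero P])
    have carrier: "carrier (regular_module R) = carrier R" by (simp add: regular_module_def)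
    have "pcos n (a [^] n) = \<zero>\<^bsub>power_quot R a n\<^esub>"
      using pow_in_pow[of n] by (simp add: pcos_zero pcos_eq_iff minus_eq)
    then have "a [^] n \<in> ?N" using P by (simp add: carrier Q.submodule_iff)
    then obtain j where j: "j \<le> n" "?N = PIdl (a [^] j)" using left_ideal_cases[OF N] by blast
    have "P = pcos n ` ?N" using P unfolding Q.submodule_iff pcos_carrier carrier by auto
    then show "\<exists>j\<le>n. P = W n j" using j unfolding W_def by auto
  }
  {
    assume "\<exists>j\<le>n. P = W n j"
    then obtain j where P: "P = W n j" by auto
    show "submodule P R (power_quot R a n)"
      unfolding P W_def
      by (rule submodule_image[OF left_module_regular left_module_power_quot pcos_hom zero])
        (simp add: submodule_left_principal)
  }
qed

lemma submodule_W: "j \<le> n \<Longrightarrow> submodule (W n j) R (power_quot R a n)"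
  unfolding submodule_power_quot_iff by (rule exI[of _ j]) simp

lemma composition_series_power_quot:
  "composition_series R (power_quot R a n) Ns \<longleftrightarrow> Ns = map (\<lambda>i. W n (n - i)) [0..<Suc n]"
  by (rule left_module.composition_series_chain[OF left_module_power_quot])
    (auto simp: submodule_power_quot_iff W_subset_iff W_0 W_n)

text \<open>The isomorphism is induced by \<open>x a^j \<mapsto> f x\<close>. It is well defined
  because \<open>x a^j \<in> R a^n \<subseteq> R a^(j+1)\<close> implies \<open>x \<in> R a\<close>
  by cancellation, and \<open>R a\<close> is the kernel of \<open>f\<close>. The same cancellation
  identifies the kernel of the induced map with \<open>W n (Suc j)\<close>.\<close>

lemma chain_factor_power_quot:
  assumes V: "left_module R V" and f: "f \<in> left_module_hom R (regular_module R) V"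
    and surj: "f ` carrier R = carrier V"
    and ker: "\<And>x. x \<in> carrier R \<Longrightarrow> f x = \<zero>\<^bsub>V\<^esub> \<longleftrightarrow> x \<in> PIdl a"
    and j: "j < n"
  shows "left_module_isomorphic R (quot_module ((power_quot R a n)\<lparr>carrier := W n j\<rparr>) (W n (Suc j))) V"
proof -
  let ?Q = "power_quot R a n" and ?e = "\<lambda>x. pcos n (x \<otimes> a [^] j)"
  interpret V: left_module R V by fact
  interpret Q: left_module R ?Q by (rule left_module_power_quot)
  have Wj: "submodule (W n j) R ?Q" "submodule (W n (Suc j)) R ?Q"
    using j submodule_W by simp_all
  interpret M2: left_module R "?Q\<lparr>carrier := W n j\<rparr>" by (rule Q.left_module_restrict[OF Wj(1)])
  have sub: "submodule (W n (Suc j)) R (?Q\<lparr>carrier := W n j\<rparr>)"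
    using Q.submodule_restrict_iff[OF Wj(1)] Wj(2) W_subset_iff[of "Suc j" n j] j by simp
  have fh: "f (x \<oplus> y) = f x \<oplus>\<^bsub>V\<^esub> f y" "f (x \<otimes> y) = x \<odot>\<^bsub>V\<^esub> f y" "f x \<in> carrier V"
    if "x \<in> carrier R" "y \<in> carrier R" for x y
    using f that unfolding left_module_hom_def by (auto simp: regular_module_def)
  note Wex = W_image[of n j]
  have eq: "f x = f y" if x: "x \<in> carrier R" and y: "y \<in> carrier R" and e: "?e x = ?e y" for x y
  proof -
    have "(x \<ominus> y) \<otimes> a [^] j = x \<otimes> a [^] j \<ominus> y \<otimes> a [^] j"
      using x y by (simp add: minus_eq l_distr l_minus)
    also have "\<dots> \<in> PIdl (a [^] n)" using e x y by (simp add: pcos_eq_iff)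
    also have "PIdl (a [^] n) \<subseteq> PIdl (a [^] (1 + j))" using j by (intro pow_mem_mono) simp
    finally have "x \<ominus> y \<in> PIdl a" using pow_mem_iff[of "x \<ominus> y" j 1] x y by simp
    then have "f (x \<ominus> y) = \<zero>\<^bsub>V\<^esub>" using ker x y by simp
    moreover have "f x = f (x \<ominus> y) \<oplus>\<^bsub>V\<^esub> f y"
      using x y by (subst fh(1)[symmetric]) (auto simp: minus_eq a_assoc l_neg)
    ultimately show ?thesis using fh(3)[OF y y] by simp
  qed
  define h where "h X = f (SOME x. x \<in> carrier R \<and> ?e x = X)" for X
  have h: "h (?e x) = f x" if x: "x \<in> carrier R" for x
  proof -
    let ?y = "SOME y. y \<in> carrier R \<and> ?e y = ?e x"
    have "?y \<in> carrier R \<and> ?e ?y = ?e x" by (rule someI[of _ x]) (use x in simp)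
    then show ?thesis unfolding h_def using x eq by blast
  qed
  have eadd: "?e x \<oplus>\<^bsub>?Q\<^esub> ?e y = ?e (x \<oplus> y)" if "x \<in> carrier R" "y \<in> carrier R" for x y
    using that by (simp add: power_quot_add_coset l_distr)
  have esm: "b \<odot>\<^bsub>?Q\<^esub> ?e x = ?e (b \<otimes> x)" if "b \<in> carrier R" "x \<in> carrier R" for x b
    using that by (simp add: power_quot_smult_coset m_assoc)
  have "h \<in> left_module_hom R (?Q\<lparr>carrier := W n j\<rparr>) V"
    unfolding left_module_hom_def Wex by (auto simp: h eadd esm fh)
  then show ?thesis
  proof (rule M2.quot_isomorphic[OF sub V])
    show "h ` carrier (?Q\<lparr>carrier := W n j\<rparr>) = carrier V"
    proof -
      have "h ` carrier (?Q\<lparr>carrier := W n j\<rparr>) = (\<lambda>x. h (?e x)) ` carrier R" by (simp add: Wex image_image)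
      also have "\<dots> = f ` carrier R" using h by (rule image_cong[OF refl])
      finally show ?thesis using surj by simp
    qed
    fix X assume "X \<in> carrier (?Q\<lparr>carrier := W n j\<rparr>)"
    then obtain x where x: "x \<in> carrier R" "X = ?e x" by (auto simp: Wex)
    have "X \<in> W n (Suc j) \<longleftrightarrow> x \<otimes> a [^] j \<in> PIdl (a [^] (1 + j))"
      using x j pcos_in_W[of "x \<otimes> a [^] j" "Suc j" n] by simp
    also have "\<dots> \<longleftrightarrow> x \<in> PIdl a" using pow_mem_iff[of x j 1] x by simp
    finally show "h X = \<zero>\<^bsub>V\<^esub> \<longleftrightarrow> X \<in> W n (Suc j)" using x by (simp add: h ker)
  qed
qed

text \<open>Injectivity of the transition map from \<open>R / R a^k\<close> to
  \<open>R / R a^(k+m)\<close>.\<close>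

lemma pcos_shift:
  assumes x: "x \<in> carrier R" and y: "y \<in> carrier R"
  shows "pcos (k + m) (x \<otimes> a [^] m) = pcos (k + m) (y \<otimes> a [^] m) \<longleftrightarrow> pcos k x = pcos k y"
proof -
  have "x \<otimes> a [^] m \<ominus> y \<otimes> a [^] m = (x \<ominus> y) \<otimes> a [^] m"
    using x y by (simp add: minus_eq l_distr l_minus)
  then show ?thesis using x y pow_mem_iff[of "x \<ominus> y" m k] by (simp add: pcos_eq_iff)
qed

section \<open>The direct limit as a set of fractions\<close>

definition prel :: "((nat \<times> 'a set) \<times> (nat \<times> 'a set)) set" where
  "prel = dlim_rel {1..} (power_quot R a) (power_quot_map R a)"

text \<open>Since the transition maps are injective, agreement at some level \<open>k\<close> is the
  same as agreement at the level \<open>i + j\<close>. This turns the existential quantifier of the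
  direct limit into cross multiplication of the fractions \<open>x / a^i\<close> and
  \<open>y / a^j\<close>.\<close>

lemma prel_iff:
  assumes i: "1 \<le> i" and j: "1 \<le> j" and x: "x \<in> carrier R" and y: "y \<in> carrier R"
  shows "((i, pcos i x), (j, pcos j y)) \<in> prel \<longleftrightarrow>
    pcos (i + j) (x \<otimes> a [^] j) = pcos (i + j) (y \<otimes> a [^] i)" (is "?L \<longleftrightarrow> ?R")
proof -
  have level: "power_quot_map R a i k (pcos i x) = power_quot_map R a j k (pcos j y) \<longleftrightarrow> ?R"
    if k: "i \<le> k" "j \<le> k" for k
  proof -
    have s: "i + (k - i) = k" "j + (k - j) = k" using k by auto
    \<comment> \<open>Levels \<open>k\<close> and \<open>i + j\<close> are not assumed comparable,
      so both are embedded into the level \<open>k + (i + j)\<close>.\<close>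
    have "pcos k (x \<otimes> a [^] (k - i)) = pcos k (y \<otimes> a [^] (k - j)) \<longleftrightarrow>
        pcos (k + (i + j)) (x \<otimes> a [^] (k - i) \<otimes> a [^] (i + j)) =
        pcos (k + (i + j)) (y \<otimes> a [^] (k - j) \<otimes> a [^] (i + j))"
      using x y by (intro pcos_shift[symmetric]) auto
    also have "x \<otimes> a [^] (k - i) \<otimes> a [^] (i + j) = x \<otimes> a [^] j \<otimes> a [^] k"
      using x k by (simp add: pow_mult) (simp add: add.commute)
    also have "y \<otimes> a [^] (k - j) \<otimes> a [^] (i + j) = y \<otimes> a [^] i \<otimes> a [^] k"
      using y k by (simp add: pow_mult)  (simp add: add.commute)
    also have "pcos (k + (i + j)) (x \<otimes> a [^] j \<otimes> a [^] k) = pcos (k + (i + j)) (y \<otimes> a [^] i \<otimes> a [^] k) \<longleftrightarrow> ?R"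
      unfolding add.commute[of k "i + j"] using x y by (intro pcos_shift) auto
    finally show ?thesis
      using k x y by (simp only: power_quot_map_coset elem_closed)
  qed
  have "?L \<longleftrightarrow> (\<exists>k\<in>{1..}. i \<le> k \<and> j \<le> k \<and>
      power_quot_map R a i k (pcos i x) = power_quot_map R a j k (pcos j y))"
    unfolding prel_def dlim_rel_def using i j power_quot_carrierI[OF x, of a i] power_quot_carrierI[OF y, of a j] by simp
  also have "\<dots> \<longleftrightarrow> ?R"
  proof
    assume ?R
    then show "\<exists>k\<in>{1..}. i \<le> k \<and> j \<le> k \<and>
      power_quot_map R a i k (pcos i x) = power_quot_map R a j k (pcos j y)"
      using level[of "i + j"] i by (intro bexI[of _ "i + j"]) simp_all
  qed (use level in blast)
  finally show ?thesis .
qed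

text \<open>As for fractions: both equations are expanded to the common level
  \<open>i + j + k\<close>, combined there, and the factor \<open>a^j\<close> is cancelled.\<close>

lemma prel_trans_aux:
  assumes x: "x \<in> carrier R" and y: "y \<in> carrier R" and z: "z \<in> carrier R"
    and xy: "pcos (i + j) (x \<otimes> a [^] j) = pcos (i + j) (y \<otimes> a [^] i)"
    and yz: "pcos (j + k) (y \<otimes> a [^] k) = pcos (j + k) (z \<otimes> a [^] j)"
  shows "pcos (i + k) (x \<otimes> a [^] k) = pcos (i + k) (z \<otimes> a [^] i)"
proof -
  have "pcos ((i + j) + k) (x \<otimes> a [^] j \<otimes> a [^] k) = pcos ((i + j) + k) (y \<otimes> a [^] i \<otimes> a [^] k)"
    using pcos_shift[of "x \<otimes> a [^] j" "y \<otimes> a [^] i" "i + j" k] x y xy by simp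
  moreover have "pcos ((j + k) + i) (y \<otimes> a [^] k \<otimes> a [^] i) = pcos ((j + k) + i) (z \<otimes> a [^] j \<otimes> a [^] i)"
    using pcos_shift[of "y \<otimes> a [^] k" "z \<otimes> a [^] j" "j + k" i] y z yz by simp
  moreover have "(j + k) + i = (i + j) + k" "y \<otimes> a [^] k \<otimes> a [^] i = y \<otimes> a [^] i \<otimes> a [^] k"
    "(i + j) + k = (i + k) + j" "x \<otimes> a [^] j \<otimes> a [^] k = x \<otimes> a [^] k \<otimes> a [^] j"
    "z \<otimes> a [^] j \<otimes> a [^] i = z \<otimes> a [^] i \<otimes> a [^] j"
    using x y z by (simp_all add: pow_mult add.commute)
  ultimately have "pcos ((i + k) + j) (x \<otimes> a [^] k \<otimes> a [^] j) = pcos ((i + k) + j) (z \<otimes> a [^] i \<otimes> a [^] j)"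
    by simp
  then show ?thesis
    using pcos_shift[of "x \<otimes> a [^] k" "z \<otimes> a [^] i" "i + k" j] x z by simp
qed

abbreviation psum :: "(nat \<times> 'a set) set" where
  "psum \<equiv> SIGMA i:{1..}. carrier (power_quot R a i)"

lemma psumE:
  assumes "s \<in> psum"
  obtains i x where "1 \<le> i" "x \<in> carrier R" "s = (i, pcos i x)"
  using assms by (auto elim!: power_quot_carrierE)

lemma psumI: "\<lbrakk>1 \<le> i; x \<in> carrier R\<rbrakk> \<Longrightarrow> (i, pcos i x) \<in> psum"
  by (auto intro: power_quot_carrierI)

lemma equiv_prel: "equiv psum prel"
proof (rule equivI)
  show sub: "prel \<subseteq> psum \<times> psum" by (auto simp: prel_def dlim_rel_def)
  show "refl_on psum prel"
  proof (rule refl_onI)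
    fix s assume "s \<in> psum"
    then obtain i x where "1 \<le> i" "x \<in> carrier R" "s = (i, pcos i x)" by (rule psumE)
    then show "(s, s) \<in> prel" by (simp only: prel_iff)
  qed
  show "sym prel" by (auto simp: prel_def dlim_rel_def sym_def intro: sym)
  show "trans prel"
  proof (rule transI)
    fix s t u assume st: "(s, t) \<in> prel" and tu: "(t, u) \<in> prel"
    then have "s \<in> psum" "t \<in> psum" "u \<in> psum" using sub by blast+
    obtain i x where s: "1 \<le> i" "x \<in> carrier R" "s = (i, pcos i x)" using \<open>s \<in> psum\<close> by (rule psumE)
    obtain j y where t: "1 \<le> j" "y \<in> carrier R" "t = (j, pcos j y)" using \<open>t \<in> psum\<close> by (rule psumE)
    obtain k z where u: "1 \<le> k" "z \<in> carrier R" "u = (k, pcos k z)" using \<open>u \<in> psum\<close> by (rule psumE)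
    have "pcos (i + k) (x \<otimes> a [^] k) = pcos (i + k) (z \<otimes> a [^] i)"
      using st tu s t u by (intro prel_trans_aux[of x y z i j k]) (simp_all only: prel_iff)
    then show "(s, u) \<in> prel" using s u by (simp only: prel_iff)
  qed
qed

text \<open>The class of \<open>x + R a\<^sup>i\<close> in the limit behaves like a fraction \<open>x / a\<^sup>i\<close> modulo \<open>R\<close>.\<close>

definition pfrac :: "nat \<Rightarrow> 'a \<Rightarrow> (nat \<times> 'a set) set" where
  "pfrac i x = prel `` {(i, pcos i x)}"

lemma pfrac_eq_iff:
  assumes "1 \<le> i" "1 \<le> j" "x \<in> carrier R" "y \<in> carrier R"
  shows "pfrac i x = pfrac j y \<longleftrightarrow> pcos (i + j) (x \<otimes> a [^] j) = pcos (i + j) (y \<otimes> a [^] i)"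
  unfolding pfrac_def using eq_equiv_class_iff[OF equiv_prel psumI psumI] prel_iff assms by simp

lemma pfrac_mem:
  assumes "(j, Y) \<in> pfrac i x" "1 \<le> i" "x \<in> carrier R"
  obtains y where "1 \<le> j" "y \<in> carrier R" "Y = pcos j y" "pfrac j y = pfrac i x"
proof -
  have r: "((i, pcos i x), (j, Y)) \<in> prel" using assms by (simp add: pfrac_def)
  then have "(j, Y) \<in> psum" using equiv_prel by (auto simp: equiv_def)
  then obtain j' y where "1 \<le> j'" "y \<in> carrier R" "(j, Y) = (j', pcos j' y)" by (rule psumE)
  moreover have "prel `` {(i, pcos i x)} = prel `` {(j, Y)}" by (rule equiv_class_eq[OF equiv_prel r])
  ultimately show thesis using that[of y] by (simp add: pfrac_def)
qed

lemma pfrac_self: "\<lbrakk>1 \<le> i; x \<in> carrier R\<rbrakk> \<Longrightarrow> (i, pcos i x) \<in> pfrac i x"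
  unfolding pfrac_def by (rule equiv_class_self[OF equiv_prel psumI])

lemma pfrac_shift:
  assumes "1 \<le> i" "x \<in> carrier R" shows "pfrac (i + m) (x \<otimes> a [^] m) = pfrac i x"
  using assms by (simp add: pfrac_eq_iff pow_mult add.commute)

lemma pfrac_eq_same_iff:
  assumes "1 \<le> i" "x \<in> carrier R" "y \<in> carrier R"
  shows "pfrac i x = pfrac i y \<longleftrightarrow> pcos i x = pcos i y"
  using assms by (simp add: pfrac_eq_iff pcos_shift)

lemma pfrac_add_cong:
  assumes i: "1 \<le> i" "1 \<le> k" and c: "x \<in> carrier R" "y \<in> carrier R" "x' \<in> carrier R" "y' \<in> carrier R"
    and eq: "pfrac k x' = pfrac i x" "pfrac k y' = pfrac i y"
  shows "pfrac k (x' \<oplus> y') = pfrac i (x \<oplus> y)"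
proof -
  have x: "pcos (k + i) (x' \<otimes> a [^] i) = pcos (k + i) (x \<otimes> a [^] k)"
    and y: "pcos (k + i) (y' \<otimes> a [^] i) = pcos (k + i) (y \<otimes> a [^] k)"
    using eq i c by (simp_all only: pfrac_eq_iff)
  have "pcos (k + i) ((x' \<oplus> y') \<otimes> a [^] i) =
      pcos (k + i) (x' \<otimes> a [^] i) \<oplus>\<^bsub>power_quot R a (k + i)\<^esub> pcos (k + i) (y' \<otimes> a [^] i)"
    using c by (simp add: l_distr power_quot_add_coset)
  also have "\<dots> = pcos (k + i) ((x \<oplus> y) \<otimes> a [^] k)"
    unfolding x y using c by (simp add: l_distr power_quot_add_coset)
  finally show ?thesis using i c by (simp add: pfrac_eq_iff)
qed

lemma pfrac_smult_cong:
  assumes i: "1 \<le> i" "1 \<le> k" and c: "x \<in> carrier R" "x' \<in> carrier R" "b \<in> carrier R"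
    and eq: "pfrac k x' = pfrac i x"
  shows "pfrac k (b \<otimes> x') = pfrac i (b \<otimes> x)"
proof -
  have x: "pcos (k + i) (x' \<otimes> a [^] i) = pcos (k + i) (x \<otimes> a [^] k)"
    using eq i c by (simp only: pfrac_eq_iff)
  have "pcos (k + i) (b \<otimes> x' \<otimes> a [^] i) = b \<odot>\<^bsub>power_quot R a (k + i)\<^esub> pcos (k + i) (x' \<otimes> a [^] i)"
    using c by (simp add: m_assoc power_quot_smult_coset)
  also have "\<dots> = pcos (k + i) (b \<otimes> x \<otimes> a [^] k)"
    unfolding x using c by (simp add: m_assoc power_quot_smult_coset)
  finally show ?thesis using i c by (simp add: pfrac_eq_iff)
qed

section \<open>Module structure and submodules of the Pruefer module\<close>

abbreviation "U \<equiv> pruefer_module R a"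

lemma pruefer_carrier_iff: "X \<in> carrier U \<longleftrightarrow> (\<exists>i\<ge>1. \<exists>x\<in>carrier R. X = pfrac i x)"
proof -
  have "X \<in> carrier U \<longleftrightarrow> (\<exists>s\<in>psum. X = prel `` {s})"
    by (auto simp: pruefer_module_def direct_limit_def prel_def quotient_def)
  also have "\<dots> \<longleftrightarrow> (\<exists>i\<ge>1. \<exists>x\<in>carrier R. X = pfrac i x)"
  proof
    assume "\<exists>s\<in>psum. X = prel `` {s}"
    then obtain s where s: "s \<in> psum" "X = prel `` {s}" by (rule bexE)
    obtain i x where "1 \<le> i" "x \<in> carrier R" "s = (i, pcos i x)" using s(1) by (rule psumE)
    then show "\<exists>i\<ge>1. \<exists>x\<in>carrier R. X = pfrac i x" using s(2) unfolding pfrac_def by (intro exI conjI bexI[of _ x]) simp_all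
  next
    assume "\<exists>i\<ge>1. \<exists>x\<in>carrier R. X = pfrac i x"
    then obtain i x where "1 \<le> i" "x \<in> carrier R" "X = pfrac i x" by (elim exE conjE bexE)
    then show "\<exists>s\<in>psum. X = prel `` {s}" unfolding pfrac_def by (intro bexI[OF _ psumI])
  qed
  finally show ?thesis .
qed

text \<open>The sum in a direct limit is a union over all pairs of representatives and all common
  levels \<open>k\<close>; every term of that union is the same class, by invariance of fractions
  under expansion.\<close>

lemma pruefer_add:
  assumes i: "1 \<le> i" and x: "x \<in> carrier R" and y: "y \<in> carrier R"
  shows "pfrac i x \<oplus>\<^bsub>U\<^esub> pfrac i y = pfrac i (x \<oplus> y)"
proof -
  let ?f = "\<lambda>(j, X) (j', Y) k. prel `` {(k, power_quot_map R a j k X \<oplus>\<^bsub>power_quot R a k\<^esub> power_quot_map R a j' k Y)}"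
  have eq: "?f s t k = pfrac i (x \<oplus> y)"
    if s: "s \<in> pfrac i x" and t: "t \<in> pfrac i y" and k: "k \<in> {k\<in>{1..}. fst s \<le> k \<and> fst t \<le> k}" for s t k
  proof -
    obtain j X where [simp]: "s = (j, X)" by (cases s)
    obtain j' Y where [simp]: "t = (j', Y)" by (cases t)
    obtain x' where x': "1 \<le> j" "x' \<in> carrier R" "X = pcos j x'" "pfrac j x' = pfrac i x"
      using s i x by (auto elim: pfrac_mem)
    obtain y' where y': "1 \<le> j'" "y' \<in> carrier R" "Y = pcos j' y'" "pfrac j' y' = pfrac i y"
      using t i y by (auto elim: pfrac_mem)
    have k': "1 \<le> k" "j \<le> k" "j' \<le> k" using k by auto
    have "pfrac (j + (k - j)) (x' \<otimes> a [^] (k - j)) = pfrac j x'" using x' by (intro pfrac_shift)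
    then have fx: "pfrac k (x' \<otimes> a [^] (k - j)) = pfrac i x" using k' x' by simp
    have "pfrac (j' + (k - j')) (y' \<otimes> a [^] (k - j')) = pfrac j' y'" using y' by (intro pfrac_shift)
    then have fy: "pfrac k (y' \<otimes> a [^] (k - j')) = pfrac i y" using k' y' by simp
    have "?f s t k = pfrac k (x' \<otimes> a [^] (k - j) \<oplus> y' \<otimes> a [^] (k - j'))"
      using k' x' y' by (simp add: pfrac_def power_quot_map_coset power_quot_add_coset)
    also have "\<dots> = pfrac i (x \<oplus> y)"
      using i k' x y x' y' fx fy by (intro pfrac_add_cong) simp_all
    finally show ?thesis .
  qed
  have "pfrac i x \<oplus>\<^bsub>U\<^esub> pfrac i y =
      (\<Union>s\<in>pfrac i x. \<Union>t\<in>pfrac i y. \<Union>k\<in>{k\<in>{1..}. fst s \<le> k \<and> fst t \<le> k}. ?f s t k)"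
    unfolding pruefer_module_def direct_limit_def prel_def[symmetric]
    by (simp add: case_prod_unfold)
  also have "\<dots> = (\<Union>s\<in>pfrac i x. \<Union>t\<in>pfrac i y. pfrac i (x \<oplus> y))"
  proof (intro SUP_cong refl SUP_eq_const)
    fix s t :: "nat \<times> 'a set"
    \<comment> \<open>A union over an empty set of levels would be empty. The successor provides a
      level that is at least \<open>1\<close>, as the index set of the limit requires.\<close>
    have "Suc (fst s + fst t) \<in> {k\<in>{1..}. fst s \<le> k \<and> fst t \<le> k}" by simp
    then show "{k\<in>{1..}. fst s \<le> k \<and> fst t \<le> k} \<noteq> {}" by blast
  qed (rule eq)
  also have "\<dots> = pfrac i (x \<oplus> y)"
    using pfrac_self[OF i x] pfrac_self[OF i y] by (intro SUP_eq_const refl) blast+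
  finally show ?thesis .
qed

lemma pruefer_smult:
  assumes i: "1 \<le> i" and x: "x \<in> carrier R" and b: "b \<in> carrier R"
  shows "b \<odot>\<^bsub>U\<^esub> pfrac i x = pfrac i (b \<otimes> x)"
proof -
  let ?f = "\<lambda>(j, X). prel `` {(j, b \<odot>\<^bsub>power_quot R a j\<^esub> X)}"
  have eq: "?f s = pfrac i (b \<otimes> x)" if s: "s \<in> pfrac i x" for s
  proof -
    obtain j X where [simp]: "s = (j, X)" by (cases s)
    obtain x' where x': "1 \<le> j" "x' \<in> carrier R" "X = pcos j x'" "pfrac j x' = pfrac i x"
      using s i x by (auto elim: pfrac_mem)
    have "?f s = pfrac j (b \<otimes> x')"
      using x' b by (simp add: pfrac_def power_quot_smult_coset)
    also have "\<dots> = pfrac i (b \<otimes> x)"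
      using i x x' b by (intro pfrac_smult_cong) simp_all
    finally show ?thesis .
  qed
  have "b \<odot>\<^bsub>U\<^esub> pfrac i x = (\<Union>s\<in>pfrac i x. ?f s)"
    unfolding pruefer_module_def direct_limit_def prel_def[symmetric] by simp
  also have "\<dots> = pfrac i (b \<otimes> x)"
    using pfrac_self[OF i x] by (intro SUP_eq_const eq) blast
  finally show ?thesis .
qed

lemma pfrac_zero: "\<lbrakk>1 \<le> i; 1 \<le> j\<rbrakk> \<Longrightarrow> pfrac i \<zero> = pfrac j \<zero>"
  by (simp add: pfrac_eq_iff)

lemma pruefer_zero:
  assumes i: "1 \<le> i" shows "\<zero>\<^bsub>U\<^esub> = pfrac i \<zero>"
proof -
  have "\<zero>\<^bsub>U\<^esub> = (\<Union>j\<in>{1..}. pfrac j \<zero>)"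
    unfolding pruefer_module_def direct_limit_def prel_def[symmetric] pfrac_def pcos_zero by simp
  also have "\<dots> = pfrac i \<zero>"
    using i by (intro SUP_eq_const pfrac_zero) auto
  finally show ?thesis .
qed

lemma common_index:
  assumes "X \<in> carrier U" "1 \<le> k"
  obtains i x where "k \<le> i" "x \<in> carrier R" "X = pfrac i x"
proof -
  obtain i x where i: "1 \<le> i" "x \<in> carrier R" "X = pfrac i x"
    using assms unfolding pruefer_carrier_iff by blast
  then show thesis
    using pfrac_shift[of i x k] by (intro that[of "i + k" "x \<otimes> a [^] k"]) simp_all
qed

lemma common_index2:
  assumes "X \<in> carrier U" "Y \<in> carrier U"
  obtains i x y where "1 \<le> i" "x \<in> carrier R" "y \<in> carrier R" "X = pfrac i x" "Y = pfrac i y"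
proof -
  obtain i x where i: "1 \<le> i" "x \<in> carrier R" "X = pfrac i x"
    using assms unfolding pruefer_carrier_iff by blast
  obtain j y where j: "1 \<le> j" "y \<in> carrier R" "Y = pfrac j y"
    using assms unfolding pruefer_carrier_iff by blast
  show thesis
    using i j pfrac_shift[of i x j] pfrac_shift[of j y i]
    by (intro that[of "i + j" "x \<otimes> a [^] j" "y \<otimes> a [^] i"]) (simp_all add: add.commute)
qed

lemma pfrac_carrier: "\<lbrakk>1 \<le> i; x \<in> carrier R\<rbrakk> \<Longrightarrow> pfrac i x \<in> carrier U"
  unfolding pruefer_carrier_iff by blast

lemma common_index3:
  assumes "X \<in> carrier U" "Y \<in> carrier U" "Z \<in> carrier U"
  obtains i x y z where "1 \<le> i" "x \<in> carrier R" "y \<in> carrier R" "z \<in> carrier R"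
    "X = pfrac i x" "Y = pfrac i y" "Z = pfrac i z"
proof -
  obtain i x y where i: "1 \<le> i" "x \<in> carrier R" "y \<in> carrier R" "X = pfrac i x" "Y = pfrac i y"
    using common_index2[OF assms(1,2)] .
  obtain j z where j: "1 \<le> j" "z \<in> carrier R" "Z = pfrac j z"
    using assms unfolding pruefer_carrier_iff by blast
  show thesis
    using i j pfrac_shift[of i x j] pfrac_shift[of i y j] pfrac_shift[of j z i]
    by (intro that[of "i + j" "x \<otimes> a [^] j" "y \<otimes> a [^] j" "z \<otimes> a [^] i"]) (simp_all add: add.commute)
qed

lemma left_module_pruefer: "left_module R U"
proof -
  have U1: "thesis" if "X \<in> carrier U" "\<And>i x. \<lbrakk>1 \<le> i; x \<in> carrier R; X = pfrac i x\<rbrakk> \<Longrightarrow> thesis" for X thesis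
    using that unfolding pruefer_carrier_iff by blast
  have "abelian_group U"
  proof (rule abelian_groupI)
    show "\<zero>\<^bsub>U\<^esub> \<in> carrier U" unfolding pruefer_zero[OF le_refl] by (simp add: pfrac_carrier)
    fix X assume X: "X \<in> carrier U"
    then obtain i x where x: "1 \<le> i" "x \<in> carrier R" "X = pfrac i x" by (rule U1)
    show "\<zero>\<^bsub>U\<^esub> \<oplus>\<^bsub>U\<^esub> X = X"
      unfolding pruefer_zero[OF x(1)] using x by (simp add: pruefer_add)
    have "pfrac i (\<ominus> x) \<oplus>\<^bsub>U\<^esub> X = \<zero>\<^bsub>U\<^esub>"
      unfolding pruefer_zero[OF x(1)] using x by (simp add: pruefer_add l_neg)
    then show "\<exists>Y\<in>carrier U. Y \<oplus>\<^bsub>U\<^esub> X = \<zero>\<^bsub>U\<^esub>"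
      using x pfrac_carrier[of i "\<ominus> x"] by (intro bexI[of _ "pfrac i (\<ominus> x)"]) simp_all
    fix Y assume Y: "Y \<in> carrier U"
    obtain i x y where xy: "1 \<le> i" "x \<in> carrier R" "y \<in> carrier R" "X = pfrac i x" "Y = pfrac i y"
      using common_index2[OF X Y] .
    show "X \<oplus>\<^bsub>U\<^esub> Y \<in> carrier U" using xy by (simp add: pruefer_add pfrac_carrier)
    show "X \<oplus>\<^bsub>U\<^esub> Y = Y \<oplus>\<^bsub>U\<^esub> X" using xy by (simp add: pruefer_add a_comm)
    fix Z assume Z: "Z \<in> carrier U"
    obtain i x y z where xyz: "1 \<le> i" "x \<in> carrier R" "y \<in> carrier R" "z \<in> carrier R"
      "X = pfrac i x" "Y = pfrac i y" "Z = pfrac i z"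
      using common_index3[OF X Y Z] .
    then show "X \<oplus>\<^bsub>U\<^esub> Y \<oplus>\<^bsub>U\<^esub> Z = X \<oplus>\<^bsub>U\<^esub> (Y \<oplus>\<^bsub>U\<^esub> Z)" by (simp add: pruefer_add a_assoc)
  qed
  then show ?thesis
  proof (intro left_module.intro left_module_axioms.intro ring_axioms)
    fix b X assume b: "b \<in> carrier R" and X: "X \<in> carrier U"
    from X obtain i x where x: "1 \<le> i" "x \<in> carrier R" "X = pfrac i x" by (rule U1)
    show "b \<odot>\<^bsub>U\<^esub> X \<in> carrier U" using b x by (simp add: pruefer_smult pfrac_carrier)
    fix d assume d: "d \<in> carrier R"
    show "(b \<oplus> d) \<odot>\<^bsub>U\<^esub> X = b \<odot>\<^bsub>U\<^esub> X \<oplus>\<^bsub>U\<^esub> d \<odot>\<^bsub>U\<^esub> X"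
      using b d x by (simp add: pruefer_smult pruefer_add l_distr)
    show "b \<otimes> d \<odot>\<^bsub>U\<^esub> X = b \<odot>\<^bsub>U\<^esub> (d \<odot>\<^bsub>U\<^esub> X)"
      using b d x by (simp add: pruefer_smult m_assoc)
  next
    fix b X Y assume b: "b \<in> carrier R" and X: "X \<in> carrier U" and Y: "Y \<in> carrier U"
    obtain i x y where xy: "1 \<le> i" "x \<in> carrier R" "y \<in> carrier R" "X = pfrac i x" "Y = pfrac i y"
      using common_index2[OF X Y] .
    then show "b \<odot>\<^bsub>U\<^esub> (X \<oplus>\<^bsub>U\<^esub> Y) = b \<odot>\<^bsub>U\<^esub> X \<oplus>\<^bsub>U\<^esub> b \<odot>\<^bsub>U\<^esub> Y"
      using b by (simp add: pruefer_smult pruefer_add r_distr)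
  next
    fix X assume "X \<in> carrier U"
    then obtain i x where x: "1 \<le> i" "x \<in> carrier R" "X = pfrac i x" by (rule U1)
    then show "\<one> \<odot>\<^bsub>U\<^esub> X = X" by (simp add: pruefer_smult)
  qed
qed

text \<open>The copy of \<open>R / R a^i\<close> inside the limit, consisting of the fractions with
  denominator \<open>a^i\<close>. The case \<open>0\<close> is separate because the directed system
  starts at \<open>1\<close>.\<close>

definition layer :: "nat \<Rightarrow> (nat \<times> 'a set) set set" where
  "layer i = (if i = 0 then {\<zero>\<^bsub>U\<^esub>} else pfrac i ` carrier R)"

text \<open>A fraction \<open>x / a^j\<close> can be written with denominator \<open>a^i\<close> iff
  \<open>x\<close> is a left multiple of \<open>a^(j-i)\<close>: inside level \<open>j\<close>, the
  layer \<open>i\<close> is \<open>W j (j - i)\<close>.\<close>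

lemma pfrac_in_layer:
  assumes i: "i \<le> j" and j: "1 \<le> j" and x: "x \<in> carrier R"
  shows "pfrac j x \<in> layer i \<longleftrightarrow> x \<in> PIdl (a [^] (j - i))"
proof (cases "i = 0")
  case True
  have "pfrac j x \<in> layer i \<longleftrightarrow> pcos j x = pcos j \<zero>"
    using True j x by (simp add: layer_def pruefer_zero[OF j] pfrac_eq_same_iff)
  then show ?thesis using True x by (simp add: pcos_eq_iff minus_eq)
next
  case False
  then have i1: "1 \<le> i" by simp
  have "pfrac j x = pfrac i y \<longleftrightarrow> pcos j x = pcos j (y \<otimes> a [^] (j - i))" if y: "y \<in> carrier R" for y
    using pfrac_shift[OF i1 y, of "j - i"] i j x y pfrac_eq_same_iff[of j x "y \<otimes> a [^] (j - i)"] by simp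
  then have "pfrac j x \<in> layer i \<longleftrightarrow> (\<exists>y\<in>carrier R. pcos j x = pcos j (y \<otimes> a [^] (j - i)))"
    using False by (auto simp: layer_def)
  also have "\<dots> \<longleftrightarrow> pcos j x \<in> W j (j - i)"
    by (simp only: W_image image_iff)
  also have "\<dots> \<longleftrightarrow> x \<in> PIdl (a [^] (j - i))" using x by (intro pcos_in_W) simp_all
  finally show ?thesis .
qed

lemma layer_elem:
  assumes X: "X \<in> layer i" and j: "i \<le> j" "1 \<le> j"
  obtains x where "x \<in> carrier R" "X = pfrac j x"
proof (cases "i = 0")
  case True
  then show thesis using X pruefer_zero[OF j(2)] that[of \<zero>] by (simp add: layer_def)
next
  case False
  then obtain y where y: "y \<in> carrier R" "X = pfrac i y" using X by (auto simp: layer_def)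
  then show thesis using pfrac_shift[of i y "j - i"] False j by (intro that[of "y \<otimes> a [^] (j - i)"]) simp_all
qed

lemma layer_mono:
  assumes "i \<le> k" shows "layer i \<subseteq> layer k"
proof
  fix X assume X: "X \<in> layer i"
  define j where "j = Suc k"
  have j: "i \<le> j" "1 \<le> j" "k \<le> j" using assms by (auto simp: j_def)
  obtain x where x: "x \<in> carrier R" "X = pfrac j x" using layer_elem[OF X j(1,2)] .
  then have "x \<in> PIdl (a [^] (j - i))" using X j by (simp add: pfrac_in_layer)
  then have "x \<in> PIdl (a [^] (j - k))" using pow_mem_mono[OF diff_le_mono2[OF assms, of j]] by blast
  then show "X \<in> layer k" using x j by (simp add: pfrac_in_layer)
qed

text \<open>The fraction \<open>1 / a^(i+1)\<close> cannot be reduced, as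
  \<open>1 \<notin> R a\<close>.\<close>

lemma layer_strict: "layer (Suc i) \<noteq> layer i"
proof
  assume "layer (Suc i) = layer i"
  moreover have "pfrac (Suc i) \<one> \<in> layer (Suc i)" by (simp add: layer_def)
  ultimately have "\<one> \<in> PIdl (a [^] (Suc i - i))"
    using pfrac_in_layer[of i "Suc i" \<one>] by simp
  then show False using one_notin by simp
qed

lemma layer_subset_carrier: "layer i \<subseteq> carrier U"
  using left_module.submodule_zero[OF left_module_pruefer]
  by (auto simp: layer_def pfrac_carrier left_module.submodule_iff[OF left_module_pruefer])

lemma pfrac_hom:
  assumes i: "1 \<le> i"
  shows "pfrac i \<in> left_module_hom R (regular_module R) U" "pfrac i \<zero>\<^bsub>regular_module R\<^esub> = \<zero>\<^bsub>U\<^esub>"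
  unfolding left_module_hom_def pruefer_zero[OF i] using i
  by (auto simp: regular_module_def pfrac_carrier pruefer_add pruefer_smult)

lemma submodule_layer: "submodule (layer i) R U"
proof (cases "i = 0")
  case True
  then show ?thesis using left_module.submodule_zero[OF left_module_pruefer] by (simp add: layer_def)
next
  case False
  then have i: "1 \<le> i" by simp
  have "submodule (pfrac i ` carrier (regular_module R)) R U"
    by (rule submodule_image[OF left_module_regular left_module_pruefer pfrac_hom[OF i]
        left_module.submodule_carrier[OF left_module_regular]])
  then show ?thesis using False by (simp add: layer_def regular_module_def)
qed

text \<open>The numerators \<open>x\<close> with \<open>x / a^j \<in> N\<close> form a left ideal,
  and it contains \<open>a^j\<close> because \<open>a^j / a^j = 0\<close>; so it is one of the
  \<open>R a^l\<close>.\<close>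

lemma submodule_inter_layer:
  assumes N: "submodule N R U" and j: "1 \<le> j"
  obtains i where "i \<le> j" "N \<inter> layer j = layer i"
proof -
  interpret U: left_module R U by (rule left_module_pruefer)
  let ?J = "{x \<in> carrier (regular_module R). pfrac j x \<in> N}"
  have carrier: "carrier (regular_module R) = carrier R" by (simp add: regular_module_def)
  have J: "submodule ?J R (regular_module R)"
    by (rule submodule_vimage[OF left_module_regular left_module_pruefer pfrac_hom[OF j] N])
  have "pfrac j (a [^] j) = \<zero>\<^bsub>U\<^esub>"
    using pfrac_in_layer[of 0 j "a [^] j"] j pow_in_pow[of j] by (simp add: layer_def)
  then have "a [^] j \<in> ?J" using N by (simp add: carrier U.submodule_iff)
  then obtain l where l: "l \<le> j" "?J = PIdl (a [^] l)" by (rule left_ideal_cases[OF J])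
  have lj: "j - l \<le> j" by simp
  have mem: "pfrac j x \<in> N \<longleftrightarrow> pfrac j x \<in> layer (j - l)" if x: "x \<in> carrier R" for x
  proof -
    have "pfrac j x \<in> N \<longleftrightarrow> x \<in> ?J" using x by (simp add: carrier)
    also have "\<dots> \<longleftrightarrow> pfrac j x \<in> layer (j - l)" using l x pfrac_in_layer[OF lj j x] by simp
    finally show ?thesis .
  qed
  have "X \<in> N \<longleftrightarrow> X \<in> layer (j - l)" if X: "X \<in> layer j" for X
  proof -
    obtain x where "x \<in> carrier R" "X = pfrac j x" using X le_refl j by (rule layer_elem)
    then show ?thesis using mem by simp
  qed
  then have "N \<inter> layer j = layer (j - l)" using layer_mono[OF lj] by blast
  then show thesis by (rule that[OF lj])
qed

lemma submodule_pruefer_subset: "submodule N R U \<Longrightarrow> N \<subseteq> carrier U"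
  by (simp add: left_module.submodule_iff[OF left_module_pruefer])

text \<open>A submodule inside some layer is a layer. Otherwise it has, for each \<open>k\<close>,
  an element outside \<open>layer k\<close>; cut with a larger layer \<open>j\<close> containing
  this element, it becomes a \<open>layer i\<close> with \<open>i > k\<close> and so contains
  \<open>layer k\<close>. The layers exhaust the module.\<close>

lemma submodule_pruefer_cases:
  assumes N: "submodule N R U"
  obtains "N = carrier U" | i where "N = layer i"
proof (cases "\<exists>j\<ge>1. N \<subseteq> layer j")
  case True
  then obtain j where j: "1 \<le> j" "N \<subseteq> layer j" by blast
  obtain i where "N \<inter> layer j = layer i" using submodule_inter_layer[OF N j(1)] .
  then show thesis using j(2) that(2)[of i] by (simp add: Int_absorb2)
next
  case False
  note sub = submodule_pruefer_subset[OF N]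
  have "layer k \<subseteq> N" if k: "1 \<le> k" for k
  proof -
    obtain X where X: "X \<in> N" "X \<notin> layer k" using False k by blast
    obtain j x where j: "k \<le> j" "x \<in> carrier R" "X = pfrac j x"
      using common_index[OF _ k] X(1) sub by blast
    have j1: "1 \<le> j" using j k by simp
    obtain i where i: "N \<inter> layer j = layer i" using submodule_inter_layer[OF N j1] .
    have "X \<in> layer j" using j j1 by (auto simp: layer_def)
    then have "X \<in> layer i" using X i by blast
    then have "\<not> i \<le> k" using X layer_mono[of i k] by blast
    then have "layer k \<subseteq> layer i" by (intro layer_mono) simp
    then show ?thesis using i by blast
  qed
  moreover have "\<exists>k\<ge>1. X \<in> layer k" if X: "X \<in> carrier U" for X
  proof -
    obtain i x where i: "1 \<le> i" "x \<in> carrier R" "X = pfrac i x"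
      using X unfolding pruefer_carrier_iff by (elim exE conjE bexE)
    then have "X \<in> layer i" by (simp add: layer_def)
    with i(1) show ?thesis by (intro exI conjI)
  qed
  ultimately have "N = carrier U" using sub by blast
  then show thesis by (rule that(1))
qed

lemma uniserial_pruefer: "uniserial_module R U"
  unfolding uniserial_module_def
proof (intro allI impI)
  fix N N' assume N: "submodule N R U" and N': "submodule N' R U"
  note sub = submodule_pruefer_subset[OF N] submodule_pruefer_subset[OF N']
  show "N \<subseteq> N' \<or> N' \<subseteq> N"
  proof (rule submodule_pruefer_cases[OF N])
    fix i assume i: "N = layer i"
    show ?thesis
    proof (rule submodule_pruefer_cases[OF N'])
      fix j assume j: "N' = layer j"
      show ?thesis unfolding i j using layer_mono[of i j] layer_mono[of j i] nat_le_linear[of i j] by blast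
    qed (use sub in simp)
  qed (use sub in simp)
qed

text \<open>Layers are indexed by natural numbers, so among those occurring in a descending chain
  there is a smallest, and the chain is constant from there on. If no layer occurs, all members are
  the whole module.\<close>

lemma artinian_pruefer: "artinian_module R U"
  unfolding artinian_module_def
proof (intro allI impI)
  fix N :: "nat \<Rightarrow> (nat \<times> 'a set) set set"
  assume "(\<forall>i. submodule (N i) R U) \<and> (\<forall>i. N (Suc i) \<subseteq> N i)"
  then have N: "\<And>i. submodule (N i) R U" and dec: "\<And>i. N (Suc i) \<subseteq> N i" by auto
  have anti: "N j \<subseteq> N i" if "i \<le> j" for i j using lift_Suc_antimono_le[of N, OF dec that] .
  show "\<exists>m. \<forall>i\<ge>m. N i = N m"
  proof (cases "\<exists>k i. N i = layer k")
    case False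
    then have "N i = carrier U" for i using submodule_pruefer_cases[OF N[of i]] by metis
    then show ?thesis by simp
  next
    case True
    define k where "k = (LEAST k. \<exists>i. N i = layer k)"
    have "\<exists>i. N i = layer k" unfolding k_def using True by (rule LeastI_ex)
    then obtain m where m: "N m = layer k" by blast
    have "N i = N m" if i: "m \<le> i" for i
    proof (rule submodule_pruefer_cases[OF N[of i]])
      assume "N i = carrier U"
      then show ?thesis using anti[OF i] m layer_subset_carrier[of k] by auto
    next
      fix l assume l: "N i = layer l"
      then have "k \<le> l" unfolding k_def by (intro Least_le) blast
      then show ?thesis using anti[OF i] m l layer_mono[of k l] by auto
    qed
    then show ?thesis by blast
  qed
qed

lemma not_noetherian_pruefer: "\<not> noetherian_module R U"
proof
  assume noeth: "noetherian_module R U"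
  have "(\<forall>i. submodule (layer i) R U) \<and> (\<forall>i. layer i \<subseteq> layer (Suc i))"
    using submodule_layer layer_mono by simp
  with noeth obtain m where m: "\<forall>i\<ge>m. layer i = layer m" unfolding noetherian_module_def by blast
  show False using m[rule_format, OF le_SucI[OF le_refl]] layer_strict[of m] by (rule notE[rotated])
qed

end

section \<open>The action of words on infinite paths\<close>

lemma poly_mapping_sum_single:
  "f = (\<Sum>w\<in>Poly_Mapping.keys f. Poly_Mapping.single w (Poly_Mapping.lookup f w))"
proof (rule poly_mapping_eqI)
  fix k
  show "Poly_Mapping.lookup f k = Poly_Mapping.lookup (\<Sum>w\<in>Poly_Mapping.keys f. Poly_Mapping.single w (Poly_Mapping.lookup f w)) k"
    by (simp add: lookup_sum lookup_single when_def in_keys_iff)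
qed

text \<open>Extension by additivity from single terms. The set \<open>S\<close> carries a condition
  on the support, such as words in the generators of the graph or paths in one tail class.\<close>

lemma poly_mapping_induct_on [consumes 1, case_names zero single add]:
  fixes f :: "'a \<Rightarrow>\<^sub>0 'b::comm_monoid_add"
  assumes keys: "Poly_Mapping.keys f \<subseteq> S" and zero: "P 0"
    and single: "\<And>w k. w \<in> S \<Longrightarrow> P (Poly_Mapping.single w k)"
    and add: "\<And>f g. \<lbrakk>P f; P g\<rbrakk> \<Longrightarrow> P (f + g)"
  shows "P f"
proof -
  have "P (\<Sum>w\<in>A. Poly_Mapping.single w (Poly_Mapping.lookup f w))" if "A \<subseteq> S" for A
    using that by (induction A rule: infinite_finite_induct) (auto intro: zero single add)
  from this[OF keys] show ?thesis using poly_mapping_sum_single[of f] by simp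
qed

lemmas poly_mapping_induct = poly_mapping_induct_on[OF subset_UNIV, case_names zero single add]

lemma word_act_append:
  "word_act E (u @ w) q = Option.bind (word_act E w q) (word_act E u)"
proof (induction u)
  case Nil
  then show ?case by (cases "word_act E w q") auto
next
  case (Cons g u)
  then show ?case by (cases "word_act E w q") auto
qed

text \<open>The support of a sum may be smaller than the union of the supports. Summing over larger
  finite sets, on which the extra terms vanish, makes additivity in both arguments a termwise
  matter.\<close>

lemma free_act_superset:
  assumes "finite S" "Poly_Mapping.keys f \<subseteq> S" "finite T" "Poly_Mapping.keys x \<subseteq> T"
  shows "free_act E f x = (\<Sum>w\<in>S. \<Sum>q\<in>T.
      (case word_act E (letters w) q of
         None \<Rightarrow> 0
       | Some q' \<Rightarrow> Poly_Mapping.single q' (Poly_Mapping.lookup f w * Poly_Mapping.lookup x q)))"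
    (is "_ = (\<Sum>w\<in>S. \<Sum>q\<in>T. ?t w q)")
proof -
  have "free_act E f x = (\<Sum>w\<in>Poly_Mapping.keys f. \<Sum>q\<in>Poly_Mapping.keys x. ?t w q)"
    by (simp add: free_act_def)
  also have "\<dots> = (\<Sum>w\<in>Poly_Mapping.keys f. \<Sum>q\<in>T. ?t w q)"
    using assms by (intro sum.cong refl sum.mono_neutral_left) (auto simp: in_keys_iff split: option.splits)
  also have "\<dots> = (\<Sum>w\<in>S. \<Sum>q\<in>T. ?t w q)"
    using assms by (intro sum.mono_neutral_left) (auto simp: in_keys_iff split: option.splits intro!: sum.neutral)
  finally show ?thesis .
qed

lemma free_act_add_left: "free_act E (f + g) x = free_act E f x + free_act E g x"
proof -
  let ?S = "Poly_Mapping.keys f \<union> Poly_Mapping.keys g" and ?T = "Poly_Mapping.keys x"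
  have "Poly_Mapping.keys (f + g) \<subseteq> ?S" by (rule keys_add)
  then show ?thesis
    using free_act_superset[of ?S _ ?T x E]
    by (simp add: sum.distrib[symmetric])
      (intro sum.cong refl, simp add: single_add lookup_add distrib_right split: option.splits)
qed

lemma free_act_add_right: "free_act E f (x + y) = free_act E f x + free_act E f y"
proof -
  let ?S = "Poly_Mapping.keys f" and ?T = "Poly_Mapping.keys x \<union> Poly_Mapping.keys y"
  have "Poly_Mapping.keys (x + y) \<subseteq> ?T" by (rule keys_add)
  then show ?thesis
    using free_act_superset[of ?S f ?T _ E]
    by (simp add: sum.distrib[symmetric])
      (intro sum.cong refl, simp add: single_add lookup_add distrib_left split: option.splits)
qed

lemma free_act_zero [simp]: "free_act E 0 x = 0" "free_act E f 0 = 0"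
  by (simp_all add: free_act_def)

lemma free_act_diff_left: "free_act E (f - g) x = free_act E f x - free_act E g x"
  using free_act_add_left[of E "f - g" g x] by simp

lemma free_act_sum_left: "free_act E (sum f A) x = (\<Sum>i\<in>A. free_act E (f i) x)"
  by (induction A rule: infinite_finite_induct) (simp_all add: free_act_add_left)

lemma free_act_single:
  "free_act E (Poly_Mapping.single w k) (Poly_Mapping.single q m) =
    (case word_act E (letters w) q of None \<Rightarrow> 0 | Some q' \<Rightarrow> Poly_Mapping.single q' (k * m))"
  by (subst free_act_superset[of "{w}" _ "{q}"]) (auto split: option.splits)

text \<open>By additivity in all three arguments it suffices to treat single words and a single
  path, where concatenation of words acts as composition.\<close>

lemma free_act_mult: "free_act E (f * g) x = free_act E f (free_act E g x)"
proof (induction f rule: poly_mapping_induct)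
  case (single u k)
  show ?case
  proof (induction g rule: poly_mapping_induct)
    case (single w l)
    show ?case
      by (induction x rule: poly_mapping_induct)
        (auto simp: free_act_add_right free_act_single mult_single word_act_append plus_fword_def
          mult.assoc split: option.splits)
  qed (simp_all add: distrib_left free_act_add_left free_act_add_right)
qed (simp_all add: distrib_right free_act_add_left)

lemma free_act_word_elt:
  "free_act E (word_elt gs) (Poly_Mapping.single q m) =
    (case word_act E gs q of None \<Rightarrow> 0 | Some q' \<Rightarrow> Poly_Mapping.single q' m)"
  by (simp add: word_elt_def free_act_single split: option.splits)

lemma free_act_scalar:
  "free_act E (Poly_Mapping.single 0 k) (Poly_Mapping.single q m) = Poly_Mapping.single q (k * m)"
  by (simp add: free_act_single zero_fword_def)

lemma free_act_one [simp]: "free_act E 1 x = x"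
  by (induction x rule: poly_mapping_induct)
    (simp_all add: free_act_add_right free_act_scalar flip: single_one)

lemma infinite_path_Cons:
  "\<lbrakk>infinite_path E q; e \<in> arcs E; head E e = tail E (shd q)\<rbrakk> \<Longrightarrow> infinite_path E (e ## q)"
  unfolding infinite_path_def
proof (intro allI)
  fix i
  assume *: "\<forall>i. q !! i \<in> arcs E \<and> head E (q !! i) = tail E (q !! Suc i)"
    "e \<in> arcs E" "head E e = tail E (shd q)"
  then show "(e ## q) !! i \<in> arcs E \<and> head E ((e ## q) !! i) = tail E ((e ## q) !! Suc i)"
  proof (cases i)
    case (Suc j)
    then show ?thesis using *(1)[rule_format, of j] by simp
  qed simp
qed

lemma infinite_path_stl: "infinite_path E q \<Longrightarrow> infinite_path E (stl q)"
  unfolding infinite_path_def by (metis snth.simps(2))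

text \<open>A generator changes only the front of an infinite path: dropping one more entry of
  \<open>q'\<close> compensates for a new edge, dropping one more entry of \<open>p\<close> for a
  removed one.\<close>

lemma gen_act_tail_class:
  assumes q: "q \<in> tail_class E p" and g: "g \<in> lpa_gens E" and act: "gen_act E g q = Some q'"
  shows "q' \<in> tail_class E p"
proof -
  obtain m n where mn: "sdrop m p = sdrop n q" and inf: "infinite_path E q"
    using q by (auto simp: tail_class_def)
  show ?thesis
  proof (cases g)
    case (Vertex v)
    then show ?thesis using act q by (auto split: if_splits)
  next
    case (Edge e)
    then have "e \<in> arcs E" "head E e = tail E (shd q)" "q' = e ## q"
      using g act by (auto simp: lpa_gens_def split: if_splits)
    moreover have "sdrop m p = sdrop (Suc n) (e ## q)" using mn by simp
    ultimately show ?thesis using inf infinite_path_Cons[of E q e] unfolding tail_class_def by blast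
  next
    case (Ghost e)
    then have q': "q' = stl q" using act by (auto split: if_splits)
    have "sdrop (Suc m) p = sdrop n (stl q)" using mn by (simp only: sdrop.simps sdrop_stl)
    then show ?thesis using q' infinite_path_stl[OF inf] unfolding tail_class_def by blast
  qed
qed

lemma word_act_tail_class:
  "\<lbrakk>q \<in> tail_class E p; set gs \<subseteq> lpa_gens E; word_act E gs q = Some q'\<rbrakk> \<Longrightarrow> q' \<in> tail_class E p"
proof (induction gs arbitrary: q')
  case (Cons g gs)
  then show ?case by (auto simp: Option.bind_eq_Some_conv intro: gen_act_tail_class)
qed simp

lemma free_act_closed:
  assumes f: "f \<in> carrier (free_algebra (lpa_gens E))" and x: "Poly_Mapping.keys x \<subseteq> tail_class E p"
  shows "Poly_Mapping.keys (free_act E f x) \<subseteq> tail_class E p"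
proof -
  have "Poly_Mapping.keys f \<subseteq> {w. set (letters w) \<subseteq> lpa_gens E}"
    using f by (auto simp: free_algebra_def)
  then show ?thesis
  proof (induction f rule: poly_mapping_induct_on)
    case (single w k)
    from x show ?case
    proof (induction x rule: poly_mapping_induct_on)
      case (single q m)
      then show ?case
        using word_act_tail_class[OF single, of "letters w"] \<open>w \<in> _\<close>
        by (auto simp: free_act_single split: option.splits)
    next
      case (add x y)
      then show ?case using keys_add[of "free_act E (Poly_Mapping.single w k) x" "free_act E (Poly_Mapping.single w k) y"]
        by (auto simp: free_act_add_right)
    qed simp
  next
    case (add f g)
    then show ?case using keys_add[of "free_act E f x" "free_act E g x"]
      by (auto simp: free_act_add_left)
  qed simp
qed

text \<open>In each of the two sums over edges or vertices exactly the term that matches the first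
  edge of \<open>q\<close>, or its source, can survive, and it returns \<open>q\<close>.\<close>

lemma (in fin_digraph) free_act_relations:
  assumes r: "r \<in> lpa_relations G" and q: "infinite_path G q"
  shows "free_act G r (Poly_Mapping.single q (m :: 'k::field)) = 0"
proof -
  have arcs: "shd q \<in> arcs G" "tail G (shd (stl q)) = head G (shd q)"
    using q[unfolded infinite_path_def, rule_format, of 0] by auto
  note simps = free_act_diff_left free_act_word_elt
  from r show ?thesis
  proof cases
    case (cuntz_krieger v)
    have "free_act G (\<Sum>e\<in>out_arcs G v. word_elt [Edge e, Ghost e]) (Poly_Mapping.single q m) =
      (\<Sum>e\<in>out_arcs G v. if e = shd q then Poly_Mapping.single q m else 0)"
      unfolding free_act_sum_left using arcs by (intro sum.cong refl) (auto simp: free_act_word_elt)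
    also have "\<dots> = (if tail G (shd q) = v then Poly_Mapping.single q m else 0)"
      using arcs cuntz_krieger by (simp add: sum.delta)
    finally show ?thesis using cuntz_krieger by (auto simp: simps)
  next
    case unit
    have "free_act G (\<Sum>v\<in>verts G. word_elt [Vertex v]) (Poly_Mapping.single q m) =
      (\<Sum>v\<in>verts G. if v = tail G (shd q) then Poly_Mapping.single q m else 0)"
      unfolding free_act_sum_left by (intro sum.cong refl) (auto simp: free_act_word_elt)
    also have "\<dots> = Poly_Mapping.single q m"
      using arcs by (simp add: sum.delta)
    finally show ?thesis using unit by (simp add: simps)
  qed (use arcs in \<open>auto simp: simps\<close>)
qed


section \<open>The ideal of relations\<close>

context fin_digraph
begin

text \<open>The elements satisfying \<open>P\<close> form an ideal that contains the relations,
  hence contains the ideal they generate; negatives arise by multiplication with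
  \<open>- 1\<close>.\<close>

lemma lpa_ideal_induct [consumes 1, case_names relation zero add left right]:
  assumes f: "f \<in> (lpa_ideal G :: ('a, 'b, 'k::field) lpa_free set)"
    and rel: "\<And>r. r \<in> lpa_relations G \<Longrightarrow> P r" and zero: "P 0"
    and add: "\<And>f g. \<lbrakk>P f; P g\<rbrakk> \<Longrightarrow> P (f + g)"
    and left: "\<And>f g. \<lbrakk>g \<in> carrier (free_algebra (lpa_gens G)); P f\<rbrakk> \<Longrightarrow> P (g * f)"
    and right: "\<And>f g. \<lbrakk>g \<in> carrier (free_algebra (lpa_gens G)); P f\<rbrakk> \<Longrightarrow> P (f * g)"
  shows "P f"
proof -
  let ?F = "free_algebra (lpa_gens G) :: ('a, 'b, 'k) lpa_free ring"
  interpret F: ring ?F by (rule free_algebra_ring)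
  let ?J = "{f \<in> carrier ?F. P f}"
  note closed = free_algebra_closed[where G = "lpa_gens G" and 'k = 'k]
  have neg: "P (- f)" if "P f" for f using left[OF closed(5)[OF closed(2)] that] by simp
  have inv: "\<ominus>\<^bsub>?F\<^esub> f = - f" if "f \<in> carrier ?F" for f
    using that closed(5)[OF that] by (intro F.minus_equality) (simp_all add: free_algebra_simps)
  have "subgroup ?J (add_monoid ?F)"
  proof (rule F.add.subgroupI)
    show "?J \<noteq> {}" using closed(1) zero by auto
  qed (use closed add neg inv in \<open>auto simp: free_algebra_simps\<close>)
  then have "ideal ?J ?F"
    by (intro idealI F.ring_axioms) (use closed left right in \<open>auto simp: free_algebra_simps\<close>)
  then have "lpa_ideal G \<subseteq> ?J"
    unfolding lpa_ideal_def using rel lpa_relations_closed by (intro F.genideal_minimal) auto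
  then show ?thesis using f by auto
qed

lemma lpa_ideal_facts:
  fixes f g :: "('a, 'b, 'k::field) lpa_free"
  shows "0 \<in> (lpa_ideal G :: ('a, 'b, 'k) lpa_free set)"
    and "\<lbrakk>f \<in> lpa_ideal G; g \<in> lpa_ideal G\<rbrakk> \<Longrightarrow> f + g \<in> lpa_ideal G"
    and "\<lbrakk>g \<in> carrier (free_algebra (lpa_gens G)); f \<in> lpa_ideal G\<rbrakk> \<Longrightarrow> g * f \<in> lpa_ideal G"
    and "\<lbrakk>g \<in> carrier (free_algebra (lpa_gens G)); f \<in> lpa_ideal G\<rbrakk> \<Longrightarrow> f * g \<in> lpa_ideal G"
    and "f \<in> lpa_ideal G \<Longrightarrow> - f \<in> lpa_ideal G"
    and "f \<in> lpa_relations G \<Longrightarrow> f \<in> lpa_ideal G"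
    and "f \<in> lpa_ideal G \<Longrightarrow> f \<in> carrier (free_algebra (lpa_gens G))"
proof -
  let ?F = "free_algebra (lpa_gens G) :: ('a, 'b, 'k) lpa_free ring"
  interpret F: ring ?F by (rule free_algebra_ring)
  interpret I: ideal "lpa_ideal G" ?F by (rule lpa_ideal_ideal)
  show "0 \<in> (lpa_ideal G :: ('a, 'b, 'k) lpa_free set)"
    using I.zero_closed by (simp add: free_algebra_simps)
  show "f + g \<in> lpa_ideal G" if "f \<in> lpa_ideal G" "g \<in> lpa_ideal G"
    using I.a_closed[OF that] by (simp add: free_algebra_simps)
  show l: "g * f \<in> lpa_ideal G" if "g \<in> carrier ?F" "f \<in> lpa_ideal G" for f g
    using I.I_l_closed[OF that(2,1)] by (simp add: free_algebra_simps)
  show "f * g \<in> lpa_ideal G" if "g \<in> carrier ?F" "f \<in> lpa_ideal G"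
    using I.I_r_closed[OF that(2,1)] by (simp add: free_algebra_simps)
  show "- f \<in> lpa_ideal G" if "f \<in> lpa_ideal G"
    using l[OF free_algebra_closed(5)[OF free_algebra_closed(2)] that] by simp
  show "f \<in> lpa_ideal G" if "f \<in> lpa_relations G"
    unfolding lpa_ideal_def using F.genideal_self[OF lpa_relations_closed] that by blast
  show "f \<in> carrier ?F" if "f \<in> lpa_ideal G" using that I.a_subset by blast
qed

text \<open>The vector \<open>x\<close> is generalised because \<open>f * g\<close> lets
  \<open>f\<close> act on the image of \<open>x\<close> under \<open>g\<close>, which stays in the
  span of the tail class by \<open>free_act_closed\<close>.\<close>

lemma free_act_ideal:
  fixes f :: "('a, 'b, 'k::field) lpa_free"
  assumes "f \<in> lpa_ideal G" and "Poly_Mapping.keys x \<subseteq> tail_class G p"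
  shows "free_act G f x = 0"
  using assms
proof (induction arbitrary: x rule: lpa_ideal_induct)
  case (relation r)
  from relation(2) show ?case
  proof (induction x rule: poly_mapping_induct_on)
    case (single q m)
    then show ?case using free_act_relations[OF relation(1)] by (simp add: tail_class_def)
  qed (simp_all add: free_act_add_right)
next
  case (right f g)
  then show ?case using free_act_closed[OF right(1)] by (simp add: free_act_mult)
qed (simp_all add: free_act_add_left free_act_mult)

abbreviation lpa_class :: "('a, 'b, 'k::field) lpa_free \<Rightarrow> ('a, 'b, 'k) lpa" where
  "lpa_class f \<equiv> lpa_ideal G +>\<^bsub>free_algebra (lpa_gens G)\<^esub> f"

lemma lpa_class_eq_iff:
  fixes f g :: "('a, 'b, 'k::field) lpa_free"
  assumes f: "f \<in> carrier (free_algebra (lpa_gens G))" and g: "g \<in> carrier (free_algebra (lpa_gens G))"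
  shows "lpa_class f = lpa_class g \<longleftrightarrow> f - g \<in> lpa_ideal G"
proof -
  have "lpa_class f = {i + f | i. i \<in> lpa_ideal G}" for f :: "('a, 'b, 'k) lpa_free"
    by (auto simp: a_r_coset_def' free_algebra_simps)
  then have cl: "h \<in> lpa_class f \<longleftrightarrow> h - f \<in> lpa_ideal G" for f h :: "('a, 'b, 'k) lpa_free"
    by (auto intro: exI[of _ "h - f"])
  show ?thesis
  proof
    assume "lpa_class f = lpa_class g"
    moreover have "f \<in> lpa_class f" by (simp add: cl lpa_ideal_facts(1))
    ultimately show "f - g \<in> lpa_ideal G" by (simp only: cl)
  next
    assume fg: "f - g \<in> lpa_ideal G"
    have "h \<in> lpa_class f \<longleftrightarrow> h \<in> lpa_class g" for h
    proof -
      have "h - g = (h - f) + (f - g)" "h - f = (h - g) + - (f - g)" by simp_all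
      then show ?thesis unfolding cl using lpa_ideal_facts(2,5) fg by metis
    qed
    then show "lpa_class f = lpa_class g" by blast
  qed
qed

lemma lpa_class_hom:
  fixes f g :: "('a, 'b, 'k::field) lpa_free"
  assumes f: "f \<in> carrier (free_algebra (lpa_gens G))" and g: "g \<in> carrier (free_algebra (lpa_gens G))"
  shows "lpa_class f \<in> carrier (leavitt_path_algebra G)"
    and "lpa_class f \<oplus>\<^bsub>leavitt_path_algebra G\<^esub> lpa_class g = lpa_class (f + g)"
    and "lpa_class f \<otimes>\<^bsub>leavitt_path_algebra G\<^esub> lpa_class g = lpa_class (f * g)"
proof -
  have h: "lpa_class \<in> ring_hom (free_algebra (lpa_gens G) :: ('a, 'b, 'k) lpa_free ring) (leavitt_path_algebra G)"
    unfolding leavitt_path_algebra_def by (rule ideal.rcos_ring_hom[OF lpa_ideal_ideal])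
  show "lpa_class f \<in> carrier (leavitt_path_algebra G)" by (rule ring_hom_closed[OF h f])
  show "lpa_class f \<oplus>\<^bsub>leavitt_path_algebra G\<^esub> lpa_class g = lpa_class (f + g)"
    using ring_hom_add[OF h f g] by (simp add: free_algebra_simps)
  show "lpa_class f \<otimes>\<^bsub>leavitt_path_algebra G\<^esub> lpa_class g = lpa_class (f * g)"
    using ring_hom_mult[OF h f g] by (simp add: free_algebra_simps)
qed

lemma lpa_class_one: "\<one>\<^bsub>leavitt_path_algebra G\<^esub> = lpa_class (1 :: ('a, 'b, 'k::field) lpa_free)"
  by (simp add: leavitt_path_algebra_def FactRing_def free_algebra_simps)

lemma lpa_class_zero: "\<zero>\<^bsub>leavitt_path_algebra G\<^esub> = lpa_class (0 :: ('a, 'b, 'k::field) lpa_free)"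
  by (simp add: leavitt_path_algebra_def FactRing_def free_algebra_simps a_r_coset_def')

lemma lpa_classE:
  assumes "X \<in> carrier (leavitt_path_algebra G :: ('a, 'b, 'k::field) lpa ring)"
  obtains f where "f \<in> carrier (free_algebra (lpa_gens G))" "X = lpa_class f"
  using assms unfolding leavitt_path_algebra_def FactRing_def A_RCOSETS_def' by auto

text \<open>The ideal of relations acts as zero, so all members of the coset act alike and
  \<open>the_elem\<close> is applied to a genuine singleton.\<close>

lemma chen_smult:
  fixes f :: "('a, 'b, 'k::field) lpa_free"
  assumes f: "f \<in> carrier (free_algebra (lpa_gens G))" and x: "x \<in> carrier (chen_module G p)"
  shows "lpa_class f \<odot>\<^bsub>chen_module G p\<^esub> x = free_act G f x"
proof -
  let ?I = "lpa_ideal G :: ('a, 'b, 'k) lpa_free set"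
  have "(\<lambda>g. free_act G g x) ` lpa_class f = (\<lambda>i. free_act G (i + f) x) ` ?I"
    by (auto simp: a_r_coset_def' free_algebra_simps)
  also have "\<dots> = (\<lambda>_. free_act G f x) ` ?I"
    by (rule image_cong[OF refl]) (use x in \<open>simp add: free_act_add_left free_act_ideal chen_module_def\<close>)
  also have "\<dots> = {free_act G f x}" using lpa_ideal_facts(1) by (intro image_constant)
  finally show ?thesis by (simp add: chen_module_def)
qed

lemma left_module_chen:
  "left_module (leavitt_path_algebra G :: ('a, 'b, 'k::field) lpa ring) (chen_module G p)"
proof (intro left_module.intro left_module_axioms.intro leavitt_path_algebra_ring)
  let ?V = "chen_module G p :: (('a, 'b, 'k) lpa, 'b stream \<Rightarrow>\<^sub>0 'k) module"
  let ?L = "leavitt_path_algebra G :: ('a, 'b, 'k) lpa ring"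
  have V: "carrier ?V = {x. Poly_Mapping.keys x \<subseteq> tail_class G p}" "add ?V = (+)" "zero ?V = 0"
    by (simp_all add: chen_module_def)
  have add: "x + y \<in> carrier ?V" if "x \<in> carrier ?V" "y \<in> carrier ?V" for x y
    using that keys_add[of x y] by (auto simp: V)
  have neg: "- x \<in> carrier ?V" if "x \<in> carrier ?V" for x
    using that by (auto simp: V in_keys_iff)
  show "abelian_group ?V"
  proof (rule abelian_groupI)
    show "\<exists>y\<in>carrier ?V. y \<oplus>\<^bsub>?V\<^esub> x = \<zero>\<^bsub>?V\<^esub>" if "x \<in> carrier ?V" for x
      using neg[OF that] by (intro bexI[of _ "- x"]) (simp_all add: V)
  qed (use add in \<open>auto simp: V add.assoc add.commute\<close>)
  have cl: "free_act G f x \<in> carrier ?V"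
    if "f \<in> carrier (free_algebra (lpa_gens G))" "x \<in> carrier ?V" for f x
    using free_act_closed[OF that(1)] that(2) by (simp add: V)
  note fcl = free_algebra_closed[where G = "lpa_gens G" and 'k = 'k]
  fix X x assume X: "X \<in> carrier ?L" and x: "x \<in> carrier ?V"
  from X obtain f where f: "f \<in> carrier (free_algebra (lpa_gens G))" "X = lpa_class f" by (rule lpa_classE)
  show "X \<odot>\<^bsub>?V\<^esub> x \<in> carrier ?V" using f x cl by (simp add: chen_smult)
  fix Y assume Y: "Y \<in> carrier ?L"
  from Y obtain g where g: "g \<in> carrier (free_algebra (lpa_gens G))" "Y = lpa_class g" by (rule lpa_classE)
  show "(X \<oplus>\<^bsub>?L\<^esub> Y) \<odot>\<^bsub>?V\<^esub> x = X \<odot>\<^bsub>?V\<^esub> x \<oplus>\<^bsub>?V\<^esub> Y \<odot>\<^bsub>?V\<^esub> x"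
    using f g x fcl by (simp add: lpa_class_hom chen_smult free_act_add_left V(2))
  show "(X \<otimes>\<^bsub>?L\<^esub> Y) \<odot>\<^bsub>?V\<^esub> x = X \<odot>\<^bsub>?V\<^esub> (Y \<odot>\<^bsub>?V\<^esub> x)"
    using f g x fcl cl by (simp add: lpa_class_hom chen_smult free_act_mult)
next
  let ?V = "chen_module G p :: (('a, 'b, 'k) lpa, 'b stream \<Rightarrow>\<^sub>0 'k) module"
  let ?L = "leavitt_path_algebra G :: ('a, 'b, 'k) lpa ring"
  fix X x y assume X: "X \<in> carrier ?L" and xy: "x \<in> carrier ?V" "y \<in> carrier ?V"
  from X obtain f where f: "f \<in> carrier (free_algebra (lpa_gens G))" "X = lpa_class f" by (rule lpa_classE)
  have "x + y \<in> carrier ?V" using xy keys_add[of x y] by (auto simp: chen_module_def)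
  moreover have "add ?V = (+)" by (simp add: chen_module_def)
  ultimately show "X \<odot>\<^bsub>?V\<^esub> (x \<oplus>\<^bsub>?V\<^esub> y) = X \<odot>\<^bsub>?V\<^esub> x \<oplus>\<^bsub>?V\<^esub> X \<odot>\<^bsub>?V\<^esub> y"
    using f(1) xy unfolding f(2) by (simp add: chen_smult free_act_add_right)
next
  let ?V = "chen_module G p :: (('a, 'b, 'k) lpa, 'b stream \<Rightarrow>\<^sub>0 'k) module"
  let ?L = "leavitt_path_algebra G :: ('a, 'b, 'k) lpa ring"
  fix x assume "x \<in> carrier ?V"
  then show "\<one>\<^bsub>?L\<^esub> \<odot>\<^bsub>?V\<^esub> x = x"
    unfolding lpa_class_one by (simp add: chen_smult free_algebra_closed(2))
qed

end

section \<open>Monomials in a Leavitt path algebra\<close>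

lemma word_elt_append: "word_elt (u @ w) = (word_elt u * word_elt w :: 'g fword \<Rightarrow>\<^sub>0 'k::field)"
  by (simp add: word_elt_def mult_single plus_fword_def)

lemma word_elt_Cons: "word_elt (g # w) = (word_elt [g] * word_elt w :: 'g fword \<Rightarrow>\<^sub>0 'k::field)"
  using word_elt_append[of "[g]" w] by simp

lemma word_elt_Nil: "word_elt [] = (1 :: 'g fword \<Rightarrow>\<^sub>0 'k::field)"
  by (simp add: word_elt_def flip: zero_fword_def)

lemma scalar_mult_commute:
  fixes f :: "'g fword \<Rightarrow>\<^sub>0 'k::field"
  shows "Poly_Mapping.single 0 k * f = f * Poly_Mapping.single 0 k"
proof (induction f rule: poly_mapping_induct)
  case (single w l)
  then show ?case by (simp add: mult_single mult.commute)
qed (simp_all add: distrib_left distrib_right)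

lemma scalar_closed: "Poly_Mapping.single 0 k \<in> carrier (free_algebra H)"
  by (auto simp: free_algebra_def zero_fword_def)

lemma (in fin_digraph) awalk_append_cancel:
  assumes "awalk u p w" shows "awalk u (p @ q) w' \<longleftrightarrow> awalk w q w'"
proof -
  have "cas u p w \<Longrightarrow> cas u (p @ q) w' \<longleftrightarrow> cas w q w'"
    by (induction p arbitrary: u) (auto simp del: cas_append_iff)
  then show ?thesis using assms awalk_last_in_verts[OF assms] by (auto simp: awalk_def simp del: cas_append_iff)
qed

text \<open>The parameter \<open>K\<close> serves only to fix the type of coefficients.\<close>

locale lpa_free_setup = fin_digraph G for G :: "('a, 'b) pre_digraph" +
  fixes K :: "'k::field itself"
begin

abbreviation C :: "('a, 'b, 'k) lpa_free set" where "C \<equiv> carrier (free_algebra (lpa_gens G))"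
abbreviation I :: "('a, 'b, 'k) lpa_free set" where "I \<equiv> lpa_ideal G"
abbreviation wd :: "('a, 'b) lpa_gen list \<Rightarrow> ('a, 'b, 'k) lpa_free" where "wd \<equiv> word_elt"
abbreviation scal :: "'k \<Rightarrow> ('a, 'b, 'k) lpa_free" where "scal k \<equiv> Poly_Mapping.single 0 k"

lemma gens_iff [simp]:
  "Vertex x \<in> lpa_gens G \<longleftrightarrow> x \<in> verts G" "Edge e \<in> lpa_gens G \<longleftrightarrow> e \<in> arcs G"
  "Ghost e \<in> lpa_gens G \<longleftrightarrow> e \<in> arcs G"
  by (auto simp: lpa_gens_def)

lemma C_minus: "\<lbrakk>f \<in> C; g \<in> C\<rbrakk> \<Longrightarrow> f - g \<in> C"
  using free_algebra_closed(3)[OF _ free_algebra_closed(5), of f "lpa_gens G" g] by simp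

lemma C_sum: "(\<And>i. i \<in> S \<Longrightarrow> f i \<in> C) \<Longrightarrow> sum f S \<in> C"
  by (induction S rule: infinite_finite_induct) (auto intro: free_algebra_closed)

lemma C_power: "f \<in> C \<Longrightarrow> f ^ n \<in> C"
  by (induction n) (auto intro: free_algebra_closed)

lemmas C_intros [simp, intro] = free_algebra_closed[where G = "lpa_gens G" and 'k = 'k]
  scalar_closed[where H = "lpa_gens G"] C_minus C_sum C_power
  word_elt_closed[where G = "lpa_gens G" and 'k = 'k]

lemmas I_zero [simp] = lpa_ideal_facts(1)[where 'k = 'k]
lemmas I_add = lpa_ideal_facts(2)[where 'k = 'k]
lemmas I_left = lpa_ideal_facts(3)[where 'k = 'k]
lemmas I_right = lpa_ideal_facts(4)[where 'k = 'k]
lemmas I_minus = lpa_ideal_facts(5)[where 'k = 'k]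
lemmas I_C = lpa_ideal_facts(7)[where 'k = 'k]

text \<open>Equality in the Leavitt path algebra, expressed between representatives in the free
  algebra.\<close>

definition eqv :: "('a, 'b, 'k) lpa_free \<Rightarrow> ('a, 'b, 'k) lpa_free \<Rightarrow> bool" (infix \<open>\<approx>\<close> 50) where
  "f \<approx> g \<longleftrightarrow> f - g \<in> I"

lemma eqv_refl [simp]: "f \<approx> f" by (simp add: eqv_def)

lemma eqv_sym: "f \<approx> g \<Longrightarrow> g \<approx> f"
  using I_minus[of "f - g"] by (simp add: eqv_def)

lemma eqv_trans [trans]: "\<lbrakk>f \<approx> g; g \<approx> h\<rbrakk> \<Longrightarrow> f \<approx> h"
  using I_add[of "f - g" "g - h"] by (simp add: eqv_def)

lemma eqv_add: "\<lbrakk>f \<approx> g; f' \<approx> g'\<rbrakk> \<Longrightarrow> f + f' \<approx> g + g'"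
  using I_add[of "f - g" "f' - g'"] by (simp add: eqv_def algebra_simps)

lemma eqv_sum: "(\<And>i. i \<in> S \<Longrightarrow> f i \<approx> g i) \<Longrightarrow> sum f S \<approx> sum g S"
  by (induction S rule: infinite_finite_induct) (auto intro: eqv_add)

lemma eqv_left: "\<lbrakk>h \<in> C; f \<approx> g\<rbrakk> \<Longrightarrow> h * f \<approx> h * g"
  using I_left[of h "f - g"] by (simp add: eqv_def algebra_simps)

lemma eqv_right: "\<lbrakk>h \<in> C; f \<approx> g\<rbrakk> \<Longrightarrow> f * h \<approx> g * h"
  using I_right[of h "f - g"] by (simp add: eqv_def algebra_simps)

lemma eqv_left_zero: "\<lbrakk>h \<in> C; f \<approx> 0\<rbrakk> \<Longrightarrow> h * f \<approx> 0"
  using eqv_left[of h f 0] by simp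

lemma eqv_right_zero: "\<lbrakk>h \<in> C; f \<approx> 0\<rbrakk> \<Longrightarrow> f * h \<approx> 0"
  using eqv_right[of h f 0] by simp

lemma eqv_C: "\<lbrakk>f \<approx> g; g \<in> C\<rbrakk> \<Longrightarrow> f \<in> C"
  using C_intros(3)[of "f - g" g] I_C[of "f - g"] by (simp add: eqv_def)

lemma relation_eqv: "f - g \<in> lpa_relations G \<Longrightarrow> f \<approx> g"
  unfolding eqv_def by (rule lpa_ideal_facts(6))

lemma vertex_vertex: "\<lbrakk>x \<in> verts G; y \<in> verts G\<rbrakk> \<Longrightarrow> wd [Vertex x] * wd [Vertex y] \<approx> (if x = y then wd [Vertex x] else 0)"
  using relation_eqv[OF lpa_relations.vertices[of x G y]] by (simp add: word_elt_Cons[of _ "[_]"])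

lemma source_edge: "e \<in> arcs G \<Longrightarrow> wd [Vertex (tail G e)] * wd [Edge e] \<approx> wd [Edge e]"
  using relation_eqv[OF lpa_relations.source_edge[of e G]] by (simp add: word_elt_Cons[of _ "[_]"])

lemma edge_range: "e \<in> arcs G \<Longrightarrow> wd [Edge e] * wd [Vertex (head G e)] \<approx> wd [Edge e]"
  using relation_eqv[OF lpa_relations.edge_range[of e G]] by (simp add: word_elt_Cons[of _ "[_]"])

lemma range_ghost: "e \<in> arcs G \<Longrightarrow> wd [Vertex (head G e)] * wd [Ghost e] \<approx> wd [Ghost e]"
  using relation_eqv[OF lpa_relations.range_ghost[of e G]] by (simp add: word_elt_Cons[of _ "[_]"])

lemma ghost_source: "e \<in> arcs G \<Longrightarrow> wd [Ghost e] * wd [Vertex (tail G e)] \<approx> wd [Ghost e]"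
  using relation_eqv[OF lpa_relations.ghost_source[of e G]] by (simp add: word_elt_Cons[of _ "[_]"])

lemma ghost_edge: "\<lbrakk>e \<in> arcs G; f \<in> arcs G\<rbrakk> \<Longrightarrow>
    wd [Ghost e] * wd [Edge f] \<approx> (if e = f then wd [Vertex (head G e)] else 0)"
  using relation_eqv[OF lpa_relations.ghost_edge[of e G f]] by (simp add: word_elt_Cons[of _ "[_]"])

lemma one_eqv: "1 \<approx> (\<Sum>x\<in>verts G. wd [Vertex x])"
  using relation_eqv[OF lpa_relations.unit[of G]] by simp

lemma eqv_ctx: "\<lbrakk>f \<approx> g; h \<in> C; h' \<in> C\<rbrakk> \<Longrightarrow> h * f * h' \<approx> h * g * h'"
  by (intro eqv_left eqv_right)

text \<open>The element \<open>w q^*\<close>, whose ghost edges appear in reverse order. The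
  explicit vertex ensures that empty paths denote the vertex \<open>w\<close> and not the
  unit.\<close>

definition gpath :: "'a \<Rightarrow> 'b list \<Rightarrow> ('a, 'b, 'k) lpa_free" where
  "gpath w q = wd (Vertex w # map Ghost (rev q))"

definition wmon :: "'b list \<Rightarrow> 'a \<Rightarrow> 'b list \<Rightarrow> ('a, 'b, 'k) lpa_free" where
  "wmon p w q = wd (map Edge p) * gpath w q"

definition path :: "'b list \<Rightarrow> 'a \<Rightarrow> ('a, 'b, 'k) lpa_free" where
  "path p w = wd (map Edge p @ [Vertex w])"

lemma path_mon: "path p w = wmon p w []"
  by (simp add: path_def wmon_def gpath_def word_elt_append)

lemma wmon_Cons: "wmon (e # p) w q = wd [Edge e] * wmon p w q"
  by (simp add: wmon_def word_elt_Cons[of "Edge e" "map Edge p"] mult.assoc)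

lemma wmon_Nil: "wmon [] w q = wd [Vertex w] * wd (map Ghost (rev q))"
  by (simp add: wmon_def gpath_def word_elt_Nil word_elt_Cons[of "Vertex w" "map Ghost (rev q)"])

lemma gpath_Cons: "gpath w (e # q) = gpath w q * wd [Ghost e]"
  by (simp add: gpath_def flip: word_elt_append)

lemma path_append: "path (p @ q) w = wd (map Edge p) * path q w"
  by (simp add: path_def word_elt_append mult.assoc)

lemma gpath_C: "awalk u q w \<Longrightarrow> gpath w q \<in> C"
  unfolding gpath_def using awalk_last_in_verts[of u q w] by (intro C_intros) (auto simp: awalk_def)

lemma edges_C: "awalk u p w \<Longrightarrow> wd (map Edge p) \<in> C"
  by (intro C_intros) (auto simp: awalk_def)

lemma wmon_C: "\<lbrakk>awalk u p w; awalk u' q w\<rbrakk> \<Longrightarrow> wmon p w q \<in> C"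
  unfolding wmon_def by (rule free_algebra_closed(4)[OF edges_C gpath_C])

lemma path_C: "awalk u p w \<Longrightarrow> path p w \<in> C"
  unfolding path_mon using awalk_last_in_verts[of u p w]
  by (intro wmon_C[of u p w w]) (auto simp: awalk_def)

text \<open>If \<open>p\<close> starts with an edge, the source of that edge can be inserted in
  front of it, which leaves a product of two vertices; if \<open>p\<close> is empty, this product is
  already there.\<close>

lemma vertex_mon:
  assumes p: "awalk u p w" and q: "awalk u' q w" and x: "x \<in> verts G"
  shows "wd [Vertex x] * wmon p w q \<approx> (if x = u then wmon p w q else 0)"
proof (cases p)
  case Nil
  then have w: "w = u" "w \<in> verts G" using p by (auto simp: awalk_def)
  have g: "wd (map Ghost (rev q)) \<in> C" using q by (intro C_intros) (auto simp: awalk_def)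
  have "wd [Vertex x] * wd [Vertex w] * wd (map Ghost (rev q)) \<approx>
      (if x = w then wd [Vertex x] else 0) * wd (map Ghost (rev q))"
    using eqv_right[OF g vertex_vertex[OF x w(2)]] by simp
  then show ?thesis using Nil w by (auto simp: wmon_Nil mult.assoc)
next
  case (Cons e p')
  then have e: "e \<in> arcs G" "u = tail G e" "awalk (head G e) p' w" using p by (auto simp: awalk_Cons_iff)
  then have u: "u \<in> verts G" by simp
  have m: "wd [Edge e] * wmon p' w q \<in> C" "wmon p' w q \<in> C"
    using wmon_C[OF e(3) q] e(1) by auto
  have "wd [Vertex x] * (wd [Vertex u] * wd [Edge e]) * wmon p' w q \<approx> wd [Vertex x] * wd [Edge e] * wmon p' w q"
    using eqv_ctx[OF source_edge[OF e(1)], of "wd [Vertex x]" "wmon p' w q"] m x e by simp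
  then have 1: "wd [Vertex x] * wmon p w q \<approx> wd [Vertex x] * wd [Vertex u] * (wd [Edge e] * wmon p' w q)"
    by (simp add: Cons wmon_Cons mult.assoc eqv_sym)
  also have "\<dots> \<approx> (if x = u then wd [Vertex x] else 0) * (wd [Edge e] * wmon p' w q)"
    using m by (intro eqv_right vertex_vertex x u)
  also have "\<dots> \<approx> (if x = u then wmon p w q else 0)"
    using eqv_right[OF m(2) source_edge[OF e(1)]] e(2) by (simp add: Cons wmon_Cons mult.assoc)
  finally show ?thesis .
qed

definition is_mon :: "('a, 'b, 'k) lpa_free \<Rightarrow> bool" where
  "is_mon f \<longleftrightarrow> (\<exists>u p w u' q. awalk u p w \<and> awalk u' q w \<and> f = wmon p w q)"

text \<open>Up to the relations, zero and the monomials \<open>p q^*\<close> are stable under left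
  multiplication by generators; this is the inductive step for rewriting words.\<close>

lemma gen_mon:
  assumes g: "g \<in> lpa_gens G" and p: "awalk u p w" and q: "awalk u' q w"
  shows "wd [g] * wmon p w q \<approx> 0 \<or> (\<exists>f. is_mon f \<and> wd [g] * wmon p w q \<approx> f)"
proof -
  have m: "wmon p w q \<in> C" by (rule wmon_C[OF p q])
  have im: "is_mon (wmon p w q)" using p q unfolding is_mon_def by blast
  have wv: "w \<in> verts G" by (rule awalk_last_in_verts[OF p])
  show ?thesis
  proof (cases g)
    case (Vertex x)
    then show ?thesis using vertex_mon[OF p q, of x] g im by (cases "x = u") auto
  next
    case (Edge e)
    then have e: "e \<in> arcs G" using g by simp
    show ?thesis
    proof (cases "head G e = u")
      case True
      then have "awalk (tail G e) (e # p) w" using e p by (simp add: awalk_Cons_iff)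
      then have "is_mon (wmon (e # p) w q)" using q unfolding is_mon_def by blast
      then show ?thesis using Edge by (auto simp: wmon_Cons)
    next
      case False
      \<comment> \<open>The range of \<open>e\<close> is inserted; it differs from the vertex where
        \<open>p\<close> starts and kills the product.\<close>
      have "wd [Edge e] * wmon p w q \<approx> wd [Edge e] * (wd [Vertex (head G e)] * wmon p w q)"
        using eqv_right[OF m edge_range[OF e]] by (simp add: mult.assoc eqv_sym)
      also have "\<dots> \<approx> 0"
        using vertex_mon[OF p q, of "head G e"] False e eqv_left_zero[of "wd [Edge e]"] by simp
      finally show ?thesis using Edge by simp
    qed
  next
    case (Ghost e)
    then have e: "e \<in> arcs G" using g by simp
    show ?thesis
    proof (cases p)
      case Nil
      have gq: "wd (map Ghost (rev q)) \<in> C" using q by (intro C_intros) (auto simp: awalk_def)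
      have "wd [Ghost e] * wmon p w q \<approx> wd [Ghost e] * (wd [Vertex (tail G e)] * wmon p w q)"
        using eqv_right[OF m ghost_source[OF e]] by (simp add: mult.assoc eqv_sym)
      also have "\<dots> \<approx> wd [Ghost e] * (if tail G e = u then wmon p w q else 0)"
        using e eqv_left[OF _ vertex_mon[OF p q, of "tail G e"], of "wd [Ghost e]"] by simp
      finally have 1: "wd [Ghost e] * wmon p w q \<approx> wd [Ghost e] * (if tail G e = u then wmon p w q else 0)" .
      have uw: "u = w" using p Nil by (simp add: awalk_def)
      show ?thesis
      proof (cases "tail G e = u")
        case True
        \<comment> \<open>With \<open>p\<close> empty the ghost edge meets no edge to cancel and is
          absorbed into the ghost part: \<open>e^* w q^*\<close> becomes
          \<open>r(e) (q e)^*\<close>.\<close>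
        have aw: "awalk u' (q @ [e]) (head G e)"
          unfolding awalk_append_cancel[OF q] using True uw e by (auto simp: awalk_def)
        have "wd [Ghost e] * wmon p w q = wd [Ghost e] * wd [Vertex (tail G e)] * wd (map Ghost (rev q))"
          using Nil True uw by (simp add: wmon_Nil mult.assoc)
        also have "\<dots> \<approx> wd [Ghost e] * wd (map Ghost (rev q))"
          using eqv_right[OF gq ghost_source[OF e]] .
        also have "\<dots> \<approx> wd [Vertex (head G e)] * wd [Ghost e] * wd (map Ghost (rev q))"
          using eqv_right[OF gq range_ghost[OF e]] by (rule eqv_sym)
        also have "\<dots> = wmon [] (head G e) (q @ [e])"
          by (simp add: wmon_Nil word_elt_Cons[of "Ghost e" "map Ghost (rev q)"] mult.assoc)
        finally have "wd [Ghost e] * wmon p w q \<approx> wmon [] (head G e) (q @ [e])" .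
        moreover have "is_mon (wmon [] (head G e) (q @ [e]))"
        proof -
          have "awalk (head G e) [] (head G e)" using e by (simp add: awalk_def)
          then show ?thesis using aw unfolding is_mon_def by blast
        qed
        ultimately show ?thesis using Ghost by auto
      next
        case False
        then show ?thesis using 1 Ghost by simp
      qed
    next
      case (Cons f p')
      then have f: "f \<in> arcs G" "u = tail G f" "awalk (head G f) p' w" using p by (auto simp: awalk_Cons_iff)
      have m': "wmon p' w q \<in> C" by (rule wmon_C[OF f(3) q])
      have 1: "wd [Ghost e] * wmon p w q \<approx> (if e = f then wd [Vertex (head G e)] else 0) * wmon p' w q"
        using eqv_right[OF m' ghost_edge[OF e f(1)]] by (simp add: Cons wmon_Cons mult.assoc)
      show ?thesis
      proof (cases "e = f")
        case True
        have "wd [Vertex (head G f)] * wmon p' w q \<approx> wmon p' w q"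
          using vertex_mon[OF f(3) q, of "head G f"] f(1) by simp
        then have "wd [Ghost e] * wmon p w q \<approx> wmon p' w q" using 1 True eqv_trans by simp
        moreover have "is_mon (wmon p' w q)" using f(3) q unfolding is_mon_def by blast
        ultimately show ?thesis using Ghost by auto
      next
        case False
        then show ?thesis using 1 Ghost by simp
      qed
    qed
  qed
qed

text \<open>The final vertex is the trivial monomial from which the induction starts; the letters
  are then applied from right to left.\<close>

lemma word_mon:
  assumes "set gs \<subseteq> lpa_gens G" and "x \<in> verts G"
  shows "wd (gs @ [Vertex x]) \<approx> 0 \<or> (\<exists>f. is_mon f \<and> wd (gs @ [Vertex x]) \<approx> f)"
  using assms(1)
proof (induction gs)
  case Nil
  have "awalk x [] x" using assms(2) by (simp add: awalk_def)
  then have "is_mon (wmon [] x [])" unfolding is_mon_def by blast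
  then show ?case by (auto simp: wmon_def gpath_def word_elt_Nil)
next
  case (Cons g gs)
  then have g: "wd [g] \<in> C" "g \<in> lpa_gens G" by auto
  have eq: "wd ((g # gs) @ [Vertex x]) = wd [g] * wd (gs @ [Vertex x])"
    using word_elt_Cons[of g "gs @ [Vertex x]"] by simp
  from Cons have "wd (gs @ [Vertex x]) \<approx> 0 \<or> (\<exists>f. is_mon f \<and> wd (gs @ [Vertex x]) \<approx> f)" by simp
  then show ?case
  proof
    assume "wd (gs @ [Vertex x]) \<approx> 0"
    then show ?thesis unfolding eq using eqv_left_zero[OF g(1)] by blast
  next
    assume "\<exists>f. is_mon f \<and> wd (gs @ [Vertex x]) \<approx> f"
    then obtain u p w u' q where aw: "awalk u p w" "awalk u' q w" "wd (gs @ [Vertex x]) \<approx> wmon p w q"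
      unfolding is_mon_def by blast
    have "wd ((g # gs) @ [Vertex x]) \<approx> wd [g] * wmon p w q"
      unfolding eq by (rule eqv_left[OF g(1) aw(3)])
    then show ?thesis using gen_mon[OF g(2) aw(1,2)] eqv_trans by blast
  qed
qed

text \<open>The monomials \<open>p q^*\<close> span the algebra. The property must be transferable
  along \<open>\<approx>\<close>, since they span the free algebra only modulo the ideal.\<close>

lemma C_induct [consumes 1, case_names eqv zero add scalar wmon]:
  assumes f: "f \<in> C"
    and eqv: "\<And>f g. \<lbrakk>f \<in> C; g \<in> C; f \<approx> g; Q g\<rbrakk> \<Longrightarrow> Q f" and zero: "Q 0"
    and add: "\<And>f g. \<lbrakk>f \<in> C; g \<in> C; Q f; Q g\<rbrakk> \<Longrightarrow> Q (f + g)"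
    and scalar: "\<And>k f. \<lbrakk>f \<in> C; Q f\<rbrakk> \<Longrightarrow> Q (scal k * f)"
    and wmon: "\<And>u p w u' q. \<lbrakk>awalk u p w; awalk u' q w\<rbrakk> \<Longrightarrow> Q (wmon p w q)"
  shows "Q f"
proof -
  have sumQ: "(\<forall>i\<in>S. f i \<in> C \<and> Q (f i)) \<Longrightarrow> sum f S \<in> C \<and> Q (sum f S)" for f :: "'c \<Rightarrow> _" and S
    by (induction S rule: infinite_finite_induct) (auto intro: zero add)
  have word: "Q (wd gs)" if gs: "set gs \<subseteq> lpa_gens G" for gs
  proof -
    have gC: "wd gs \<in> C" using gs by blast
    have "Q (wd (gs @ [Vertex x]))" if x: "x \<in> verts G" for x
    proof -
      have wC: "wd (gs @ [Vertex x]) \<in> C" using gs x by (intro C_intros) auto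
      from word_mon[OF gs x] show ?thesis
      proof
        assume "wd (gs @ [Vertex x]) \<approx> 0"
        then show ?thesis by (intro eqv[OF wC C_intros(1) _ zero])
      next
        assume "\<exists>f. is_mon f \<and> wd (gs @ [Vertex x]) \<approx> f"
        then obtain u p w u' q where aw: "awalk u p w" "awalk u' q w" "wd (gs @ [Vertex x]) \<approx> wmon p w q"
          unfolding is_mon_def by blast
        show ?thesis by (rule eqv[OF wC wmon_C[OF aw(1,2)] aw(3) wmon[OF aw(1,2)]])
      qed
    qed
    moreover have "wd (gs @ [Vertex x]) \<in> C" if "x \<in> verts G" for x
      using gs that by (intro C_intros) auto
    ultimately have s: "(\<Sum>x\<in>verts G. wd (gs @ [Vertex x])) \<in> C \<and> Q (\<Sum>x\<in>verts G. wd (gs @ [Vertex x]))"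
      by (intro sumQ) blast
    \<comment> \<open>Multiplying by \<open>1\<close>, the sum of all vertices, replaces an
      arbitrary word by words that end with a vertex.\<close>
    have "wd gs * 1 \<approx> wd gs * (\<Sum>x\<in>verts G. wd [Vertex x])" by (rule eqv_left[OF gC one_eqv])
    then have "wd gs \<approx> (\<Sum>x\<in>verts G. wd (gs @ [Vertex x]))"
      by (simp add: sum_distrib_left word_elt_append)
    then show ?thesis using eqv[OF gC] s by blast
  qed
  have expand: "Poly_Mapping.single w k = scal k * wd (letters w)" for w k
    by (simp add: word_elt_def mult_single)
  have "f \<in> C \<and> Q f"
  proof -
    have "Poly_Mapping.keys f \<subseteq> {w. set (letters w) \<subseteq> lpa_gens G}"
      using f by (auto simp: free_algebra_def)
    then show ?thesis
    proof (induction f rule: poly_mapping_induct_on)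
      case (single w k)
      then have "wd (letters w) \<in> C" "Q (wd (letters w))" using word by auto
      then have "scal k * wd (letters w) \<in> C \<and> Q (scal k * wd (letters w))"
        by (intro conjI scalar free_algebra_closed(4)[OF scalar_closed])
      then show ?case by (simp only: expand[of w k])
    qed (auto intro: zero add)
  qed
  then show ?thesis by simp
qed

lemma ghost_path_cancel:
  assumes "awalk u q w" and "awalk w p w'"
  shows "gpath w q * path (q @ p) w' \<approx> path p w'"
  using assms
proof (induction q arbitrary: u)
  case Nil
  then have "u = w" "w \<in> verts G" by (auto simp: awalk_def)
  moreover have "awalk w' [] w'" using awalk_last_in_verts[OF Nil(2)] by (simp add: awalk_def)
  ultimately show ?case
    using vertex_mon[OF Nil(2), of w' "[]" w] by (simp add: path_mon gpath_def)
next
  case (Cons e q)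
  then have e: "e \<in> arcs G" "awalk (head G e) q w" by (auto simp: awalk_Cons_iff)
  have aw: "awalk (head G e) (q @ p) w'" using awalk_append_cancel[OF e(2)] Cons.prems(2) by simp
  have nil: "awalk w' [] w'" using awalk_last_in_verts[OF aw] by (simp add: awalk_def)
  have "gpath w (e # q) * path ((e # q) @ p) w' = gpath w q * (wd [Ghost e] * wd [Edge e]) * path (q @ p) w'"
    by (simp add: gpath_Cons path_mon wmon_Cons mult.assoc)
  also have "\<dots> \<approx> gpath w q * wd [Vertex (head G e)] * path (q @ p) w'"
    using eqv_ctx[OF ghost_edge[OF e(1) e(1)] gpath_C[OF e(2)] path_C[OF aw]] by simp
  also have "\<dots> \<approx> gpath w q * path (q @ p) w'"
    using eqv_left[OF gpath_C[OF e(2)] vertex_mon[OF aw nil, of "head G e"]] e(1)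
    by (simp add: path_mon mult.assoc)
  also have "\<dots> \<approx> path p w'" by (rule Cons.IH[OF e(2) Cons.prems(2)])
  finally show ?case .
qed

text \<open>The length condition makes \<open>q^*\<close> meet a mismatching edge before
  \<open>p\<close> is used up; for a shorter \<open>p\<close> a ghost path could remain. The start
  vertices are compared separately because \<open>q\<close> may be empty.\<close>

lemma ghost_path_zero:
  assumes "awalk u q w" and "awalk u' p w'" and "length q \<le> length p"
    and "\<not> (u = u' \<and> (\<exists>r. p = q @ r))"
  shows "gpath w q * path p w' \<approx> 0"
  using assms
proof (induction q arbitrary: u u' p)
  case Nil
  then have "u = w" "w \<in> verts G" by (auto simp: awalk_def)
  moreover have "awalk w' [] w'" using awalk_last_in_verts[OF Nil(2)] by (simp add: awalk_def)
  ultimately show ?case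
    using vertex_mon[OF Nil(2), of w' "[]" w] Nil(4) by (simp add: path_mon gpath_def)
next
  case (Cons e q)
  then have e: "e \<in> arcs G" "awalk (head G e) q w" "u = tail G e" by (auto simp: awalk_Cons_iff)
  obtain f p' where p: "p = f # p'" using Cons.prems(3) by (cases p) auto
  then have f: "f \<in> arcs G" "awalk (head G f) p' w'" "u' = tail G f"
    using Cons.prems(2) by (auto simp: awalk_Cons_iff)
  have nil: "awalk w' [] w'" using awalk_last_in_verts[OF f(2)] by (simp add: awalk_def)
  have "gpath w (e # q) * path p w' = gpath w q * (wd [Ghost e] * wd [Edge f]) * path p' w'"
    by (simp add: p gpath_Cons path_mon wmon_Cons mult.assoc)
  also have "\<dots> \<approx> gpath w q * (if e = f then wd [Vertex (head G e)] else 0) * path p' w'"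
    by (rule eqv_ctx[OF ghost_edge[OF e(1) f(1)] gpath_C[OF e(2)] path_C[OF f(2)]])
  also have "\<dots> \<approx> 0"
  proof (cases "e = f")
    case True
    have "gpath w q * wd [Vertex (head G e)] * path p' w' \<approx> gpath w q * path p' w'"
      using eqv_left[OF gpath_C[OF e(2)] vertex_mon[OF f(2) nil, of "head G e"]] f(1) True
      by (simp add: path_mon mult.assoc)
    also have "\<dots> \<approx> 0"
      using Cons.prems(3,4) e f p True by (intro Cons.IH[OF e(2) f(2)]) auto
    finally show ?thesis using True by simp
  qed simp
  finally show ?case .
qed

end

section \<open>The grading\<close>

text \<open>The usual integer grading of a Leavitt path algebra; it serves to cancel
  \<open>c - 1\<close> on the right.\<close>

fun gen_degree :: "('v, 'e) lpa_gen \<Rightarrow> int" where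
  "gen_degree (Vertex x) = 0"
| "gen_degree (Edge e) = 1"
| "gen_degree (Ghost e) = -1"

definition word_degree :: "('v, 'e) lpa_gen fword \<Rightarrow> int" where
  "word_degree w = sum_list (map gen_degree (letters w))"

lemma word_degree_add: "word_degree (u + w) = word_degree u + word_degree w"
  by (simp add: word_degree_def plus_fword_def)

definition graded_part :: "int \<Rightarrow> ('v, 'e, 'k::field) lpa_free \<Rightarrow> ('v, 'e, 'k) lpa_free" where
  "graded_part d f = (\<Sum>w\<in>{w \<in> Poly_Mapping.keys f. word_degree w = d}. Poly_Mapping.single w (Poly_Mapping.lookup f w))"

lemma lookup_graded_part:
  "Poly_Mapping.lookup (graded_part d f) w = (if word_degree w = d then Poly_Mapping.lookup f w else 0)"
  by (simp add: graded_part_def lookup_sum lookup_single when_def in_keys_iff)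

lemma graded_part_zero [simp]: "graded_part d 0 = 0"
  by (simp add: graded_part_def)

lemma graded_part_add: "graded_part d (f + g) = graded_part d f + graded_part d g"
  by (rule poly_mapping_eqI) (simp add: lookup_graded_part lookup_add)

lemma graded_part_diff: "graded_part d (f - g) = graded_part d f - graded_part d g"
  by (rule poly_mapping_eqI) (simp add: lookup_graded_part lookup_minus)

lemma graded_part_sum: "graded_part d (sum f S) = (\<Sum>i\<in>S. graded_part d (f i))"
  by (induction S rule: infinite_finite_induct) (simp_all add: graded_part_add)

lemma graded_part_single:
  "graded_part d (Poly_Mapping.single w k) = (if word_degree w = d then Poly_Mapping.single w k else 0)"
  by (rule poly_mapping_eqI) (auto simp: lookup_graded_part lookup_single when_def)

lemma graded_part_graded_part: "graded_part d (graded_part e f) = (if d = e then graded_part e f else 0)"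
  by (rule poly_mapping_eqI) (simp add: lookup_graded_part)

lemma graded_part_single_mult:
  "graded_part d (Poly_Mapping.single u k * f) = Poly_Mapping.single u k * graded_part (d - word_degree u) f"
  by (induction f rule: poly_mapping_induct)
    (auto simp: distrib_left graded_part_add graded_part_single mult_single word_degree_add)

lemma graded_part_mult_single:
  "graded_part d (f * Poly_Mapping.single u k) = graded_part (d - word_degree u) f * Poly_Mapping.single u k"
  by (induction f rule: poly_mapping_induct)
    (auto simp: distrib_right graded_part_add graded_part_single mult_single word_degree_add)

lemma sum_graded_parts: "f = (\<Sum>d\<in>word_degree ` Poly_Mapping.keys f. graded_part d f)"
proof (rule poly_mapping_eqI)
  fix w
  show "Poly_Mapping.lookup f w = Poly_Mapping.lookup (\<Sum>d\<in>word_degree ` Poly_Mapping.keys f. graded_part d f) w"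
    by (cases "w \<in> Poly_Mapping.keys f") (auto simp: lookup_sum lookup_graded_part in_keys_iff)
qed

lemma graded_part_word_elt:
  "graded_part d (word_elt gs) = (if sum_list (map gen_degree gs) = d then word_elt gs else 0)"
  by (simp add: word_elt_def graded_part_single word_degree_def)

lemma relation_homogeneous:
  assumes "r \<in> lpa_relations E"
  obtains e where "graded_part e r = r"
proof -
  have "\<exists>e. graded_part e r = r"
    using assms
  proof cases
    case unit
    have "graded_part 0 r = r"
      unfolding unit by (simp add: graded_part_diff graded_part_sum graded_part_word_elt flip: word_elt_Nil)
    then show ?thesis by blast
  next
    case (cuntz_krieger v)
    have "graded_part 0 r = r"
      unfolding cuntz_krieger by (simp add: graded_part_diff graded_part_sum graded_part_word_elt)
    then show ?thesis by blast
  next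
    case (vertices v u)
    have "graded_part 0 r = r" unfolding vertices by (simp add: graded_part_diff graded_part_word_elt)
    then show ?thesis by blast
  next
    case (ghost_edge e e')
    have "graded_part 0 r = r" unfolding ghost_edge by (simp add: graded_part_diff graded_part_word_elt)
    then show ?thesis by blast
  next
    case (source_edge e)
    have "graded_part 1 r = r" unfolding source_edge by (simp add: graded_part_diff graded_part_word_elt)
    then show ?thesis by blast
  next
    case (edge_range e)
    have "graded_part 1 r = r" unfolding edge_range by (simp add: graded_part_diff graded_part_word_elt)
    then show ?thesis by blast
  next
    case (range_ghost e)
    have "graded_part (-1) r = r" unfolding range_ghost by (simp add: graded_part_diff graded_part_word_elt)
    then show ?thesis by blast
  next
    case (ghost_source e)
    have "graded_part (-1) r = r" unfolding ghost_source by (simp add: graded_part_diff graded_part_word_elt)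
    then show ?thesis by blast
  qed
  then show thesis using that by blast
qed

context lpa_free_setup
begin

text \<open>The ideal is generated by homogeneous elements, so it contains the components of its
  members. Multiplication by a single word shifts the degree, hence the generalisation over
  \<open>d\<close>.\<close>

lemma ideal_graded: "f \<in> I \<Longrightarrow> graded_part d f \<in> I"
proof (induction f arbitrary: d rule: lpa_ideal_induct)
  case (relation r)
  obtain e where e: "graded_part e r = r" by (rule relation_homogeneous[OF relation])
  then show ?case using graded_part_graded_part[of d e r] lpa_ideal_facts(6)[OF relation] by (auto split: if_splits)
next
  case (left f g)
  have "Poly_Mapping.keys g \<subseteq> {w. set (letters w) \<subseteq> lpa_gens G}"
    using left(1) by (auto simp: free_algebra_def)
  then show ?case
  proof (induction g arbitrary: d rule: poly_mapping_induct_on)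
    case (single w k)
    then have "Poly_Mapping.single w k \<in> C" by (auto simp: free_algebra_def)
    then show ?case using left(2) by (simp add: graded_part_single_mult I_left)
  qed (auto simp: distrib_right graded_part_add intro: I_add)
next
  case (right f g)
  have "Poly_Mapping.keys g \<subseteq> {w. set (letters w) \<subseteq> lpa_gens G}"
    using right(1) by (auto simp: free_algebra_def)
  then show ?case
  proof (induction g arbitrary: d rule: poly_mapping_induct_on)
    case (single w k)
    then have "Poly_Mapping.single w k \<in> C" by (auto simp: free_algebra_def)
    then show ?case using right(2) by (simp add: graded_part_mult_single I_right)
  qed (auto simp: distrib_left graded_part_add intro: I_add)
qed (auto simp: graded_part_add intro: I_add)

text \<open>If \<open>y = y p\<close>, then the component of \<open>y\<close> in degree \<open>d\<close> is the one in degree \<open>d - |p|\<close>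
  multiplied by \<open>p\<close>, so that a nonzero component would propagate to infinitely many degrees.\<close>

lemma right_mult_path_minus_one_cancel:
  assumes p: "set p \<subseteq> arcs G" "p \<noteq> []" and yp: "y * wd (map Edge p) \<approx> y"
  shows "y \<approx> 0"
proof -
  let ?p = "wd (map Edge p)" and ?l = "int (length p)"
  have pC: "?p \<in> C" using p by (intro C_intros) auto
  have deg: "word_degree (FWord (map Edge p)) = ?l"
    by (simp add: word_degree_def comp_def sum_list_triv)
  have step: "graded_part (d - ?l) y \<notin> I" if d: "graded_part d y \<notin> I" for d
  proof
    assume low: "graded_part (d - ?l) y \<in> I"
    have "graded_part d (y * ?p - y) \<in> I" using yp unfolding eqv_def by (rule ideal_graded)
    moreover have "graded_part d (y * ?p) = graded_part (d - ?l) y * ?p"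
      unfolding word_elt_def graded_part_mult_single deg ..
    ultimately have "graded_part (d - ?l) y * ?p - graded_part d y \<in> I" by (simp add: graded_part_diff)
    then have "graded_part (d - ?l) y * ?p + - (graded_part (d - ?l) y * ?p - graded_part d y) \<in> I"
      by (intro I_add I_minus I_right pC low)
    then show False using d by simp
  qed
  have "graded_part d y \<in> I" for d
  proof (rule ccontr)
    assume d: "graded_part d y \<notin> I"
    have notin: "graded_part (d - int j * ?l) y \<notin> I" for j
    proof (induction j)
      case (Suc j)
      then show ?case using step[OF Suc] by (simp add: algebra_simps)
    qed (simp add: d)
    have "d - int j * ?l \<in> word_degree ` Poly_Mapping.keys y" for j
    proof (rule ccontr)
      assume "d - int j * ?l \<notin> word_degree ` Poly_Mapping.keys y"
      then have "{w \<in> Poly_Mapping.keys y. word_degree w = d - int j * ?l} = {}"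
        by (auto simp: image_iff)
      then have "graded_part (d - int j * ?l) y = 0" unfolding graded_part_def by (simp only: sum.empty)
      then show False using notin[of j] by simp
    qed
    then have "range (\<lambda>j. d - int j * ?l) \<subseteq> word_degree ` Poly_Mapping.keys y" by blast
    then have "finite (range (\<lambda>j. d - int j * ?l))" by (rule finite_subset) simp
    moreover have "inj (\<lambda>j. d - int j * ?l)" using p(2) by (auto intro!: injI)
    ultimately show False using finite_imageD infinite_UNIV_nat by blast
  qed
  then have "(\<Sum>d\<in>word_degree ` Poly_Mapping.keys y. graded_part d y) \<approx> (\<Sum>d\<in>word_degree ` Poly_Mapping.keys y. 0)"
    by (intro eqv_sum) (simp add: eqv_def)
  then show ?thesis using sum_graded_parts[of y] by simp
qed

end

section \<open>Paths ending with a basic closed path\<close>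

locale lpa_cycle = lpa_free_setup G K for G :: "('a, 'b) pre_digraph" and K :: "'k::field itself" +
  fixes c :: "'b list"
  assumes basic: "basic_closed_path G c"
begin

definition v :: 'a where "v = tail G (hd c)"

abbreviation cinf :: "'b stream" where "cinf \<equiv> Stream.cycle c"

abbreviation cpow :: "nat \<Rightarrow> 'b list" where "cpow k \<equiv> concat (replicate k c)"

lemma c_ne: "c \<noteq> []" using basic by (simp add: basic_closed_path_def closed_path_def)

lemma awalk_c: "awalk v c v"
proof -
  obtain w where w: "awalk w c w" using basic by (auto simp: basic_closed_path_def closed_path_def)
  obtain e p where c: "c = e # p" using c_ne by (cases c) auto
  have "w = tail G e" using w unfolding c awalk_Cons_iff by simp
  moreover have "v = tail G e" unfolding v_def by (simp add: c)
  ultimately have "w = v" by simp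
  then show ?thesis using w by simp
qed

lemma v_verts [simp]: "v \<in> verts G" using awalk_c by (simp add: awalk_def)

lemma awalk_v_Nil [simp]: "awalk v [] v" by (simp add: awalk_def)

lemma awalk_cpow: "awalk v (cpow k) v"
  by (induction k) (simp_all add: awalk_append_cancel[OF awalk_c] del: awalk_append_iff)

lemma cpow_add: "cpow (j + k) = cpow j @ cpow k"
  by (simp add: replicate_add)

lemma length_cpow: "length (cpow k) = k * length c"
  by (induction k) simp_all

lemma length_cpow_ge: "k \<le> length (cpow k)"
  using c_ne unfolding length_cpow by (cases "length c") simp_all

lemma cpow_cinf: "cpow k @- cinf = cinf"
proof (induction k)
  case (Suc k)
  then show ?case using cycle_decomp[OF c_ne] by simp
qed simp

lemma shift_eq_imp: "\<lbrakk>p @- s = q @- s'; length p = length q\<rbrakk> \<Longrightarrow> p = q"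
  by (induction p arbitrary: q) (auto simp: length_Suc_conv Suc_length_conv)

text \<open>\<open>p c\<close> and \<open>c p\<close> are initial segments of
  \<open>c^\<infinity>\<close> of equal length, so \<open>p\<close> and \<open>c\<close> commute and
  are powers of a common word \<open>r\<close>. Basicness then leaves only
  \<open>c = r\<close>.\<close>

lemma shift_fixed:
  assumes "p @- cinf = cinf" obtains j where "p = cpow j"
proof -
  have c: "c @- cinf = cinf" using cycle_decomp[OF c_ne] by simp
  have "(p @ c) @- cinf = (c @ p) @- cinf" using assms c by simp
  then have "p @ c = c @ p" by (rule shift_eq_imp) simp
  then obtain m n r where mn: "concat (replicate m r) = p" "concat (replicate n r) = c"
    using comm_append_are_replicate by blast
  have "n = 1"
  proof (rule ccontr)
    assume "n \<noteq> 1"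
    moreover have "n \<noteq> 0" using mn c_ne by auto
    ultimately obtain k where k: "n = Suc (Suc k)" by (metis One_nat_def not0_implies_Suc)
    have "r \<noteq> []" using mn(2) c_ne by auto
    then obtain e r' where r: "r = e # r'" by (cases r) auto
    \<comment> \<open>A second copy of \<open>r\<close> follows the first inside \<open>c\<close>,
      so \<open>r\<close> ends at the source of its own first edge and is a closed path.\<close>
    have cr: "c = r @ (r @ concat (replicate k r))" using mn(2) k by simp
    have "awalk v r (awlast v r)" "awalk (awlast v r) (r @ concat (replicate k r)) v"
      using awalk_c unfolding cr awalk_append_iff by blast+
    moreover from this have "v = tail G e" "awlast v r = tail G e"
      unfolding r by (simp_all add: awalk_Cons_iff)
    ultimately have "awalk v r v" by simp
    then have "closed_path G r" using \<open>r \<noteq> []\<close> by (auto simp: closed_path_def)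
    moreover have "n \<ge> 2" using k by simp
    ultimately show False using basic mn(2) unfolding basic_closed_path_def by blast
  qed
  then show thesis using mn that[of m] by simp
qed

text \<open>The shorter path is an initial segment of the longer one, and the remainder fixes
  \<open>c^\<infinity>\<close>.\<close>

lemma same_limit:
  assumes "p @- cinf = q @- cinf"
  obtains j where "p = q @ cpow j" | j where "q = p @ cpow j"
proof -
  have aux: "\<exists>j. q = p @ cpow j" if eq: "p @- cinf = q @- cinf" and le: "length p \<le> length q" for p q
  proof -
    define p' q' where "p' = take (length p) q" and "q' = drop (length p) q"
    have q: "q = p' @ q'" by (simp add: p'_def q'_def)
    have "p @- cinf = p' @- (q' @- cinf)" using eq q by simp
    then have "p = p'" by (rule shift_eq_imp) (use le in \<open>simp add: p'_def\<close>)
    then have "q' @- cinf = cinf" using eq q by simp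
    then obtain j where "q' = cpow j" by (rule shift_fixed)
    then show ?thesis using q \<open>p = p'\<close> by blast
  qed
  show thesis using aux[OF assms] aux[OF assms[symmetric]] that nat_le_linear by blast
qed

lemma awalk_nth: "\<lbrakk>awalk u p w; Suc i < length p\<rbrakk> \<Longrightarrow> p ! i \<in> arcs G \<and> head G (p ! i) = tail G (p ! Suc i)"
proof (induction p arbitrary: u i)
  case (Cons e p)
  then have e: "e \<in> arcs G" "awalk (head G e) p w" by (auto simp: awalk_Cons_iff)
  show ?case
  proof (cases i)
    case 0
    then obtain f p' where "p = f # p'" using Cons.prems(2) by (cases p) auto
    then show ?thesis using 0 e by (auto simp: awalk_Cons_iff)
  next
    case (Suc j)
    then show ?thesis using Cons.IH[OF e(2), of j] Cons.prems(2) by simp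
  qed
qed simp

lemma infinite_cinf: "infinite_path G cinf"
  unfolding infinite_path_def
proof
  fix i
  \<comment> \<open>A power of \<open>c\<close> long enough to contain the positions
    \<open>i\<close> and \<open>Suc i\<close>.\<close>
  let ?p = "cpow (Suc (Suc i))"
  have i: "Suc i < length ?p" using length_cpow_ge[of "Suc (Suc i)"] by simp
  have nth: "cinf !! j = ?p ! j" if "j < length ?p" for j
    using shift_snth_less[OF that, of cinf] unfolding cpow_cinf .
  show "cinf !! i \<in> arcs G \<and> head G (cinf !! i) = tail G (cinf !! Suc i)"
    unfolding nth[OF i] nth[OF Suc_lessD[OF i]] by (rule awalk_nth[OF awalk_cpow i])
qed

lemma shd_cinf: "tail G (shd cinf) = v" by (simp add: v_def)

lemma infinite_path_append: "awalk u p v \<Longrightarrow> infinite_path G (p @- cinf) \<and> tail G (shd (p @- cinf)) = u"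
proof (induction p arbitrary: u)
  case Nil
  then show ?case using infinite_cinf shd_cinf by (simp add: awalk_def)
next
  case (Cons e p)
  then have e: "e \<in> arcs G" "awalk (head G e) p v" "u = tail G e" by (auto simp: awalk_Cons_iff)
  then show ?case using Cons.IH[OF e(2)] infinite_path_Cons[of G "p @- cinf" e] by simp
qed

lemma path_tail_class: "awalk u p v \<Longrightarrow> p @- cinf \<in> tail_class G cinf"
proof -
  assume "awalk u p v"
  then have "infinite_path G (p @- cinf)" using infinite_path_append by blast
  moreover have "sdrop 0 cinf = sdrop (length p) (p @- cinf)" by (simp add: sdrop_shift)
  ultimately show ?thesis unfolding tail_class_def by blast
qed

lemma infinite_path_awalk: "infinite_path G (p @- cinf) \<Longrightarrow> awalk (tail G (shd (p @- cinf))) p v"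
proof (induction p)
  case Nil
  show ?case by (simp only: shift.simps shd_cinf awalk_v_Nil)
next
  case (Cons e p)
  have "e \<in> arcs G" "head G e = tail G (shd (p @- cinf))"
    using Cons.prems[unfolded infinite_path_def, rule_format, of 0] by simp_all
  moreover have "awalk (tail G (shd (p @- cinf))) p v"
    using Cons infinite_path_stl[OF Cons.prems] by simp
  ultimately show ?case by (simp add: awalk_Cons_iff)
qed

lemma tail_class_path:
  assumes "q \<in> tail_class G cinf"
  obtains u p where "awalk u p v" "q = p @- cinf"
proof -
  obtain m n where mn: "sdrop m cinf = sdrop n q" and inf: "infinite_path G q"
    using assms by (auto simp: tail_class_def)
  \<comment> \<open>The tail may start in the middle of a copy of \<open>c\<close>. As
    \<open>c^m\<close> has at least \<open>m\<close> edges, what is left of it completes that copy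
    and is followed by \<open>c^\<infinity>\<close>.\<close>
  have "sdrop m cinf = sdrop m (cpow m @- cinf)" by (simp only: cpow_cinf)
  also have "\<dots> = drop m (cpow m) @- cinf"
    using length_cpow_ge[of m] by (simp only: sdrop_shift) simp
  finally have "sdrop n q = drop m (cpow m) @- cinf" using mn by simp
  then have q: "q = (stake n q @ drop m (cpow m)) @- cinf"
    using stake_sdrop[of n q] by simp
  show thesis
    by (rule that[OF infinite_path_awalk q]) (use inf q in simp)
qed

text \<open>An arbitrary choice. Two candidates differ by a power of \<open>c\<close>, which is
  absorbed into a coefficient with constant term \<open>1\<close>.\<close>

definition rep :: "'b stream \<Rightarrow> 'b list" where
  "rep q = (SOME p. \<exists>u. awalk u p v \<and> q = p @- cinf)"

lemma rep:
  assumes "q \<in> tail_class G cinf"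
  obtains u where "awalk u (rep q) v" "q = rep q @- cinf"
proof -
  have "\<exists>p u. awalk u p v \<and> q = p @- cinf" using tail_class_path[OF assms] by metis
  then have "\<exists>u. awalk u (rep q) v \<and> q = rep q @- cinf" unfolding rep_def by (rule someI_ex)
  then show thesis using that by blast
qed

lemma act_path:
  assumes "awalk u p v"
  shows "free_act G (path p v) (Poly_Mapping.single cinf m) = Poly_Mapping.single (p @- cinf) m"
proof -
  have "word_act G (map Edge p @ [Vertex v]) cinf = Some (p @- cinf)" using assms
  proof (induction p arbitrary: u)
    case Nil
    then show ?case using shd_cinf by simp
  next
    case (Cons e p)
    then have "awalk (head G e) p v" by (auto simp: awalk_Cons_iff)
    then show ?case using Cons.IH infinite_path_append by simp
  qed
  then show ?thesis by (simp add: path_def free_act_word_elt)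
qed


section \<open>Congruences modulo powers of \<open>c - 1\<close>\<close>

definition z :: "('a, 'b, 'k) lpa_free" where "z = wd (map Edge c)"

definition A :: "('a, 'b, 'k) lpa_free" where "A = z - 1"

lemma z_C [simp]: "z \<in> C" unfolding z_def by (rule edges_C[OF awalk_c])

lemma A_C [simp]: "A \<in> C" by (simp add: A_def)

lemma z_power: "z ^ k = wd (map Edge (cpow k))"
  by (induction k) (simp_all add: z_def word_elt_Nil word_elt_append)

text \<open>Nonemptiness matters: the empty word is the unit, whereas the empty path is a
  vertex.\<close>

lemma edges_path: "\<lbrakk>awalk u p w; p \<noteq> []\<rbrakk> \<Longrightarrow> wd (map Edge p) \<approx> path p w"
proof (induction p arbitrary: u)
  case (Cons e p)
  then have e: "e \<in> arcs G" "awalk (head G e) p w" by (auto simp: awalk_Cons_iff)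
  show ?case
  proof (cases "p = []")
    case True
    then have "head G e = w" using e by (simp add: awalk_def)
    then have "wd [Edge e] * wd [Vertex w] \<approx> wd [Edge e]" using edge_range[OF e(1)] by simp
    then show ?thesis using True eqv_sym by (simp add: path_def word_elt_Cons[of _ "[_]"])
  next
    case False
    have "wd [Edge e] * wd (map Edge p) \<approx> wd [Edge e] * path p w"
      using Cons.IH[OF e(2) False] e(1) by (intro eqv_left) auto
    moreover have "wd (map Edge (e # p)) = wd [Edge e] * wd (map Edge p)"
      unfolding list.map by (rule word_elt_Cons)
    moreover have "path (e # p) w = wd [Edge e] * path p w" by (simp add: path_mon wmon_Cons)
    ultimately show ?thesis by simp
  qed
qed simp

lemma vertex_path: "awalk v p w \<Longrightarrow> wd [Vertex v] * path p w \<approx> path p w"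
  using vertex_mon[of v p w w "[]" v] awalk_last_in_verts[of v p w] by (simp add: path_mon awalk_def)

lemma path_z_power:
  assumes p: "awalk u p v"
  shows "path p v * z ^ k \<approx> path (p @ cpow k) v"
proof (cases k)
  case (Suc j)
  have ne: "cpow k \<noteq> []" using c_ne Suc by simp
  have pC: "wd (map Edge p) \<in> C" by (rule edges_C[OF p])
  have vC: "wd [Vertex v] \<in> C" by (intro C_intros) simp
  have "wd (map Edge p) * (wd [Vertex v] * z ^ k) \<approx> wd (map Edge p) * (wd [Vertex v] * path (cpow k) v)"
    unfolding z_power by (intro eqv_left pC vC edges_path[OF awalk_cpow ne])
  also have "\<dots> \<approx> wd (map Edge p) * path (cpow k) v"
    by (intro eqv_left pC vertex_path awalk_cpow)
  finally have "wd (map Edge p) * (wd [Vertex v] * z ^ k) \<approx> path (p @ cpow k) v"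
    unfolding path_append .
  moreover have "path p v * z ^ k = wd (map Edge p) * (wd [Vertex v] * z ^ k)"
    by (simp add: path_def word_elt_append mult.assoc)
  ultimately show ?thesis by simp
qed simp

lemma vertex_z: "wd [Vertex v] * z \<approx> z"
proof -
  have vC: "wd [Vertex v] \<in> C" by (intro C_intros) simp
  have zp: "z \<approx> path c v" unfolding z_def by (rule edges_path[OF awalk_c c_ne])
  have "wd [Vertex v] * z \<approx> wd [Vertex v] * path c v" by (rule eqv_left[OF vC zp])
  also have "\<dots> \<approx> path c v" by (rule vertex_path[OF awalk_c])
  also have "\<dots> \<approx> z" by (rule eqv_sym[OF zp])
  finally show ?thesis .
qed

text \<open>The exponent makes \<open>c^k\<close> at least as long as \<open>q\<close>, so
  \<open>q^*\<close> is either consumed completely or annihilates it; the successor keeps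
  \<open>c^k\<close> nonempty when \<open>q\<close> is empty.\<close>

lemma mon_z_power:
  assumes p: "awalk u p w" and q: "awalk u' q w"
  shows "wmon p w q * z ^ Suc (length q) \<approx> 0 \<or>
    (\<exists>r. awalk u r v \<and> wmon p w q * z ^ Suc (length q) \<approx> path r v)"
proof -
  let ?k = "Suc (length q)"
  have ne: "cpow ?k \<noteq> []" using c_ne by simp
  have pC: "wd (map Edge p) \<in> C" by (rule edges_C[OF p])
  have "wmon p w q * z ^ ?k \<approx> wmon p w q * path (cpow ?k) v"
    unfolding z_power by (intro eqv_left wmon_C[OF p q] edges_path[OF awalk_cpow ne])
  then have 1: "wmon p w q * z ^ ?k \<approx> wd (map Edge p) * (gpath w q * path (cpow ?k) v)"
    by (simp only: wmon_def mult.assoc)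
  show ?thesis
  proof (cases "u' = v \<and> (\<exists>r. cpow ?k = q @ r)")
    case True
    then obtain r where r: "cpow ?k = q @ r" and u': "u' = v" by blast
    have wr: "awalk w r v" using awalk_append_cancel[OF q[unfolded u']] awalk_cpow[of ?k] unfolding r by simp
    have "gpath w q * path (cpow ?k) v \<approx> path r v"
      unfolding r by (rule ghost_path_cancel[OF q wr])
    then have "wmon p w q * z ^ ?k \<approx> path (p @ r) v"
      using eqv_trans[OF 1 eqv_left[OF pC]] by (simp only: path_append)
    moreover have "awalk u (p @ r) v" using awalk_append_cancel[OF p] wr by blast
    ultimately show ?thesis by blast
  next
    case False
    have "length q \<le> length (cpow ?k)" using length_cpow_ge[of ?k] by linarith
    then have "gpath w q * path (cpow ?k) v \<approx> 0"
      using False by (intro ghost_path_zero[OF q awalk_cpow])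
    then show ?thesis using eqv_trans[OF 1 eqv_left_zero[OF pC]] by blast
  qed
qed

text \<open>The preimage in the free algebra of the left ideal generated by
  \<open>(c - 1)^n\<close>.\<close>

definition J :: "nat \<Rightarrow> ('a, 'b, 'k) lpa_free set" where
  "J n = {f \<in> C. \<exists>r\<in>C. f \<approx> r * A ^ n}"

lemma J_C: "f \<in> J n \<Longrightarrow> f \<in> C" by (simp add: J_def)

lemma J_mult_A: "r \<in> C \<Longrightarrow> r * A ^ n \<in> J n"
  unfolding J_def using eqv_refl free_algebra_closed(4)[OF _ C_power[OF A_C]] by blast

lemma J_I: "f \<approx> 0 \<Longrightarrow> f \<in> J n"
  unfolding J_def using eqv_C[of f 0] by (auto intro!: bexI[of _ 0])

lemma J_zero [simp]: "0 \<in> J n" by (rule J_I) simp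

lemma J_add: "\<lbrakk>f \<in> J n; g \<in> J n\<rbrakk> \<Longrightarrow> f + g \<in> J n"
proof -
  assume f: "f \<in> J n" and g: "g \<in> J n"
  then obtain r s where "r \<in> C" "f \<approx> r * A ^ n" "s \<in> C" "g \<approx> s * A ^ n" unfolding J_def by blast
  then have "f + g \<approx> (r + s) * A ^ n" "r + s \<in> C" using eqv_add by (auto simp: distrib_right)
  then show ?thesis using f g unfolding J_def by blast
qed

lemma J_left: "\<lbrakk>h \<in> C; f \<in> J n\<rbrakk> \<Longrightarrow> h * f \<in> J n"
proof -
  assume h: "h \<in> C" and f: "f \<in> J n"
  then obtain r where "r \<in> C" "f \<approx> r * A ^ n" unfolding J_def by blast
  then have "h * f \<approx> (h * r) * A ^ n" "h * r \<in> C" using eqv_left[OF h] h by (auto simp: mult.assoc)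
  moreover have "h * f \<in> C" using h J_C[OF f] by auto
  ultimately show ?thesis unfolding J_def by blast
qed

lemma J_minus: "f \<in> J n \<Longrightarrow> - f \<in> J n"
  using J_left[of "- 1" f n] C_intros(5)[OF C_intros(2)] by simp

text \<open>An element commuting with \<open>A\<close> can be moved past \<open>A^n\<close>, which a
  left ideal does not permit for general factors.\<close>

lemma J_right:
  assumes h: "h \<in> C" and comm: "h * A = A * h" and f: "f \<in> J n"
  shows "f * h \<in> J n"
proof -
  obtain r where r: "r \<in> C" "f \<approx> r * A ^ n" using f unfolding J_def by blast
  have "A ^ n * h = h * A ^ n" using comm by (metis power_commuting_commutes)
  then have "f * h \<approx> (r * h) * A ^ n" using eqv_right[OF h r(2)] by (simp add: mult.assoc)
  moreover have "f * h \<in> C" "r * h \<in> C" using h r(1) J_C[OF f] by auto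
  ultimately show ?thesis unfolding J_def by blast
qed

lemma J_le: "\<lbrakk>f \<in> J n; m \<le> n\<rbrakk> \<Longrightarrow> f \<in> J m"
proof -
  assume f: "f \<in> J n" and mn: "m \<le> n"
  then obtain r where r: "r \<in> C" "f \<approx> r * A ^ n" unfolding J_def by blast
  have "A ^ n = A ^ (n - m) * A ^ m" using mn by (simp flip: power_add)
  then have "f \<approx> (r * A ^ (n - m)) * A ^ m" using r by (simp add: mult.assoc)
  moreover have "r * A ^ (n - m) \<in> C" using r by auto
  ultimately show ?thesis using J_C[OF f] unfolding J_def by blast
qed

definition cong :: "nat \<Rightarrow> ('a, 'b, 'k) lpa_free \<Rightarrow> ('a, 'b, 'k) lpa_free \<Rightarrow> bool" where
  "cong n f g \<longleftrightarrow> f - g \<in> J n"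

lemma cong_eqv: "f \<approx> g \<Longrightarrow> cong n f g"
  unfolding cong_def by (intro J_I) (simp add: eqv_def)

lemma cong_refl [simp]: "cong n f f" by (simp add: cong_def)

lemma cong_sym: "cong n f g \<Longrightarrow> cong n g f"
  using J_minus[of "f - g" n] by (simp add: cong_def)

lemma cong_trans [trans]: "\<lbrakk>cong n f g; cong n g h\<rbrakk> \<Longrightarrow> cong n f h"
  using J_add[of "f - g" n "g - h"] by (simp add: cong_def)

lemma cong_add: "\<lbrakk>cong n f g; cong n f' g'\<rbrakk> \<Longrightarrow> cong n (f + f') (g + g')"
  using J_add[of "f - g" n "f' - g'"] by (simp add: cong_def algebra_simps)

lemma cong_sum: "(\<And>i. i \<in> S \<Longrightarrow> cong n (f i) (g i)) \<Longrightarrow> cong n (sum f S) (sum g S)"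
  by (induction S rule: infinite_finite_induct) (auto intro: cong_add)

lemma cong_left: "\<lbrakk>h \<in> C; cong n f g\<rbrakk> \<Longrightarrow> cong n (h * f) (h * g)"
  using J_left[of h "f - g" n] by (simp add: cong_def algebra_simps)

lemma cong_right: "\<lbrakk>h \<in> C; h * A = A * h; cong n f g\<rbrakk> \<Longrightarrow> cong n (f * h) (g * h)"
  using J_right[of h "f - g" n] by (simp add: cong_def algebra_simps)

text \<open>\<open>apol h k\<close>: the element \<open>h\<close> is a polynomial in \<open>A\<close> with constant term \<open>k\<close>, except that its
  remaining coefficients may be arbitrary elements commuting with \<open>A\<close>.\<close>

definition apol :: "('a, 'b, 'k) lpa_free \<Rightarrow> 'k \<Rightarrow> bool" where
  "apol h k \<longleftrightarrow> (\<exists>s\<in>C. s * A = A * s \<and> h = scal k + s * A)"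

lemma apolD: "apol h k \<Longrightarrow> h \<in> C" "apol h k \<Longrightarrow> h * A = A * h"
  unfolding apol_def by (auto simp: distrib_left distrib_right scalar_mult_commute mult.assoc)

lemma apol_scal: "apol (scal k) k"
  unfolding apol_def by (intro bexI[of _ 0]) auto

lemma apol_zero: "apol 0 0" using apol_scal[of 0] by simp

lemma apol_one: "apol 1 1" using apol_scal[of 1] by simp

lemma apol_A: "apol A 0"
  unfolding apol_def by (intro bexI[of _ 1]) auto

lemma apol_add: "\<lbrakk>apol f k; apol g l\<rbrakk> \<Longrightarrow> apol (f + g) (k + l)"
proof -
  assume "apol f k" "apol g l"
  then obtain s t where "s \<in> C" "s * A = A * s" "f = scal k + s * A" "t \<in> C" "t * A = A * t" "g = scal l + t * A"
    unfolding apol_def by blast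
  then show ?thesis unfolding apol_def
    by (intro bexI[of _ "s + t"]) (auto simp: single_add distrib_left distrib_right)
qed

text \<open>With \<open>g = l + t A\<close> commuting with \<open>A\<close>, the product is
  \<open>k l + (k t + s g) A\<close>, and the new factor of \<open>A\<close> again commutes with
  \<open>A\<close>.\<close>

lemma apol_mult: "\<lbrakk>apol f k; apol g l\<rbrakk> \<Longrightarrow> apol (f * g) (k * l)"
proof -
  assume f: "apol f k" and g: "apol g l"
  then obtain s t where st: "s \<in> C" "s * A = A * s" "f = scal k + s * A" "t \<in> C" "t * A = A * t" "g = scal l + t * A"
    unfolding apol_def by blast
  have gA: "g * A = A * g" "g \<in> C" using apolD[OF g] by auto
  have sA: "scal k * A = A * scal k" by (rule scalar_mult_commute)
  have comm: "(scal k * t + s * g) * A = A * (scal k * t + s * g)"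
  proof -
    have "scal k * t * A = scal k * A * t" by (simp only: mult.assoc st(5))
    also have "\<dots> = A * (scal k * t)" by (simp only: sA mult.assoc)
    finally have 1: "scal k * t * A = A * (scal k * t)" .
    have "s * g * A = s * A * g" by (simp only: mult.assoc gA(1))
    also have "\<dots> = A * (s * g)" by (simp only: st(2) mult.assoc)
    finally show ?thesis using 1 by (simp only: distrib_left distrib_right)
  qed
  have "f * g = scal k * g + s * (A * g)" by (simp add: st(3) distrib_right mult.assoc)
  also have "\<dots> = scal k * scal l + (scal k * t + s * g) * A"
    unfolding gA(1)[symmetric] by (simp add: st(6) distrib_right distrib_left mult.assoc)
  also have "scal k * scal l = scal (k * l)" by (simp add: mult_single)
  finally show ?thesis unfolding apol_def using comm st gA(2) by (intro bexI[of _ "scal k * t + s * g"]) auto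
qed

lemma apol_power: "apol f 1 \<Longrightarrow> apol (f ^ n) 1"
  using apol_mult[of f 1] by (induction n) (auto intro: apol_one)

lemma apol_z: "apol z 1"
  using apol_add[OF apol_one apol_A] by (simp add: A_def)

text \<open>The truncated geometric series for \<open>1 / (1 + A)\<close>: a right inverse of
  \<open>z\<close> modulo \<open>J n\<close>.\<close>

definition zinv :: "nat \<Rightarrow> ('a, 'b, 'k) lpa_free" where
  "zinv n = (\<Sum>i<n. (- A) ^ i)"

lemma z_zinv: "z * zinv n = 1 - (- A) ^ n"
proof (induction n)
  case (Suc n)
  have "z * zinv (Suc n) = z * zinv n + z * (- A) ^ n" by (simp add: zinv_def distrib_left)
  also have "\<dots> = 1 - (- A) ^ n + (1 + A) * (- A) ^ n" using Suc by (simp add: A_def)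
  finally show ?case by (simp add: distrib_right)
qed (simp add: zinv_def)

text \<open>\<open>zinv 0\<close> is an empty sum with constant term \<open>0\<close>; hence the
  successor here and the condition \<open>1 \<le> n\<close> below.\<close>

lemma apol_zinv: "apol (zinv (Suc n)) 1"
proof (induction n)
  case (Suc n)
  have "apol (- A) 0" using apol_mult[OF apol_scal[of "- 1"] apol_A] by (simp add: single_uminus)
  then have "apol ((- A) * (- A) ^ n) 0"
  proof (induction n)
    case (Suc n)
    show ?case using apol_mult[OF Suc.prems Suc.IH[OF Suc.prems]] by simp
  qed simp
  from apol_add[OF Suc.IH this] have "apol (zinv (Suc n) + (- A) * (- A) ^ n) 1"
    by (simp only: add_0_right)
  also have "zinv (Suc n) + (- A) * (- A) ^ n = zinv (Suc (Suc n))" by (simp add: zinv_def)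
  finally show ?case .
qed (simp add: zinv_def apol_one)

lemma cong_z_zinv:
  assumes f: "f \<in> C" shows "cong n f (f * (z * zinv n))"
proof -
  have "f - f * (z * zinv n) = f * (- A) ^ n" by (simp add: z_zinv right_diff_distrib)
  also have "\<dots> = (f * (- 1) ^ n) * A ^ n" by (simp only: power_minus[of A] mult.assoc)
  finally show ?thesis unfolding cong_def using f C_intros(5)[OF C_intros(2)] by (auto intro!: J_mult_A C_intros)
qed

text \<open>In each step \<open>z * zinv n\<close> is appended on the right, and its
  \<open>z\<close> is moved to the left through the powers of \<open>zinv n\<close>, with which it
  commutes.\<close>

lemma cong_z_zinv_power:
  assumes f: "f \<in> C" and n: "1 \<le> n" shows "cong n f (f * z ^ k * zinv n ^ k)"
proof (induction k)
  case (Suc k)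
  obtain n' where n': "n = Suc n'" using n by (cases n) auto
  have u: "zinv n \<in> C" "zinv n * A = A * zinv n" using apolD[OF apol_zinv] n' by auto
  then have "z * zinv n = zinv n * z" by (simp add: A_def algebra_simps)
  then have comm: "z * zinv n ^ k = zinv n ^ k * z" by (metis power_commuting_commutes)
  have "cong n (f * z ^ k * zinv n ^ k) (f * z ^ k * zinv n ^ k * (z * zinv n))"
    using f u by (intro cong_z_zinv C_intros z_C)
  also have "f * z ^ k * zinv n ^ k * (z * zinv n) = f * z ^ k * (zinv n ^ k * z) * zinv n"
    by (simp only: mult.assoc)
  also have "\<dots> = f * z ^ Suc k * zinv n ^ Suc k"
    unfolding comm[symmetric] by (simp only: mult.assoc power_Suc2)
  finally show ?case using Suc.IH cong_trans by blast
qed simp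

definition B :: "'b stream \<Rightarrow> ('a, 'b, 'k) lpa_free" where
  "B q = path (rep q) v"

lemma B_C: "q \<in> tail_class G cinf \<Longrightarrow> B q \<in> C"
  unfolding B_def using rep path_C by metis

text \<open>If \<open>p\<close> is longer than the chosen representative by \<open>c^j\<close>, the
  coefficient is \<open>z^j\<close>; if it is shorter by \<open>c^j\<close>, the coefficient is the
  \<open>j\<close>-th power of \<open>zinv n\<close>.\<close>

lemma path_cong_B:
  assumes p: "awalk u p v" and n: "1 \<le> n"
  obtains g where "apol g 1" "cong n (path p v) (B (p @- cinf) * g)"
proof -
  let ?q = "p @- cinf"
  obtain n' where n': "n = Suc n'" using n by (cases n) auto
  have q: "?q \<in> tail_class G cinf" by (rule path_tail_class[OF p])
  obtain u' where r: "awalk u' (rep ?q) v" "p @- cinf = rep ?q @- cinf" using rep[OF q] by blast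
  show thesis
    using r(2)
  proof (rule same_limit)
    fix j assume j: "p = rep ?q @ cpow j"
    have "path p v \<approx> B ?q * z ^ j"
      unfolding B_def using eqv_sym[OF path_z_power[OF r(1), of j]] j by simp
    then show thesis by (rule that[OF apol_power[OF apol_z] cong_eqv])
  next
    fix j assume j: "rep ?q = p @ cpow j"
    have "cong n (path p v) (path p v * z ^ j * zinv n ^ j)"
      by (rule cong_z_zinv_power[OF path_C[OF p] n])
    also have "cong n \<dots> (B ?q * zinv n ^ j)"
    proof (intro cong_right cong_eqv)
      show "path p v * z ^ j \<approx> B ?q" unfolding B_def using path_z_power[OF p, of j] j by simp
    qed (use apolD[OF apol_power[OF apol_zinv]] n' in auto)
    finally show thesis using n' by (intro that[OF apol_power[OF apol_zinv]]) auto
  qed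
qed

theorem normal_form:
  assumes n: "1 \<le> n" and f: "f \<in> C"
  obtains S h k where "finite S" "S \<subseteq> tail_class G cinf" "\<And>q. apol (h q) (k q)"
    "cong n f (\<Sum>q\<in>S. B q * h q)"
proof -
  obtain n' where n': "n = Suc n'" using n by (cases n) auto
  \<comment> \<open>The clause \<open>h q = 0\<close> outside \<open>S\<close> allows two such sums
    to be merged over the union of their index sets.\<close>
  let ?P = "\<lambda>f S h k. finite S \<and> S \<subseteq> tail_class G cinf \<and> (\<forall>q. apol (h q) (k q)) \<and>
    (\<forall>q. q \<notin> S \<longrightarrow> h q = 0) \<and> cong n f (\<Sum>q\<in>S. B q * h q)"
  from f have "\<exists>S h k. ?P f S h k"
  proof (induction f rule: C_induct)
    case (eqv f g)
    then show ?case using cong_trans[OF cong_eqv] by blast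
  next
    case zero
    have "?P 0 {} (\<lambda>_. 0) (\<lambda>_. 0)" by (simp add: apol_zero)
    then show ?case by (intro exI)
  next
    case (add f g)
    from add(3) obtain S h k where 1: "?P f S h k" by (elim exE)
    from add(4) obtain S' h' k' where 2: "?P g S' h' k'" by (elim exE)
    have "(\<Sum>q\<in>S. B q * h q) = (\<Sum>q\<in>S \<union> S'. B q * h q)" "(\<Sum>q\<in>S'. B q * h' q) = (\<Sum>q\<in>S \<union> S'. B q * h' q)"
      using 1 2 by (intro sum.mono_neutral_left; auto)+
    then have "(\<Sum>q\<in>S. B q * h q) + (\<Sum>q\<in>S'. B q * h' q) = (\<Sum>q\<in>S \<union> S'. B q * (h q + h' q))"
      by (simp add: distrib_left sum.distrib)
    then have "cong n (f + g) (\<Sum>q\<in>S \<union> S'. B q * (h q + h' q))"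
      using 1 2 cong_add[of n f "\<Sum>q\<in>S. B q * h q" g "\<Sum>q\<in>S'. B q * h' q"] by simp
    then have "?P (f + g) (S \<union> S') (\<lambda>q. h q + h' q) (\<lambda>q. k q + k' q)"
      using 1 2 by (simp add: apol_add)
    then show ?case by (intro exI)
  next
    case (scalar a f)
    from scalar(2) obtain S h k where 1: "?P f S h k" by (elim exE)
    \<comment> \<open>Scalars are central and can be moved past \<open>B q\<close> into the
      coefficient.\<close>
    have "B q * (scal a * h q) = scal a * (B q * h q)" for q
      using scalar_mult_commute[of a "B q"] by (simp only: mult.assoc[symmetric])
    then have "(\<Sum>q\<in>S. B q * (scal a * h q)) = scal a * (\<Sum>q\<in>S. B q * h q)"
      by (simp only: sum_distrib_left)
    moreover have "cong n (scal a * f) (scal a * (\<Sum>q\<in>S. B q * h q))"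
      using 1 by (intro cong_left C_intros) simp
    ultimately have "?P (scal a * f) S (\<lambda>q. scal a * h q) (\<lambda>q. a * k q)"
      using 1 by (simp add: apol_mult apol_scal)
    then show ?case by (intro exI)
  next
    case (wmon u p w u' q)
    let ?M = "wmon p w q" and ?l = "Suc (length q)"
    have M: "?M \<in> C" by (rule wmon_C[OF wmon])
    have u: "zinv n ^ ?l \<in> C" "zinv n ^ ?l * A = A * zinv n ^ ?l" "apol (zinv n ^ ?l) 1"
      unfolding n' by (rule apolD[OF apol_power[OF apol_zinv]] apol_power[OF apol_zinv])+
    \<comment> \<open>A power of \<open>z\<close> is inserted to consume the ghost part of the
      monomial, together with the compensating power of \<open>zinv n\<close>, which ends up in the
      coefficient.\<close>
    have 1: "cong n ?M (?M * z ^ ?l * zinv n ^ ?l)" by (rule cong_z_zinv_power[OF M n])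
    from mon_z_power[OF wmon] show ?case
    proof
      assume "?M * z ^ ?l \<approx> 0"
      then have "cong n (?M * z ^ ?l * zinv n ^ ?l) 0" by (rule cong_eqv[OF eqv_right_zero[OF u(1)]])
      then have "cong n ?M 0" by (rule cong_trans[OF 1])
      then have "?P ?M {} (\<lambda>_. 0) (\<lambda>_. 0)" by (simp add: apol_zero)
      then show ?thesis by (intro exI)
    next
      assume "\<exists>r. awalk u r v \<and> ?M * z ^ ?l \<approx> path r v"
      then obtain r where r: "awalk u r v" "?M * z ^ ?l \<approx> path r v" by blast
      obtain g where g: "apol g 1" "cong n (path r v) (B (r @- cinf) * g)"
        using path_cong_B[OF r(1) n] by blast
      let ?q = "r @- cinf" and ?g = "g * zinv n ^ ?l"
      have "cong n ?M (path r v * zinv n ^ ?l)"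
        by (rule cong_trans[OF 1 cong_right[OF u(1,2) cong_eqv[OF r(2)]]])
      also have "cong n \<dots> (B ?q * g * zinv n ^ ?l)"
        by (rule cong_right[OF u(1,2) g(2)])
      finally have "cong n ?M (B ?q * ?g)" by (simp only: mult.assoc)
      moreover have "apol ?g 1" using apol_mult[OF g(1) u(3)] by simp
      ultimately have "?P ?M {?q} (\<lambda>q. if q = ?q then ?g else 0) (\<lambda>q. if q = ?q then 1 else 0)"
        using path_tail_class[OF r(1)] by (simp add: apol_zero)
      then show ?thesis by (intro exI)
    qed
  qed
  then obtain S h k where "?P f S h k" by (elim exE)
  then show thesis by (intro that[of S h k]) simp_all
qed

end

section \<open>The Chen module as a quotient\<close>

context lpa_cycle
begin

abbreviation x0 :: "'b stream \<Rightarrow>\<^sub>0 'k" where "x0 \<equiv> Poly_Mapping.single cinf 1"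

lemma cinf_tail_class: "cinf \<in> tail_class G cinf"
  using path_tail_class[OF awalk_v_Nil] by simp

lemma act_eqv:
  assumes "f \<approx> g" and "Poly_Mapping.keys x \<subseteq> tail_class G cinf"
  shows "free_act G f x = free_act G g x"
  using free_act_ideal[of "f - g" x cinf] assms by (simp add: eqv_def free_act_diff_left)

lemma act_z: "free_act G z (Poly_Mapping.single cinf m) = Poly_Mapping.single cinf m"
proof -
  have "z \<approx> path c v" unfolding z_def by (rule edges_path[OF awalk_c c_ne])
  then have "free_act G z (Poly_Mapping.single cinf m) = free_act G (path c v) (Poly_Mapping.single cinf m)"
    using cinf_tail_class by (intro act_eqv) auto
  also have "\<dots> = Poly_Mapping.single (c @- cinf) m" by (rule act_path[OF awalk_c])
  also have "c @- cinf = cinf" using cpow_cinf[of 1] by simp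
  finally show ?thesis .
qed

lemma act_A: "free_act G A (Poly_Mapping.single cinf m) = 0"
  by (simp add: A_def free_act_diff_left act_z)

lemma act_J1:
  assumes "f \<in> J 1" shows "free_act G f x0 = 0"
proof -
  obtain r where r: "r \<in> C" "f \<approx> r * A ^ 1" using assms unfolding J_def by blast
  have "free_act G f x0 = free_act G (r * A ^ 1) x0"
    using cinf_tail_class by (intro act_eqv r) simp
  then show ?thesis by (simp add: free_act_mult act_A)
qed

text \<open>Since \<open>A\<close> kills \<open>c^\<infinity>\<close>, only the constant term of the
  coefficient acts, and \<open>B q\<close> then carries \<open>c^\<infinity>\<close> to
  \<open>q\<close>.\<close>

lemma act_B:
  assumes q: "q \<in> tail_class G cinf" and h: "apol h k"
  shows "free_act G (B q * h) x0 = Poly_Mapping.single q k"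
proof -
  obtain s where s: "h = scal k + s * A" using h unfolding apol_def by blast
  obtain u where u: "awalk u (rep q) v" "q = rep q @- cinf" using rep[OF q] .
  have "free_act G h x0 = Poly_Mapping.single cinf k"
    by (simp add: s free_act_add_left free_act_mult act_A free_act_scalar)
  then have "free_act G (B q * h) x0 = Poly_Mapping.single (rep q @- cinf) k"
    by (simp add: free_act_mult B_def act_path[OF u(1)])
  then show ?thesis using u(2) by simp
qed

text \<open>Acting with the normal form modulo \<open>J 1\<close> gives the combination of the paths
  \<open>q\<close> with coefficients \<open>k q\<close>. These paths are distinct basis elements, so
  all constant terms vanish and each summand is a left multiple of \<open>A\<close>.\<close>

lemma annihilator:
  assumes f: "f \<in> C" and act: "free_act G f x0 = 0"
  shows "f \<in> J 1"
proof -
  obtain S h k where S: "finite S" "S \<subseteq> tail_class G cinf" and h: "\<And>q. apol (h q) (k q)"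
    and fS: "cong 1 f (\<Sum>q\<in>S. B q * h q)"
    using normal_form[OF le_refl f] by blast
  have "free_act G (f - (\<Sum>q\<in>S. B q * h q)) x0 = 0" using fS unfolding cong_def by (rule act_J1)
  then have "(\<Sum>q\<in>S. free_act G (B q * h q) x0) = 0"
    using act by (simp add: free_act_diff_left free_act_sum_left)
  moreover have "(\<Sum>q\<in>S. free_act G (B q * h q) x0) = (\<Sum>q\<in>S. Poly_Mapping.single q (k q))"
    using S(2) h by (intro sum.cong refl act_B) blast+
  ultimately have sum0: "(\<Sum>q\<in>S. Poly_Mapping.single q (k q)) = 0" by simp
  have k0: "k q = 0" if "q \<in> S" for q
  proof -
    have "Poly_Mapping.lookup (\<Sum>q\<in>S. Poly_Mapping.single q (k q)) q = k q"
      using S(1) that by (simp add: lookup_sum lookup_single when_def)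
    then show ?thesis using sum0 by simp
  qed
  have "cong 1 (\<Sum>q\<in>S. B q * h q) (\<Sum>q\<in>S. 0)"
  proof (rule cong_sum)
    fix q assume q: "q \<in> S"
    obtain s where s: "s \<in> C" "h q = scal (k q) + s * A" using h[of q] unfolding apol_def by blast
    have "B q * h q = (B q * s) * A ^ 1" using k0[OF q] by (simp add: s(2) mult.assoc)
    moreover have "B q * s \<in> C" using B_C q S(2) s(1) by (intro free_algebra_closed(4)) auto
    ultimately show "cong 1 (B q * h q) 0" unfolding cong_def using J_mult_A[of "B q * s" 1] by simp
  qed
  then have "cong 1 f 0" using cong_trans[OF fS] by simp
  then show ?thesis by (simp add: cong_def)
qed

lemma J1_iff: "f \<in> C \<Longrightarrow> f \<in> J 1 \<longleftrightarrow> free_act G f x0 = 0"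
  using annihilator act_J1 by blast

lemma one_notin_J1: "1 \<notin> J 1"
proof
  assume "1 \<in> J 1"
  then have "x0 = 0" using act_J1 by fastforce
  then have "Poly_Mapping.lookup x0 cinf = 0" by simp
  then show False by simp
qed

lemma act_surj:
  assumes "Poly_Mapping.keys x \<subseteq> tail_class G cinf"
  obtains f where "f \<in> C" "free_act G f x0 = x"
proof -
  from assms have "\<exists>f\<in>C. free_act G f x0 = x"
  proof (induction x rule: poly_mapping_induct_on)
    case zero
    then show ?case by (intro bexI[of _ 0]) auto
  next
    case (single q m)
    have "free_act G (B q * scal m) x0 = Poly_Mapping.single q m" by (rule act_B[OF single apol_scal])
    then show ?case using B_C[OF single] by (intro bexI[of _ "B q * scal m"]) auto
  next
    case (add x y)
    then obtain f g where "f \<in> C" "free_act G f x0 = x" "g \<in> C" "free_act G g x0 = y" by blast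
    then show ?case by (intro bexI[of _ "f + g"]) (auto simp: free_act_add_left)
  qed
  then show thesis using that by blast
qed

text \<open>Since \<open>(s A)\<^sup>n\<close> lies in \<open>N\<close>, multiplying \<open>t = k + s A\<close> by \<open>(s A)\<^sup>j\<close> shows by descending
  induction on \<open>j\<close> that all \<open>(s A)\<^sup>j\<close> lie in \<open>N\<close>.\<close>

lemma unit_mod_power:
  assumes add: "\<And>f g. \<lbrakk>f \<in> N; g \<in> N\<rbrakk> \<Longrightarrow> f + g \<in> N"
    and left: "\<And>h f. \<lbrakk>h \<in> C; f \<in> N\<rbrakk> \<Longrightarrow> h * f \<in> N"
    and An: "A ^ n \<in> N" and t: "apol t k" "k \<noteq> 0" "t \<in> N"
  shows "1 \<in> N"
proof -
  obtain s where s: "s \<in> C" "s * A = A * s" "t = scal k + s * A" using t(1) unfolding apol_def by blast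
  define y where "y = s * A"
  have yC: "y \<in> C" using s by (auto simp: y_def)
  \<comment> \<open>Because \<open>s\<close> commutes with \<open>A\<close>, the powers separate,
    and \<open>y^n\<close> is a left multiple of \<open>A^n\<close>.\<close>
  have pow: "y ^ j = s ^ j * A ^ j" for j
  proof (induction j)
    case (Suc j)
    have As: "A * s ^ j = s ^ j * A" using s(2) by (rule power_commuting_commutes[symmetric])
    have "y ^ Suc j = s * (A * s ^ j) * A ^ j" using Suc by (simp add: y_def mult.assoc)
    also have "\<dots> = s ^ Suc j * A ^ Suc j" unfolding As by (simp add: mult.assoc)
    finally show ?case .
  qed simp
  have "y ^ (n - j) \<in> N" if "j \<le> n" for j
    using that
  proof (induction j)
    case 0
    then show ?case using pow left[OF _ An] s(1) by auto
  next
    case (Suc j)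
    let ?y = "y ^ (n - Suc j)"
    have y: "?y * y \<in> N"
      using Suc by (simp add: Suc_diff_Suc flip: power_Suc2)
    have "?y * t \<in> N" using yC t(3) by (intro left) auto
    moreover have "- 1 * (?y * y) \<in> N" by (rule left[OF C_intros(5)[OF C_intros(2)] y])
    ultimately have "?y * t + - 1 * (?y * y) \<in> N" by (rule add)
    moreover have "?y * t + - 1 * (?y * y) = scal k * ?y"
      unfolding s(3) y_def[symmetric] scalar_mult_commute by (simp add: distrib_left)
    ultimately have "scal k * ?y \<in> N" by (simp only:)
    then have "scal (1 / k) * (scal k * ?y) \<in> N" by (rule left[OF scalar_closed])
    moreover have "scal (1 / k) * scal k = 1" using t(2) by (simp add: mult_single)
    ultimately show ?case by (simp flip: mult.assoc)
  qed
  from this[of n] show ?thesis by simp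
qed

text \<open>From \<open>v c = c\<close> and the right invertibility of \<open>c\<close> modulo
  \<open>J n\<close>; it lets the vertex left over from a cancelled path be dropped.\<close>

lemma vertex_cong_one: "cong n (wd [Vertex v]) 1"
proof -
  have vC: "wd [Vertex v] \<in> C" by (intro C_intros) simp
  have uC: "zinv n \<in> C" unfolding zinv_def by (intro C_intros) auto
  have "cong n (wd [Vertex v]) (wd [Vertex v] * (z * zinv n))" by (rule cong_z_zinv[OF vC])
  also have "cong n \<dots> (z * zinv n)"
    using eqv_right[OF uC vertex_z] by (intro cong_eqv) (simp add: mult.assoc)
  also have "cong n \<dots> 1" using cong_sym[OF cong_z_zinv[OF C_intros(2), of n]] by simp
  finally show ?thesis .
qed

lemma separate_streams:
  assumes "finite S" obtains L where "\<And>q. \<lbrakk>q \<in> S; q \<noteq> (q0 :: 'b stream)\<rbrakk> \<Longrightarrow> \<exists>i<L. q !! i \<noteq> q0 !! i"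
proof -
  from assms have "\<exists>L. \<forall>q\<in>S. q \<noteq> q0 \<longrightarrow> (\<exists>i<L. q !! i \<noteq> q0 !! i)"
  proof induction
    case (insert q S)
    then obtain L where L: "\<forall>q\<in>S. q \<noteq> q0 \<longrightarrow> (\<exists>i<L. q !! i \<noteq> q0 !! i)" by blast
    obtain j where j: "q \<noteq> q0 \<longrightarrow> q !! j \<noteq> q0 !! j"
      by (metis id_stake_snth_sdrop stream.map_cong stream_smap_nats)
    have "\<forall>r\<in>insert q S. r \<noteq> q0 \<longrightarrow> (\<exists>i<Suc (L + j). r !! i \<noteq> q0 !! i)"
    proof (intro ballI impI)
      fix r assume r: "r \<in> insert q S" "r \<noteq> q0"
      show "\<exists>i<Suc (L + j). r !! i \<noteq> q0 !! i"
      proof (cases "r = q")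
        case True
        then show ?thesis using j r by (intro exI[of _ j]) simp
      next
        case False
        then obtain i where "i < L" "r !! i \<noteq> q0 !! i" using r L by blast
        then show ?thesis by (intro exI[of _ i]) simp
      qed
    qed
    then show ?case by blast
  qed simp
  then show thesis using that by blast
qed

text \<open>Left multiplication by the ghost of a long initial segment of \<open>q0\<close> kills all terms of the
  normal form except the one belonging to \<open>q0\<close>, and turns that one into a polynomial in \<open>A\<close>.\<close>

lemma normal_form_extract:
  assumes n: "1 \<le> n" and S: "finite S" "S \<subseteq> tail_class G cinf" and q0: "q0 \<in> S"
    and h: "\<And>q. apol (h q) (k q)"
  obtains g t where "g \<in> C" "apol t (k q0)" "cong n (g * (\<Sum>q\<in>S. B q * h q)) t"
proof -
  obtain n' where n': "n = Suc n'" using n by (cases n) auto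
  obtain L where L: "\<And>q. \<lbrakk>q \<in> S; q \<noteq> q0\<rbrakk> \<Longrightarrow> \<exists>i<L. q !! i \<noteq> q0 !! i"
    using separate_streams[OF S(1), of q0] by blast
  \<comment> \<open>An initial segment of \<open>q0\<close> that ends at \<open>v\<close> and has
    length at least \<open>L\<close>, so that it distinguishes \<open>q0\<close> from the other
    paths.\<close>
  define P where "P = rep q0 @ cpow L"
  define d where "d = length (rep q0)"
  define g where "g = gpath v P"
  \<comment> \<open>Appending \<open>c^(L+d)\<close> makes every representative at least as long as
    \<open>P\<close>, whose length is that of \<open>c^L\<close> plus \<open>d\<close>; this is the
    length condition of \<open>ghost_path_zero\<close>. For \<open>q0\<close> the surplus is
    \<open>c^d\<close>.\<close>
  let ?m = "L + d"
  have q0t: "q0 \<in> tail_class G cinf" using q0 S(2) by blast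
  obtain u0 where u0: "awalk u0 (rep q0) v" "q0 = rep q0 @- cinf" using rep[OF q0t] .
  have P: "awalk u0 P v" unfolding P_def awalk_append_cancel[OF u0(1)] by (rule awalk_cpow)
  have P0: "q0 = P @- cinf" using u0(2) by (simp add: P_def cpow_cinf)
  have gC: "g \<in> C" unfolding g_def by (rule gpath_C[OF P])
  have LP: "L \<le> length P" using length_cpow_ge[of L] by (simp add: P_def)
  have um: "apol (zinv n ^ ?m) 1" unfolding n' by (rule apol_power[OF apol_zinv])
  define w where "w q = zinv n ^ ?m * h q" for q
  have w: "apol (w q) (k q)" for q using apol_mult[OF um h[of q]] by (simp add: w_def)
  have term_long: "cong n (g * (B q * h q)) (g * path (rep q @ cpow ?m) v * w q)" if q: "q \<in> S" for q
  proof -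
    have qt: "q \<in> tail_class G cinf" using q S(2) by blast
    obtain u where u: "awalk u (rep q) v" "q = rep q @- cinf" using rep[OF qt] .
    have "cong n (B q) (B q * z ^ ?m * zinv n ^ ?m)" by (rule cong_z_zinv_power[OF B_C[OF qt] n])
    also have "cong n \<dots> (path (rep q @ cpow ?m) v * zinv n ^ ?m)"
      unfolding B_def by (rule cong_right[OF apolD[OF um] cong_eqv[OF path_z_power[OF u(1)]]])
    finally have "cong n (B q * h q) (path (rep q @ cpow ?m) v * zinv n ^ ?m * h q)"
      by (rule cong_right[OF apolD[OF h]])
    then have "cong n (g * (B q * h q)) (g * (path (rep q @ cpow ?m) v * zinv n ^ ?m * h q))"
      by (rule cong_left[OF gC])
    then show ?thesis by (simp only: w_def mult.assoc)
  qed
  have zero: "cong n (g * (B q * h q)) 0" if q: "q \<in> S - {q0}" for q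
  proof -
    have qt: "q \<in> tail_class G cinf" using q S(2) by blast
    obtain u where u: "awalk u (rep q) v" "q = rep q @- cinf" using rep[OF qt] .
    let ?Q = "rep q @ cpow ?m"
    have Q: "awalk u ?Q v" unfolding awalk_append_cancel[OF u(1)] by (rule awalk_cpow)
    have "length P \<le> length ?Q"
      using length_cpow_ge[of d] by (simp add: P_def cpow_add d_def)
    moreover have "\<not> (\<exists>r. ?Q = P @ r)"
    proof
      assume "\<exists>r. ?Q = P @ r"
      then obtain r where r: "?Q = P @ r" by blast
      have "q = ?Q @- cinf" using u(2) by (simp only: shift_append cpow_cinf)
      then have "q = P @- (r @- cinf)" unfolding r by simp
      then have "q !! i = q0 !! i" if "i < L" for i
        using that LP shift_snth_less[of i P "r @- cinf"] shift_snth_less[of i P cinf] P0 by (metis order_less_le_trans)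
      then show False using L[of q] q by blast
    qed
    ultimately have "g * path ?Q v \<approx> 0" unfolding g_def using ghost_path_zero[OF P Q] by blast
    then have "cong n (g * path ?Q v * w q) 0"
      by (intro cong_eqv eqv_right_zero[OF apolD(1)[OF w]])
    then show ?thesis using cong_trans[OF term_long] q by blast
  qed
  \<comment> \<open>The ghost path cancels \<open>P\<close> and leaves \<open>c^d\<close> followed
    by the vertex \<open>v\<close>, which counts as \<open>1\<close> modulo
    \<open>J n\<close>.\<close>
  have main: "cong n (g * (B q0 * h q0)) (z ^ d * w q0)"
  proof -
    have "rep q0 @ cpow ?m = P @ cpow d" by (simp add: P_def cpow_add)
    then have "cong n (g * (B q0 * h q0)) (g * path (P @ cpow d) v * w q0)" using term_long[OF q0] by simp
    also have "cong n \<dots> (path (cpow d) v * w q0)"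
      unfolding g_def by (rule cong_right[OF apolD[OF w] cong_eqv[OF ghost_path_cancel[OF P awalk_cpow]]])
    also have "path (cpow d) v = z ^ d * wd [Vertex v]"
      by (simp add: path_def word_elt_append z_power)
    also have "cong n (z ^ d * wd [Vertex v] * w q0) (z ^ d * 1 * w q0)"
      by (intro cong_right[OF apolD[OF w]] cong_left[OF C_power[OF z_C]] vertex_cong_one)
    finally show ?thesis by simp
  qed
  have "g * (\<Sum>q\<in>S. B q * h q) = g * (B q0 * h q0) + (\<Sum>q\<in>S - {q0}. g * (B q * h q))"
    using sum.remove[OF S(1) q0, of "\<lambda>q. B q * h q"] by (simp add: distrib_left sum_distrib_left)
  moreover have "cong n (\<Sum>q\<in>S - {q0}. g * (B q * h q)) (\<Sum>q\<in>S - {q0}. 0)"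
    by (rule cong_sum[OF zero])
  ultimately have "cong n (g * (\<Sum>q\<in>S. B q * h q)) (z ^ d * w q0)"
    using cong_add[OF main, of "\<Sum>q\<in>S - {q0}. g * (B q * h q)" 0] by simp
  moreover have "apol (z ^ d * w q0) (k q0)"
    using apol_mult[OF apol_power[OF apol_z] w[of q0], of d] by simp
  ultimately show thesis using that gC by blast
qed

text \<open>\<open>N\<close> stands for the preimage of a left ideal. It contains
  \<open>J n\<close>, so with \<open>f\<close> it also contains the element \<open>t\<close>
  congruent to \<open>g f\<close>, whose nonzero constant term makes \<open>unit_mod_power\<close>
  applicable.\<close>

theorem local_modulo_power:
  assumes NC: "N \<subseteq> C" and add: "\<And>f g. \<lbrakk>f \<in> N; g \<in> N\<rbrakk> \<Longrightarrow> f + g \<in> N"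
    and left: "\<And>h f. \<lbrakk>h \<in> C; f \<in> N\<rbrakk> \<Longrightarrow> h * f \<in> N" and ideal: "\<And>f. f \<approx> 0 \<Longrightarrow> f \<in> N"
    and An: "A ^ n \<in> N" and f: "f \<in> N" "f \<notin> J 1"
  shows "1 \<in> N"
proof (cases "n = 0")
  case True
  then show ?thesis using An by simp
next
  case False
  then have n: "1 \<le> n" by simp
  have JN: "r \<in> N" if r: "r \<in> J n" for r
  proof -
    obtain s where s: "s \<in> C" "r \<approx> s * A ^ n" using r unfolding J_def by blast
    then have "r - s * A ^ n \<in> N" by (intro ideal) (simp add: eqv_def)
    then have "(r - s * A ^ n) + s * A ^ n \<in> N" by (rule add[OF _ left[OF s(1) An]])
    then show ?thesis by simp
  qed
  have fC: "f \<in> C" using f NC by blast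
  obtain S h k where S: "finite S" "S \<subseteq> tail_class G cinf" and h: "\<And>q. apol (h q) (k q)"
    and fS: "cong n f (\<Sum>q\<in>S. B q * h q)"
    using normal_form[OF n fC] by blast
  \<comment> \<open>If all constant terms vanished, the normal form would annihilate
    \<open>c^\<infinity>\<close>, and so would \<open>f\<close>, because
    \<open>J n \<subseteq> J 1\<close>; then \<open>f\<close> would lie in
    \<open>J 1\<close>.\<close>
  have "\<exists>q0\<in>S. k q0 \<noteq> 0"
  proof (rule ccontr)
    assume "\<not> (\<exists>q0\<in>S. k q0 \<noteq> 0)"
    then have "free_act G (B q * h q) x0 = 0" if "q \<in> S" for q
      using act_B[OF _ h[of q]] that S(2) by auto
    then have "free_act G (\<Sum>q\<in>S. B q * h q) x0 = 0" by (simp add: free_act_sum_left)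
    moreover have "f - (\<Sum>q\<in>S. B q * h q) \<in> J 1" using fS n unfolding cong_def by (rule J_le)
    ultimately have "free_act G f x0 = 0" using act_J1 by (fastforce simp: free_act_diff_left)
    then show False using f(2) annihilator[OF fC] by blast
  qed
  then obtain q0 where q0: "q0 \<in> S" "k q0 \<noteq> 0" by blast
  obtain g t where g: "g \<in> C" "apol t (k q0)" "cong n (g * (\<Sum>q\<in>S. B q * h q)) t"
    using normal_form_extract[OF n S q0(1) h] .
  have "cong n t (g * f)"
    using cong_trans[OF cong_left[OF g(1) fS] g(3)] by (rule cong_sym)
  then have "t - g * f \<in> N" unfolding cong_def by (rule JN)
  then have "(t - g * f) + g * f \<in> N" by (rule add[OF _ left[OF g(1) f(1)]])
  then have "t \<in> N" by simp
  then show ?thesis using unit_mod_power[OF add left An g(2) q0(2)] by blast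
qed

end

section \<open>The quotients by powers of \<open>c - 1\<close>\<close>

lemma (in power_chain) composition_factor_isomorphic:
  assumes V: "left_module R V" and f: "f \<in> left_module_hom R (regular_module R) V"
    and surj: "f ` carrier R = carrier V"
    and ker: "\<And>x. x \<in> carrier R \<Longrightarrow> f x = \<zero>\<^bsub>V\<^esub> \<longleftrightarrow> x \<in> PIdl a"
    and Ns: "composition_series R (power_quot R a n) Ns" and i: "Suc i < length Ns"
  shows "left_module_isomorphic R (chain_factor (power_quot R a n) Ns i) V"
proof -
  have eq: "Ns = map (\<lambda>i. W n (n - i)) [0..<Suc n]"
    using Ns by (simp only: composition_series_power_quot)
  then have "Suc i \<le> n" using i by simp
  then have "Ns ! i = W n (Suc (n - Suc i))" "Ns ! Suc i = W n (n - Suc i)"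
    unfolding eq by (simp_all add: Suc_diff_Suc del: upt_Suc)
  then show ?thesis
    unfolding chain_factor_def using chain_factor_power_quot[OF V f surj ker, of "n - Suc i" n] \<open>Suc i \<le> n\<close> by simp
qed

context lpa_cycle
begin

abbreviation L :: "('a, 'b, 'k) lpa ring" where "L \<equiv> leavitt_path_algebra G"

abbreviation V :: "(('a, 'b, 'k) lpa, 'b stream \<Rightarrow>\<^sub>0 'k) module" where "V \<equiv> chen_module G cinf"

abbreviation a :: "('a, 'b, 'k) lpa" where "a \<equiv> lpa_class A"

lemma lpa_path_minus_one: "lpa_path G c \<ominus>\<^bsub>L\<^esub> \<one>\<^bsub>L\<^esub> = a"
proof -
  interpret L: ring L by (rule leavitt_path_algebra_ring)
  have "lpa_path G c = lpa_class z" by (simp add: lpa_path_def z_def)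
  also have "\<dots> = a \<oplus>\<^bsub>L\<^esub> \<one>\<^bsub>L\<^esub>" by (simp add: lpa_class_one lpa_class_hom A_def)
  finally show ?thesis
    using lpa_class_hom(1)[OF A_C A_C] by (simp add: L.minus_eq L.a_assoc L.r_neg)
qed

lemma class_power: "a [^]\<^bsub>L\<^esub> (n::nat) = lpa_class (A ^ n)"
proof (induction n)
  case (Suc n)
  have "a [^]\<^bsub>L\<^esub> Suc n = lpa_class (A ^ n) \<otimes>\<^bsub>L\<^esub> lpa_class A"
    using Suc by (simp add: nat_pow_def)
  also have "\<dots> = lpa_class (A ^ Suc n)"
    by (simp add: lpa_class_hom power_Suc2 del: power_Suc)
  finally show ?case .
qed (simp add: nat_pow_def lpa_class_one)

lemma class_in_principal_iff:
  assumes f: "f \<in> C" shows "lpa_class f \<in> PIdl\<^bsub>L\<^esub> (a [^]\<^bsub>L\<^esub> n) \<longleftrightarrow> f \<in> J n"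
proof -
  interpret L: ring L by (rule leavitt_path_algebra_ring)
  have iff: "lpa_class f = lpa_class r \<otimes>\<^bsub>L\<^esub> lpa_class (A ^ n) \<longleftrightarrow> f \<approx> r * A ^ n" if r: "r \<in> C" for r
    using f r by (simp add: lpa_class_hom lpa_class_eq_iff eqv_def)
  have "lpa_class f \<in> PIdl\<^bsub>L\<^esub> (a [^]\<^bsub>L\<^esub> n) \<longleftrightarrow>
      (\<exists>X\<in>carrier L. lpa_class f = X \<otimes>\<^bsub>L\<^esub> lpa_class (A ^ n))"
    by (simp only: class_power L.cgenideal_iff)
  also have "\<dots> \<longleftrightarrow> (\<exists>r\<in>C. f \<approx> r * A ^ n)"
  proof
    assume "\<exists>X\<in>carrier L. lpa_class f = X \<otimes>\<^bsub>L\<^esub> lpa_class (A ^ n)"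
    then obtain X where X: "X \<in> carrier L" "lpa_class f = X \<otimes>\<^bsub>L\<^esub> lpa_class (A ^ n)" by (elim bexE)
    from X(1) obtain r where "r \<in> C" "X = lpa_class r" by (rule lpa_classE)
    then show "\<exists>r\<in>C. f \<approx> r * A ^ n" using X(2) iff by (intro bexI[of _ r]) simp_all
  next
    assume "\<exists>r\<in>C. f \<approx> r * A ^ n"
    then obtain r where "r \<in> C" "f \<approx> r * A ^ n" by (elim bexE)
    then show "\<exists>X\<in>carrier L. lpa_class f = X \<otimes>\<^bsub>L\<^esub> lpa_class (A ^ n)"
      using iff lpa_class_hom(1)[of r r] by (intro bexI[of _ "lpa_class r"]) simp_all
  qed
  finally show ?thesis using f by (simp add: J_def)
qed

lemma class_in_principal_one_iff: "f \<in> C \<Longrightarrow> lpa_class f \<in> PIdl\<^bsub>L\<^esub> a \<longleftrightarrow> f \<in> J 1"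
  using class_in_principal_iff[of f 1] class_power[of 1] by simp

text \<open>Right cancellation comes from the grading, properness of the left ideal from the action
  on \<open>c^\<infinity>\<close>, and the last condition from the normal form.\<close>

lemma power_chain_lpa: "power_chain L a"
proof -
  interpret L: ring L by (rule leavitt_path_algebra_ring)
  show ?thesis
  proof (intro power_chain.intro power_chain_axioms.intro L.ring_axioms)
    show "a \<in> carrier L" by (rule lpa_class_hom(1)[OF A_C A_C])
  next
    fix X assume X: "X \<in> carrier L" and Xa: "X \<otimes>\<^bsub>L\<^esub> a = \<zero>\<^bsub>L\<^esub>"
    from X obtain y where y: "y \<in> C" "X = lpa_class y" by (rule lpa_classE)
    have "lpa_class (y * A) = lpa_class 0"
      using Xa y by (simp add: lpa_class_hom lpa_class_zero)
    then have "y * A \<approx> 0" using y(1) by (simp add: lpa_class_eq_iff eqv_def)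
    \<comment> \<open>\<open>y (c - 1) = 0\<close> in the form \<open>y c = y\<close>, to which the
      degree argument applies.\<close>
    then have "y * wd (map Edge c) \<approx> y" by (simp add: eqv_def A_def z_def right_diff_distrib)
    then have "y \<approx> 0"
      using awalk_c c_ne by (intro right_mult_path_minus_one_cancel) (auto simp: awalk_def)
    then show "X = \<zero>\<^bsub>L\<^esub>"
      unfolding y(2) lpa_class_zero using y(1) by (simp add: lpa_class_eq_iff eqv_def)
  next
    show "\<one>\<^bsub>L\<^esub> \<notin> PIdl\<^bsub>L\<^esub> a"
      using class_in_principal_one_iff[of 1] one_notin_J1 by (simp add: lpa_class_one)
  next
    fix N and n :: nat
    assume N: "submodule N L (regular_module L)" and an: "a [^]\<^bsub>L\<^esub> n \<in> N" and not: "\<not> N \<subseteq> PIdl\<^bsub>L\<^esub> a"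
    have N': "N \<subseteq> carrier L" "\<zero>\<^bsub>L\<^esub> \<in> N" "\<And>x y. x \<in> N \<Longrightarrow> y \<in> N \<Longrightarrow> x \<oplus>\<^bsub>L\<^esub> y \<in> N"
      "\<And>b x. b \<in> carrier L \<Longrightarrow> x \<in> N \<Longrightarrow> b \<otimes>\<^bsub>L\<^esub> x \<in> N"
      using N unfolding L.submodule_regular_iff by auto
    let ?N = "{f \<in> C. lpa_class f \<in> N}"
    obtain X where X: "X \<in> N" "X \<notin> PIdl\<^bsub>L\<^esub> a" using not by (auto simp only: subset_eq)
    have "X \<in> carrier L" using N'(1) X(1) by (rule subsetD)
    then obtain f where f: "f \<in> C" "X = lpa_class f" by (rule lpa_classE)
    have "1 \<in> ?N"
    proof (rule local_modulo_power)
      show "?N \<subseteq> C" by auto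
      show "g + h \<in> ?N" if "g \<in> ?N" "h \<in> ?N" for g h
        using that N'(3)[of "lpa_class g" "lpa_class h"] by (simp add: lpa_class_hom)
      show "g * h \<in> ?N" if "g \<in> C" "h \<in> ?N" for g h
        using that N'(4)[of "lpa_class g" "lpa_class h"] by (simp add: lpa_class_hom)
      show "g \<in> ?N" if g: "g \<approx> 0" for g
      proof -
        have gC: "g \<in> C" using eqv_C[OF g] by simp
        then have "lpa_class g = \<zero>\<^bsub>L\<^esub>"
          using g by (simp add: lpa_class_zero lpa_class_eq_iff eqv_def)
        then show ?thesis using gC N'(2) by simp
      qed
      show "A ^ n \<in> ?N" using an by (simp add: class_power)
      show "f \<in> ?N" using f X(1) by simp
      show "f \<notin> J 1" using f X(2) class_in_principal_one_iff by simp
    qed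
    then show "\<one>\<^bsub>L\<^esub> \<in> N" by (simp add: lpa_class_one)
  qed
qed

text \<open>The map \<open>X \<mapsto> X c^\<infinity>\<close>, whose kernel is
  \<open>L (c - 1)\<close>; it identifies the composition factors with the Chen module.\<close>

abbreviation orbit_map :: "('a, 'b, 'k) lpa \<Rightarrow> 'b stream \<Rightarrow>\<^sub>0 'k" where
  "orbit_map \<equiv> \<lambda>X. X \<odot>\<^bsub>V\<^esub> x0"

lemma x0_carrier: "x0 \<in> carrier V"
  using cinf_tail_class by (simp add: chen_module_def)

lemma orbit_map_hom: "orbit_map \<in> left_module_hom L (regular_module L) V"
proof -
  interpret V: left_module L V by (rule left_module_chen)
  show ?thesis
    unfolding left_module_hom_def
    using V.smult_closed[OF _ x0_carrier] V.smult_l_distr[OF _ _ x0_carrier] V.smult_assoc[OF _ _ x0_carrier]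
    by (simp add: regular_module_def)
qed

lemma orbit_map_surj: "orbit_map ` carrier L = carrier V"
proof
  interpret V: left_module L V by (rule left_module_chen)
  show "orbit_map ` carrier L \<subseteq> carrier V" using V.smult_closed[OF _ x0_carrier] by blast
  show "carrier V \<subseteq> orbit_map ` carrier L"
  proof
    fix x assume "x \<in> carrier V"
    then have "Poly_Mapping.keys x \<subseteq> tail_class G cinf" by (simp add: chen_module_def)
    then obtain f where f: "f \<in> C" "free_act G f x0 = x" by (rule act_surj)
    then have "x = orbit_map (lpa_class f)" by (simp add: chen_smult[OF f(1) x0_carrier])
    then show "x \<in> orbit_map ` carrier L" using lpa_class_hom(1)[OF f(1) f(1)] by (rule image_eqI)
  qed
qed

lemma orbit_map_kernel:
  assumes "X \<in> carrier L" shows "orbit_map X = \<zero>\<^bsub>V\<^esub> \<longleftrightarrow> X \<in> PIdl\<^bsub>L\<^esub> a"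
proof -
  from assms obtain f where f: "f \<in> C" "X = lpa_class f" by (rule lpa_classE)
  have "\<zero>\<^bsub>V\<^esub> = 0" by (simp add: chen_module_def)
  then show ?thesis
    using f chen_smult[OF f(1) x0_carrier] J1_iff[OF f(1)] class_in_principal_one_iff[OF f(1)] by simp
qed

end

theorem theorem5p4:
  fixes E :: "('v, 'e) pre_digraph" and c :: "'e list"
    and L :: "('v, 'e, 'k::field) lpa ring"
  assumes "fin_digraph E" and "basic_closed_path E c"
    and "L = leavitt_path_algebra E"
  shows "(\<forall>n\<ge>1. let M = power_quot L (lpa_path E c \<ominus>\<^bsub>L\<^esub> \<one>\<^bsub>L\<^esub>) n in
            left_module L M \<and>
            (\<exists>!Ns. composition_series L M Ns) \<and>
            (\<forall>Ns. composition_series L M Ns \<longrightarrow>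
              (\<forall>i. Suc i < length Ns \<longrightarrow>
                left_module_isomorphic L (chain_factor M Ns i) (chen_module E (cycle c))))) \<and>
         (let U = pruefer_module L (lpa_path E c \<ominus>\<^bsub>L\<^esub> \<one>\<^bsub>L\<^esub>) in
            left_module L U \<and> uniserial_module L U \<and> artinian_module L U \<and> \<not> noetherian_module L U)"
proof -
  interpret E: fin_digraph E by fact
  interpret C: lpa_cycle E "TYPE('k)" c
    by unfold_locales (rule assms(2))
  have a: "lpa_path E c \<ominus>\<^bsub>L\<^esub> \<one>\<^bsub>L\<^esub> = C.a" unfolding assms(3) by (rule C.lpa_path_minus_one)
  interpret P: power_chain L C.a unfolding assms(3) by (rule C.power_chain_lpa)
  have V: "left_module L (chen_module E (cycle c))"
    unfolding assms(3) by (rule E.left_module_chen)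
  note hom = C.orbit_map_hom[folded assms(3)] and surj = C.orbit_map_surj[folded assms(3)]
    and ker = C.orbit_map_kernel[folded assms(3)]
  have series: "\<exists>!Ns. composition_series L (power_quot L C.a n) Ns" for n
    unfolding P.composition_series_power_quot by (rule ex1I, rule refl)
  show ?thesis
    unfolding a Let_def
  proof (intro conjI allI impI)
    fix n :: nat
    show "left_module L (power_quot L C.a n)" by (rule P.left_module_power_quot)
    show "\<exists>!Ns. composition_series L (power_quot L C.a n) Ns" by (rule series)
    fix Ns i assume "composition_series L (power_quot L C.a n) Ns" "Suc i < length Ns"
    then show "left_module_isomorphic L (chain_factor (power_quot L C.a n) Ns i) (chen_module E (cycle c))"
      by (intro P.composition_factor_isomorphic[OF V hom surj] ker)
  qed (rule P.left_module_pruefer P.uniserial_pruefer P.artinian_pruefer P.not_noetherian_pruefer)+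
qed

end
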